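(* Assume that $p(\cdot\,|x,a)$ is weakly continuous in $(x,a)$; that $c(\cdot,a)$ is $K_c$-Lipschitz and $d_l(\cdot,a)$ is $K_l$-Lipschitz on $\mathsf X$ for all $a\in\mathsf A$ and $l=1,\dots,q$; and that for some constant $K_p$ with $K_p\beta<1$, $$W_1\bigl(p(\cdot\,|x,a),p(\cdot\,|y,a)\bigr)\le K_p\,d_{\mathsf X}(x,y)\quad\text{for all }x,y\in\mathsf X,\ a\in\mathsf A .$$ Then, for the discounted cost criterion, $$\bigl|\min(\mathbf{CP}_n^{\mathbf k})-\min(\mathbf{CP}^{\mathbf k})\bigr|\le Y_v\,(1/n)^{1/d},\qquad Y_v=\frac{4\alpha\,(K_c+qK\max_{l}K_l)}{1-\beta K_p},$$ where $K=2\|c\|/\min_{l=1,\dots,q}\alpha'_l$ and $\alpha$ is the quantization constant of the grids $\mathsf X_n$.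
   Context: **Model.** $\mathsf X$ (states) is a compact subset of $\mathbb R^d$, $d\ge1$, with Euclidean distance $d_{\mathsf X}$; $\mathsf A$ (actions) is a compact metric space; every action is admissible in every state. $p(\cdot\,|x,a)$ is a stochastic kernel on $\mathsf X$ given $\mathsf X\times\mathsf A$ (transition probability); $c,d_1,\dots,d_q:\mathsf X\times\mathsf A\to[0,\infty)$ are continuous; $\gamma$ is a probability measure on $\mathsf X$ (initial distribution); $\mathbf k=(k_1,\dots,k_q)\in[0,\infty)^q$. A policy $\pi=\{\pi_t\}$ is a sequence of stochastic kernels on $\mathsf A$ given the history spaces $\mathsf H_t=(\mathsf X\times\mathsf A)^t\times\mathsf X$; $\Pi$ is the set of all policies. $\mathbb E_\gamma^\pi$ is expectation under the law of $(X_t,A_t)_{t\ge0}$ determined by $\gamma$, $\pi$, $p$. $\|\cdot\|$ is the sup norm; $W_1$ is the Wasserstein distance of order 1. **Discounted criterion.** Fix $\beta\in(0,1)$. $J(\pi,\gamma)=(1-\beta)\mathbb E_\gamma^\pi[\sum_{t\ge0}\beta^tc(X_t,A_t)]$, and $J_l(\pi,\gamma)$ is the same with $d_l$ in place of $c$. $(\mathbf{CP}^{\mathbf k})$: minimize $J(\pi,\gamma)$ over $\pi\in\Pi$ subject to $J_l(\pi,\gamma)\le k_l$, $l=1,\dots,q$. Standing assumption: there are $\pi\in\Pi$ and $\boldsymbol\alpha'=(\alpha_1',\dots,\alpha_q')$ with all $\alpha'_l>0$ such that $J_l(\pi,\gamma)+\alpha'_l=k_l$ for all $l$; this $\boldsymbol\alpha'$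 is fixed. **Finite models.** $\alpha>0$ is a constant (the quantization constant) and, for each $n\ge1$, $\mathsf X_n=\{x_{n,1},\dots,x_{n,n}\}\subset\mathsf X$ is a set of cardinality $n$ with $\max_{x\in\mathsf X}\min_{y\in\mathsf X_n}d_{\mathsf X}(x,y)\le\alpha(1/n)^{1/d}$. $Q_n:\mathsf X\to\mathsf X_n$ is a nearest-point map (ties broken so that $Q_n$ is measurable); $\mathcal S_{n,i}=Q_n^{-1}(x_{n,i})$. $\nu_n$ is a measure on $\mathsf X$ with $\nu_n(\mathcal S_{n,i})>0$ for all $i$, and $\nu_{n,i}(\cdot)=\nu_n(\cdot)/\nu_n(\mathcal S_{n,i})$ is the probability measure on $\mathcal S_{n,i}$ obtained by restricting and normalizing $\nu_n$. MDP$_n$ has state space $\mathsf X_n$, action space $\mathsf A$, initial distribution $\gamma_n=\gamma\circ Q_n^{-1}$, and $p_n(x_{n,j}|x_{n,i},a)=\int_{\mathcal S_{n,i}}p(\mathcal S_{n,j}|x,a)\,\nu_{n,i}(dx)$, $c_n(x_{n,i},a)=\int_{\mathcal S_{n,i}}c(x,a)\,\nu_{n,i}(dx)$, $d_{l,n}(x_{n,i},a)=\int_{\mathcal S_{n,i}}d_l(x,a)\,\nu_{n,i}(dx)$. Its policies $\Pi_n$ and discounted costs $J_n,J_{l,n}$ are defined as for the original model. $(\mathbf{CP}_n^{\mathbf k})$: minimize $J_n(\pi,\gamma_n)$ over $\pi\in\Pi_n$ subject to $J_{l,n}(\pi,\gamma_n)\le k_l$ for all $l$. $\min(\cdot)$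 denotes the optimal value.
   Formalization: The bound is stated for every n at which (CP_n^k) is feasible, and feasibility is shown for all sufficiently large n; for small n (CP_n^k) can be infeasible, so that min(CP_n^k) is undefined. Cells are also taken to have finite ν_n-mass, so that normalization makes sense. *)

theory Defs
  imports "HOL-Probability.Probability"
begin

text \<open>
  A constrained Markov decision process in which every action is admissible in every state.
  The constraint costs are \<open>ccost M 1, ..., ccost M q\<close>; the number \<open>q\<close> of constraints is passed
  separately.
\<close>

record ('s, 'a) cmdp =
  states :: "'s measure"
  actions :: "'a measure"
  init :: "'s measure"
  trans :: "'s \<times> 'a \<Rightarrow> 's measure"
  cost :: "'s \<times> 'a \<Rightarrow> real"
  ccost :: "nat \<Rightarrow> 's \<times> 'a \<Rightarrow> real"

abbreviation steps :: "('s, 'a) cmdp \<Rightarrow> ('s \<times> 'a) measure" where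
  "steps M \<equiv> states M \<Otimes>\<^sub>M actions M"

text \<open>
  An element of the history space at time \<open>t\<close> is a pair \<open>(h, x)\<close>: \<open>h\<close> lists the state-action pairs at
  the times \<open>0, ..., t - 1\<close> and \<open>x\<close> is the state at time \<open>t\<close>.
\<close>

definition histories :: "('s, 'a) cmdp \<Rightarrow> nat \<Rightarrow> ((nat \<Rightarrow> 's \<times> 'a) \<times> 's) measure" where
  "histories M t = (\<Pi>\<^sub>M i\<in>{0..<t}. steps M) \<Otimes>\<^sub>M states M"

type_synonym ('s, 'a) policy = "nat \<Rightarrow> (nat \<Rightarrow> 's \<times> 'a) \<times> 's \<Rightarrow> 'a measure"

definition policies :: "('s, 'a) cmdp \<Rightarrow> ('s, 'a) policy set" where
  "policies M = {\<pi>. \<forall>t. \<pi> t \<in> histories M t \<rightarrow>\<^sub>M prob_algebra (actions M)}"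

text \<open>The conditional law of \<open>(X\<^sub>t, A\<^sub>t)\<close> given the state-action pairs before time \<open>t\<close>.\<close>

definition step_kernel ::
  "('s, 'a) cmdp \<Rightarrow> ('s, 'a) policy \<Rightarrow> nat \<Rightarrow> (nat \<Rightarrow> 's \<times> 'a) \<Rightarrow> ('s \<times> 'a) measure" where
  "step_kernel M \<pi> t h =
     (if t = 0 then init M else trans M (h (t - 1))) \<bind>
       (\<lambda>x. \<pi> t (h, x) \<bind> (\<lambda>a. return (steps M) (x, a)))"

text \<open>
  The law of \<open>(X\<^sub>t, A\<^sub>t)\<^sub>t\<close>: the measure that the Ionescu-Tulcea theorem constructs from the
  kernels above.
\<close>

definition law :: "('s, 'a) cmdp \<Rightarrow> ('s, 'a) policy \<Rightarrow> (nat \<Rightarrow> 's \<times> 'a) measure" where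
  "law M \<pi> =
     projective_family.lim UNIV (Ionescu_Tulcea.CI (step_kernel M \<pi>) (\<lambda>_. steps M)) (\<lambda>_. steps M)"

definition discounted_cost ::
  "real \<Rightarrow> ('s, 'a) cmdp \<Rightarrow> ('s \<times> 'a \<Rightarrow> real) \<Rightarrow> ('s, 'a) policy \<Rightarrow> real" where
  "discounted_cost \<beta> M f \<pi> = (1 - \<beta>) * (\<integral>\<omega>. (\<Sum>t. \<beta> ^ t * f (\<omega> t)) \<partial>law M \<pi>)"

definition feasible_policies ::
  "real \<Rightarrow> ('s, 'a) cmdp \<Rightarrow> nat \<Rightarrow> (nat \<Rightarrow> real) \<Rightarrow> ('s, 'a) policy set" where
  "feasible_policies \<beta> M q k =
     {\<pi> \<in> policies M. \<forall>l\<in>{1..q}. discounted_cost \<beta> M (ccost M l) \<pi> \<le> k l}"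

text \<open>
  The optimal value is meaningful only if there is a feasible policy: the infimum of the empty set
  of reals is an unspecified number.
\<close>

definition optimal_value ::
  "real \<Rightarrow> ('s, 'a) cmdp \<Rightarrow> nat \<Rightarrow> (nat \<Rightarrow> real) \<Rightarrow> real" where
  "optimal_value \<beta> M q k =
     (INF \<pi>\<in>feasible_policies \<beta> M q k. discounted_cost \<beta> M (cost M) \<pi>)"

definition couplings :: "'s measure \<Rightarrow> 's measure \<Rightarrow> 's measure \<Rightarrow> ('s \<times> 's) measure set" where
  "couplings S \<mu> \<nu> =
     {\<eta> \<in> space (prob_algebra (S \<Otimes>\<^sub>M S)). distr \<eta> S fst = \<mu> \<and> distr \<eta> S snd = \<nu>}"

text \<open>Real-valued; to be used for probability measures on a bounded space \<open>S\<close>.\<close>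

definition wasserstein1 :: "'s::metric_space measure \<Rightarrow> 's measure \<Rightarrow> 's measure \<Rightarrow> real" where
  "wasserstein1 S \<mu> \<nu> = (INF \<eta>\<in>couplings S \<mu> \<nu>. \<integral>z. dist (fst z) (snd z) \<partial>\<eta>)"

definition weakly_continuous_kernel ::
  "'s::topological_space set \<Rightarrow> 'z::topological_space set \<Rightarrow> ('z \<Rightarrow> 's measure) \<Rightarrow> bool" where
  "weakly_continuous_kernel X Z p \<longleftrightarrow>
     (\<forall>u::'s \<Rightarrow> real. continuous_on X u \<and> bounded (u ` X) \<longrightarrow>
        continuous_on Z (\<lambda>z. \<integral>y. u y \<partial>p z))"

definition nearest_point_map ::
  "'s::metric_space measure \<Rightarrow> 's set \<Rightarrow> ('s \<Rightarrow> 's) \<Rightarrow> bool" where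
  "nearest_point_map S G Q \<longleftrightarrow>
     Q \<in> S \<rightarrow>\<^sub>M count_space G \<and> (\<forall>x\<in>space S. \<forall>y\<in>G. dist x (Q x) \<le> dist x y)"

definition cell :: "'s measure \<Rightarrow> ('s \<Rightarrow> 's) \<Rightarrow> 's \<Rightarrow> 's set" where
  "cell S Q y = Q -` {y} \<inter> space S"

text \<open>
  The quantized model with state space \<open>G\<close>; \<open>uniform_measure \<nu> C\<close> is \<open>\<nu>\<close> restricted to \<open>C\<close> and
  normalized. The new state space is indexed by the grid points themselves.
\<close>

definition finite_model ::
  "('s, 'a) cmdp \<Rightarrow> 's set \<Rightarrow> ('s \<Rightarrow> 's) \<Rightarrow> 's measure \<Rightarrow> ('s, 'a) cmdp" where
  "finite_model M G Q \<nu> =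
     (let S = cell (states M) Q;
          avg = (\<lambda>f (x, a). \<integral>z. f (z, a) \<partial>uniform_measure \<nu> (S x))
      in \<lparr> states = count_space G,
           actions = actions M,
           init = distr (init M) (count_space G) Q,
           trans = (\<lambda>xa. point_measure G (\<lambda>y. ennreal (avg (\<lambda>za. measure (trans M za) (S y)) xa))),
           cost = avg (cost M),
           ccost = (\<lambda>l. avg (ccost M l)) \<rparr>)"

end

theory Submission
  imports Defs
begin

text \<open>
  Let \<open>\<delta> = \<alpha> (1/n)\<^sup>1\<^sup>/\<^sup>d\<close>, so that every state is within \<open>\<delta>\<close> of its grid point.

  \<^bold>\<open>One cost.\<close> For a cost \<open>f\<close> that is \<open>K\<close>-Lipschitz in the state, value iteration started at \<open>0\<close>
  stays within the functions with Lipschitz constant \<open>L = K / (1 - \<beta> K\<^sub>p)\<close>: integrating such a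
  function against \<open>p(\<cdot>|x,a)\<close> gives a \<open>K\<^sub>p L\<close>-Lipschitz function of \<open>x\<close> by the easy half of Kantorovich
  duality (\<open>wasserstein1_dual_bound\<close>), and \<open>K + \<beta> K\<^sub>p L = L\<close>.  So there is an \<open>L\<close>-Lipschitz \<open>v\<close> that
  solves the optimality equation of the original model up to any given error
  (\<open>almost_optimality_equation\<close>).  The same \<open>v\<close>, restricted to the grid, solves the optimality equation
  of the finite model up to \<open>(1 + \<beta>) L \<delta>\<close> (\<open>grid_Q_value\<close>): averaging over a cell moves the state by at
  most \<open>\<delta>\<close>, and so does rounding the successor state.  A function that satisfies the optimality
  equation as an inequality bounds the discounted cost of every policy from below, respectively that of
  a stationary selector policy from above.  Comparing both models with \<open>v\<close> therefore matches each
  policy of one model by a policy of the other whose normalized discounted \<open>f\<close>-cost is larger by at most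
  \<open>2 \<delta> L\<close> plus an arbitrarily small amount.

  \<^bold>\<open>All costs.\<close> The matching policy depends on \<open>f\<close>, but constraints need one policy that is good for
  \<open>c, d\<^sub>1, ..., d\<^sub>q\<close> simultaneously.  The attainable vectors of discounted costs form a convex set
  (\<open>policy_mixture\<close>: the mixture of two path laws is the law of a policy that mixes the two action
  distributions with the posterior weights given the history).  By the minimax lemma
  \<open>convexlike_minimax\<close> it is then enough to match every nonnegative combination of the costs, and such a
  combination is again a Lipschitz cost to which the first part applies (\<open>simultaneous_transfer\<close>).

  \<^bold>\<open>Constraints.\<close> After a transfer the constraints may be violated by \<open>\<eta> = 2 \<delta> max K\<^sub>l / (1 - \<beta> K\<^sub>p)\<close>.
  Mixing with the given policy of slack \<open>m = min \<alpha>'\<^sub>l\<close>, with weight \<open>\<eta> / m\<close>, restores feasibility and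
  raises the cost by at most \<open>\<parallel>c\<parallel> \<eta> / m\<close>.  Hence the optimal values differ by at most
  \<open>2 \<delta> K\<^sub>c / (1 - \<beta> K\<^sub>p) + \<parallel>c\<parallel> \<eta> / m\<close>; if \<open>\<eta> \<ge> m\<close>, this bound already exceeds the range \<open>[0, \<parallel>c\<parallel>]\<close> of
  the values.  It is at most \<open>Y\<^sub>v (1/n)\<^sup>1\<^sup>/\<^sup>d\<close>, and the finite model is feasible as soon as \<open>\<eta> < m\<close>.
\<close>

section \<open>Laws of histories and steps\<close>

definition state_kernel :: "('s, 'a) cmdp \<Rightarrow> nat \<Rightarrow> (nat \<Rightarrow> 's \<times> 'a) \<Rightarrow> 's measure" where
  "state_kernel M t h = (if t = 0 then init M else trans M (h (t - 1)))"

text \<open>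
  The finite-dimensional laws of which \<open>law\<close> is the projective limit. The arguments
  \<open>0\<close> and \<open>undefined\<close> say that no step precedes time \<open>0\<close>.
\<close>

definition path_law :: "('s, 'a) cmdp \<Rightarrow> ('s, 'a) policy \<Rightarrow> nat \<Rightarrow> (nat \<Rightarrow> 's \<times> 'a) measure" where
  "path_law M \<pi> t = Ionescu_Tulcea.C (step_kernel M \<pi>) (\<lambda>_. steps M) 0 t (\<lambda>_. undefined)"

definition history_law ::
  "('s, 'a) cmdp \<Rightarrow> ('s, 'a) policy \<Rightarrow> nat \<Rightarrow> ((nat \<Rightarrow> 's \<times> 'a) \<times> 's) measure" where
  "history_law M \<pi> t =
     path_law M \<pi> t \<bind> (\<lambda>h. state_kernel M t h \<bind> (\<lambda>x. return (histories M t) (h, x)))"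

definition step_law :: "('s, 'a) cmdp \<Rightarrow> ('s, 'a) policy \<Rightarrow> nat \<Rightarrow> ('s \<times> 'a) measure" where
  "step_law M \<pi> t = distr (law M \<pi>) (steps M) (\<lambda>\<omega>. \<omega> t)"

locale cmdp_kernels =
  fixes M :: "('s, 'a) cmdp"
  assumes init_prob: "init M \<in> space (prob_algebra (states M))"
    and trans_kernel[measurable]: "trans M \<in> steps M \<rightarrow>\<^sub>M prob_algebra (states M)"
begin

lemma policy_kernel[measurable (raw)]:
  "\<pi> \<in> policies M \<Longrightarrow> \<pi> t \<in> histories M t \<rightarrow>\<^sub>M prob_algebra (actions M)"
  by (auto simp: policies_def)

lemma state_kernel_measurable[measurable]:
  "state_kernel M t \<in> (\<Pi>\<^sub>M i\<in>{0..<t}. steps M) \<rightarrow>\<^sub>M prob_algebra (states M)"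
proof (cases t)
  case 0
  then show ?thesis using init_prob by (simp add: state_kernel_def[abs_def])
next
  case (Suc s)
  then show ?thesis by (simp add: state_kernel_def[abs_def])
qed

lemma step_kernel_eq:
  "step_kernel M \<pi> t h =
     state_kernel M t h \<bind> (\<lambda>x. \<pi> t (h, x) \<bind> (\<lambda>a. return (steps M) (x, a)))"
  by (simp add: step_kernel_def state_kernel_def)

lemma policy_kernel_compose[measurable (raw)]:
  assumes "\<pi> \<in> policies M" "f \<in> N \<rightarrow>\<^sub>M (\<Pi>\<^sub>M i\<in>{0..<t}. steps M)" "g \<in> N \<rightarrow>\<^sub>M states M"
  shows "(\<lambda>w. \<pi> t (f w, g w)) \<in> N \<rightarrow>\<^sub>M prob_algebra (actions M)"
  using measurable_compose[OF measurable_Pair[OF assms(2,3)], of "\<pi> t"] policy_kernel[OF assms(1), of t]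
  by (simp add: histories_def)

lemma step_kernel_measurable:
  assumes [measurable]: "\<pi> \<in> policies M"
  shows "step_kernel M \<pi> t \<in> (\<Pi>\<^sub>M i\<in>{0..<t}. steps M) \<rightarrow>\<^sub>M prob_algebra (steps M)"
  unfolding step_kernel_eq[abs_def] by measurable

lemma Ionescu_Tulcea_step_kernel:
  assumes "\<pi> \<in> policies M"
  shows "Ionescu_Tulcea (step_kernel M \<pi>) (\<lambda>_. steps M)"
proof (rule Ionescu_Tulcea.intro)
  show "step_kernel M \<pi> i \<in> Pi\<^sub>M {0..<i} (\<lambda>_. steps M) \<rightarrow>\<^sub>M subprob_algebra (steps M)" for i
    by (rule measurable_prob_algebraD[OF step_kernel_measurable[OF assms]])
  show "x \<in> space (Pi\<^sub>M {0..<i} (\<lambda>_. steps M)) \<Longrightarrow> prob_space (step_kernel M \<pi> i x)" for i x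
    using measurable_space[OF step_kernel_measurable[OF assms]] by (auto simp: space_prob_algebra)
qed

lemma path_law_prob:
  assumes "\<pi> \<in> policies M"
  shows "path_law M \<pi> t \<in> space (prob_algebra (\<Pi>\<^sub>M i\<in>{0..<t}. steps M))"
proof -
  interpret Ionescu_Tulcea "step_kernel M \<pi>" "\<lambda>_. steps M"
    by (rule Ionescu_Tulcea_step_kernel[OF assms])
  show ?thesis
    using prob_space_C[of "\<lambda>_. undefined" 0 t] sets_C[of "\<lambda>_. undefined" 0 t]
    by (simp add: space_prob_algebra path_law_def)
qed

lemma sets_path_law[measurable_cong]:
  "\<pi> \<in> policies M \<Longrightarrow> sets (path_law M \<pi> t) = sets (\<Pi>\<^sub>M i\<in>{0..<t}. steps M)"
  using path_law_prob by (auto simp: space_prob_algebra)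

lemma history_law_prob:
  assumes [measurable]: "\<pi> \<in> policies M"
  shows "history_law M \<pi> t \<in> space (prob_algebra (histories M t))"
  unfolding history_law_def histories_def
  by (rule measurable_bind_prob_space[THEN measurable_space, of "\<lambda>_. path_law M \<pi> t" "count_space UNIV"
        "\<Pi>\<^sub>M i\<in>{0..<t}. steps M"])
     (use path_law_prob[OF assms] in \<open>auto, measurable\<close>)

lemma sets_history_law[measurable_cong]:
  "\<pi> \<in> policies M \<Longrightarrow> sets (history_law M \<pi> t) = sets (histories M t)"
  using history_law_prob by (auto simp: space_prob_algebra)

lemma nn_integral_history_law:
  assumes [measurable]: "\<pi> \<in> policies M" and g: "g \<in> borel_measurable (histories M t)"
  shows "(\<integral>\<^sup>+w. g w \<partial>history_law M \<pi> t) =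
    (\<integral>\<^sup>+h. (\<integral>\<^sup>+x. g (h, x) \<partial>state_kernel M t h) \<partial>path_law M \<pi> t)"
proof -
  note [measurable_cong] = sets_path_law[OF assms(1)]
  have g'[measurable]: "g \<in> borel_measurable ((\<Pi>\<^sub>M i\<in>{0..<t}. steps M) \<Otimes>\<^sub>M states M)"
    using g by (simp add: histories_def)
  have "(\<integral>\<^sup>+w. g w \<partial>history_law M \<pi> t) =
    (\<integral>\<^sup>+h. \<integral>\<^sup>+w. g w \<partial>(state_kernel M t h \<bind> (\<lambda>x. return (histories M t) (h, x))) \<partial>path_law M \<pi> t)"
    unfolding history_law_def histories_def
    by (intro nn_integral_bind[where B="(\<Pi>\<^sub>M i\<in>{0..<t}. steps M) \<Otimes>\<^sub>M states M"] g'
          measurable_prob_algebraD) measurable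
  also have "\<dots> = (\<integral>\<^sup>+h. (\<integral>\<^sup>+x. g (h, x) \<partial>state_kernel M t h) \<partial>path_law M \<pi> t)"
  proof (rule nn_integral_cong)
    fix h assume "h \<in> space (path_law M \<pi> t)"
    then have h[measurable]: "h \<in> space (\<Pi>\<^sub>M i\<in>{0..<t}. steps M)"
      using sets_path_law[OF assms(1), THEN sets_eq_imp_space_eq] by auto
    have K: "sets (state_kernel M t h) = sets (states M)"
      using measurable_space[OF state_kernel_measurable h] by (auto simp: space_prob_algebra)
    note [measurable_cong] = K
    have "(\<integral>\<^sup>+w. g w \<partial>(state_kernel M t h \<bind> (\<lambda>x. return (histories M t) (h, x)))) =
      (\<integral>\<^sup>+x. \<integral>\<^sup>+w. g w \<partial>return (histories M t) (h, x) \<partial>state_kernel M t h)"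
      unfolding histories_def
      by (intro nn_integral_bind[where B="(\<Pi>\<^sub>M i\<in>{0..<t}. steps M) \<Otimes>\<^sub>M states M"] g') measurable
    also have "\<dots> = (\<integral>\<^sup>+x. g (h, x) \<partial>state_kernel M t h)"
      using h sets_eq_imp_space_eq[OF K]
      by (intro nn_integral_cong nn_integral_return) (auto simp: histories_def space_pair_measure)
    finally show "(\<integral>\<^sup>+w. g w \<partial>(state_kernel M t h \<bind> (\<lambda>x. return (histories M t) (h, x)))) =
      (\<integral>\<^sup>+x. g (h, x) \<partial>state_kernel M t h)" .
  qed
  finally show ?thesis .
qed

lemma nn_integral_step_kernel:
  assumes [measurable]: "\<pi> \<in> policies M" and h[measurable]: "h \<in> space (\<Pi>\<^sub>M i\<in>{0..<t}. steps M)"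
    and g[measurable]: "g \<in> borel_measurable (steps M)"
  shows "(\<integral>\<^sup>+z. g z \<partial>step_kernel M \<pi> t h) =
    (\<integral>\<^sup>+x. (\<integral>\<^sup>+a. g (x, a) \<partial>\<pi> t (h, x)) \<partial>state_kernel M t h)"
proof -
  have K: "sets (state_kernel M t h) = sets (states M)"
    using measurable_space[OF state_kernel_measurable h] by (auto simp: space_prob_algebra)
  note [measurable_cong] = K
  have "(\<integral>\<^sup>+z. g z \<partial>step_kernel M \<pi> t h) =
    (\<integral>\<^sup>+x. \<integral>\<^sup>+z. g z \<partial>(\<pi> t (h, x) \<bind> (\<lambda>a. return (steps M) (x, a))) \<partial>state_kernel M t h)"
    unfolding step_kernel_eq
    by (intro nn_integral_bind[where B="steps M"] g measurable_prob_algebraD) measurable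
  also have "\<dots> = (\<integral>\<^sup>+x. (\<integral>\<^sup>+a. g (x, a) \<partial>\<pi> t (h, x)) \<partial>state_kernel M t h)"
  proof (rule nn_integral_cong)
    fix x assume "x \<in> space (state_kernel M t h)"
    then have x[measurable]: "x \<in> space (states M)" using sets_eq_imp_space_eq[OF K] by auto
    have hx: "(h, x) \<in> space (histories M t)" using h x by (auto simp: histories_def space_pair_measure)
    have P: "sets (\<pi> t (h, x)) = sets (actions M)"
      using measurable_space[OF policy_kernel[OF assms(1)] hx] by (auto simp: space_prob_algebra)
    note [measurable_cong] = P
    have "(\<integral>\<^sup>+z. g z \<partial>(\<pi> t (h, x) \<bind> (\<lambda>a. return (steps M) (x, a)))) =
      (\<integral>\<^sup>+a. \<integral>\<^sup>+z. g z \<partial>return (steps M) (x, a) \<partial>\<pi> t (h, x))"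
      by (intro nn_integral_bind[where B="steps M"] g) measurable
    also have "\<dots> = (\<integral>\<^sup>+a. g (x, a) \<partial>\<pi> t (h, x))"
      using x sets_eq_imp_space_eq[OF P]
      by (intro nn_integral_cong nn_integral_return) (auto simp: space_pair_measure)
    finally show "(\<integral>\<^sup>+z. g z \<partial>(\<pi> t (h, x) \<bind> (\<lambda>a. return (steps M) (x, a)))) =
      (\<integral>\<^sup>+a. g (x, a) \<partial>\<pi> t (h, x))" .
  qed
  finally show ?thesis .
qed

lemma history_update_measurable[measurable]:
  "(\<lambda>((h, x), a). h(t := (x, a))) \<in> histories M t \<Otimes>\<^sub>M actions M \<rightarrow>\<^sub>M (\<Pi>\<^sub>M i\<in>{0..<Suc t}. steps M)"
  unfolding histories_def split_beta'
  by (rule measurable_fun_upd[where J="{0..<t}"]) auto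

text \<open>
  One step of the process, seen as: extend the history by the state, then draw the action.
  Together with the next lemmas it reduces statements about the infinite product to inductions
  over \<open>t\<close>.
\<close>

lemma nn_integral_path_law_Suc:
  assumes \<pi>[measurable]: "\<pi> \<in> policies M"
    and g[measurable]: "g \<in> borel_measurable (\<Pi>\<^sub>M i\<in>{0..<Suc t}. steps M)"
  shows "(\<integral>\<^sup>+h. g h \<partial>path_law M \<pi> (Suc t)) =
    (\<integral>\<^sup>+w. (\<integral>\<^sup>+a. g ((fst w)(t := (snd w, a))) \<partial>\<pi> t w) \<partial>history_law M \<pi> t)"
proof -
  interpret IT: Ionescu_Tulcea "step_kernel M \<pi>" "\<lambda>_. steps M"
    by (rule Ionescu_Tulcea_step_kernel[OF \<pi>])
  have sC[measurable_cong]: "sets (IT.C 0 t (\<lambda>_. undefined)) = sets (\<Pi>\<^sub>M i\<in>{0..<t}. steps M)"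
    using IT.sets_C[of "\<lambda>_. undefined" 0 t] by simp
  have eP: "IT.eP (0 + t) \<in> IT.C 0 t (\<lambda>_. undefined) \<rightarrow>\<^sub>M subprob_algebra (\<Pi>\<^sub>M i\<in>{0..<Suc t}. steps M)"
    using IT.measurable_eP[of t] by (simp cong: measurable_cong_sets add: sC)
  have upd[measurable]: "(\<lambda>w. g ((fst (fst w))(t := (snd (fst w), snd w))))
      \<in> borel_measurable (histories M t \<Otimes>\<^sub>M actions M)"
    using measurable_compose[OF history_update_measurable g] by (simp add: split_beta')
  have "(\<integral>\<^sup>+h. g h \<partial>path_law M \<pi> (Suc t)) = (\<integral>\<^sup>+h. \<integral>\<^sup>+h'. g h' \<partial>IT.eP t h \<partial>path_law M \<pi> t)"
    unfolding path_law_def IT.C.simps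
    by (subst nn_integral_bind[where B="\<Pi>\<^sub>M i\<in>{0..<Suc t}. steps M"]) (use eP in \<open>auto intro!: g\<close>)
  also have "\<dots> = (\<integral>\<^sup>+h. (\<integral>\<^sup>+x. (\<integral>\<^sup>+a. g (h(t := (x, a))) \<partial>\<pi> t (h, x)) \<partial>state_kernel M t h) \<partial>path_law M \<pi> t)"
  proof (rule nn_integral_cong)
    fix h assume "h \<in> space (path_law M \<pi> t)"
    then have h[measurable]: "h \<in> space (\<Pi>\<^sub>M i\<in>{0..<t}. steps M)"
      using sets_path_law[OF assms(1), THEN sets_eq_imp_space_eq] by auto
    have "(\<lambda>z. g (h(t := z))) \<in> borel_measurable (steps M)"
      by (rule measurable_compose[OF _ g], rule measurable_fun_upd[where J="{0..<t}"]) auto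
    then show "(\<integral>\<^sup>+h'. g h' \<partial>IT.eP t h) =
      (\<integral>\<^sup>+x. (\<integral>\<^sup>+a. g (h(t := (x, a))) \<partial>\<pi> t (h, x)) \<partial>state_kernel M t h)"
      by (simp add: IT.nn_integral_eP[OF h g] nn_integral_step_kernel[OF \<pi> h])
  qed
  also have "\<dots> = (\<integral>\<^sup>+w. (\<integral>\<^sup>+a. g ((fst w)(t := (snd w, a))) \<partial>\<pi> t w) \<partial>history_law M \<pi> t)"
    by (subst nn_integral_history_law[OF \<pi>])
       (auto intro!: nn_integral_measurable_subprob_algebra2[where N="actions M"] upd
          measurable_prob_algebraD[OF policy_kernel[OF \<pi>]] simp: split_beta')
  finally show ?thesis .
qed

lemma law_prob:
  assumes "\<pi> \<in> policies M"
  shows "law M \<pi> \<in> space (prob_algebra (\<Pi>\<^sub>M i\<in>UNIV. steps M))"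
proof -
  interpret IT: Ionescu_Tulcea "step_kernel M \<pi>" "\<lambda>_. steps M"
    by (rule Ionescu_Tulcea_step_kernel[OF assms])
  have "(\<lambda>\<omega>. restrict \<omega> {}) \<in> IT.PF.lim \<rightarrow>\<^sub>M (\<Pi>\<^sub>M i\<in>{}. steps M)"
    by (auto cong: measurable_cong_sets)
  then have "prob_space IT.PF.lim"
    by (rule prob_space_distrD) (simp add: IT.distr_lim IT.PF.prob_space_P)
  then show ?thesis
    unfolding law_def space_prob_algebra using IT.PF.sets_lim by auto
qed

lemma step_law_prob:
  assumes "\<pi> \<in> policies M"
  shows "step_law M \<pi> t \<in> space (prob_algebra (steps M))"
  using law_prob[OF assms] unfolding step_law_def space_prob_algebra
  by (auto intro!: prob_space.prob_space_distr cong: measurable_cong_sets)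

lemma sets_step_law[measurable_cong]:
  "sets (step_law M \<pi> t) = sets (steps M)"
  by (simp add: step_law_def)

text \<open>
  The coordinate at time \<open>t\<close> of the infinite law has the marginal given by the first
  \<open>t + 1\<close> kernels, by consistency of the projective family.
\<close>

lemma nn_integral_step_law_path:
  assumes \<pi>: "\<pi> \<in> policies M" and g[measurable]: "g \<in> borel_measurable (steps M)"
  shows "(\<integral>\<^sup>+z. g z \<partial>step_law M \<pi> t) = (\<integral>\<^sup>+h. g (h t) \<partial>path_law M \<pi> (Suc t))"
proof -
  interpret IT: Ionescu_Tulcea "step_kernel M \<pi>" "\<lambda>_. steps M"
    by (rule Ionescu_Tulcea_step_kernel[OF \<pi>])
  have sl[measurable_cong]: "sets (law M \<pi>) = sets (\<Pi>\<^sub>M i\<in>UNIV. steps M)"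
    using law_prob[OF \<pi>] by (auto simp: space_prob_algebra)
  have sc[measurable_cong]: "sets (IT.C 0 n (\<lambda>_. undefined)) = sets (\<Pi>\<^sub>M i\<in>{0..<n}. steps M)" for n
    using IT.sets_C[of "\<lambda>_. undefined" 0 n] by simp
  have up: "IT.up_to {0..<Suc t} = Suc t"
    unfolding IT.up_to_def by (rule Least_equality) (auto simp: not_less_eq_eq[symmetric])
  have "(\<integral>\<^sup>+z. g z \<partial>step_law M \<pi> t) = (\<integral>\<^sup>+\<omega>. g (restrict \<omega> {0..<Suc t} t) \<partial>law M \<pi>)"
    unfolding step_law_def by (subst nn_integral_distr) auto
  also have "\<dots> = (\<integral>\<^sup>+h. g (h t) \<partial>distr (law M \<pi>) (\<Pi>\<^sub>M i\<in>{0..<Suc t}. steps M) (\<lambda>\<omega>. restrict \<omega> {0..<Suc t}))"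
    by (subst nn_integral_distr) auto
  also have "\<dots> = (\<integral>\<^sup>+h. g (h t) \<partial>IT.CI {0..<Suc t})"
    unfolding law_def by (subst IT.distr_lim) auto
  also have "\<dots> = (\<integral>\<^sup>+h. g (restrict h {0..<Suc t} t) \<partial>path_law M \<pi> (Suc t))"
    unfolding IT.CI_def up path_law_def by (subst nn_integral_distr) (auto simp del: IT.C.simps)
  finally show ?thesis by simp
qed

lemma nn_integral_step_law:
  assumes \<pi>: "\<pi> \<in> policies M" and g[measurable]: "g \<in> borel_measurable (steps M)"
  shows "(\<integral>\<^sup>+z. g z \<partial>step_law M \<pi> t) =
    (\<integral>\<^sup>+w. (\<integral>\<^sup>+a. g (snd w, a) \<partial>\<pi> t w) \<partial>history_law M \<pi> t)"
  unfolding nn_integral_step_law_path[OF \<pi> g]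
  by (subst nn_integral_path_law_Suc[OF \<pi>]) auto

lemma nn_integral_step_law_fst:
  assumes \<pi>: "\<pi> \<in> policies M" and g[measurable]: "g \<in> borel_measurable (states M)"
  shows "(\<integral>\<^sup>+z. g (fst z) \<partial>step_law M \<pi> t) =
    (\<integral>\<^sup>+h. (\<integral>\<^sup>+x. g x \<partial>state_kernel M t h) \<partial>path_law M \<pi> t)"
proof -
  have "(\<integral>\<^sup>+z. g (fst z) \<partial>step_law M \<pi> t) =
      (\<integral>\<^sup>+w. (\<integral>\<^sup>+a. g (snd w) \<partial>\<pi> t w) \<partial>history_law M \<pi> t)"
    by (subst nn_integral_step_law[OF \<pi>]) auto
  also have "\<dots> = (\<integral>\<^sup>+w. g (snd w) \<partial>history_law M \<pi> t)"
  proof (rule nn_integral_cong)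
    fix w assume "w \<in> space (history_law M \<pi> t)"
    then have "w \<in> space (histories M t)"
      using sets_history_law[OF \<pi>, THEN sets_eq_imp_space_eq] by auto
    from measurable_space[OF policy_kernel[OF \<pi>] this]
    show "(\<integral>\<^sup>+a. g (snd w) \<partial>\<pi> t w) = g (snd w)"
      by (simp add: space_prob_algebra prob_space.emeasure_space_1)
  qed
  also have "\<dots> = (\<integral>\<^sup>+h. (\<integral>\<^sup>+x. g x \<partial>state_kernel M t h) \<partial>path_law M \<pi> t)"
    by (subst nn_integral_history_law[OF \<pi>]) (auto simp: histories_def)
  finally show ?thesis .
qed

lemma nn_integral_step_law_fst_0:
  assumes \<pi>: "\<pi> \<in> policies M" and g: "g \<in> borel_measurable (states M)"
  shows "(\<integral>\<^sup>+z. g (fst z) \<partial>step_law M \<pi> 0) = (\<integral>\<^sup>+x. g x \<partial>init M)"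
  using path_law_prob[OF \<pi>, of 0]
  by (simp add: nn_integral_step_law_fst[OF assms] state_kernel_def space_prob_algebra
      prob_space.emeasure_space_1)

text \<open>
  The Markov property of the transitions: the state at time \<open>t + 1\<close> is drawn from the
  transition kernel at the step of time \<open>t\<close>, whatever the policy.
\<close>

lemma nn_integral_step_law_fst_Suc:
  assumes \<pi>: "\<pi> \<in> policies M" and g[measurable]: "g \<in> borel_measurable (states M)"
  shows "(\<integral>\<^sup>+z. g (fst z) \<partial>step_law M \<pi> (Suc t)) =
    (\<integral>\<^sup>+z. (\<integral>\<^sup>+x. g x \<partial>trans M z) \<partial>step_law M \<pi> t)"
  by (subst nn_integral_step_law_path[OF \<pi>])
     (auto simp: nn_integral_step_law_fst[OF assms] state_kernel_def
       intro!: nn_integral_measurable_subprob_algebra2[where N="states M"]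
         measurable_prob_algebraD[OF trans_kernel])

end

section \<open>Mixtures of policies\<close>

definition mix :: "ennreal \<Rightarrow> 'z measure \<Rightarrow> 'z measure \<Rightarrow> 'z measure" where
  "mix r \<mu> \<nu> = measure_pmf (bernoulli_pmf (enn2real r)) \<bind> (\<lambda>b. if b then \<mu> else \<nu>)"

lemma nn_integral_mix:
  assumes "\<mu> \<in> space (prob_algebra N)" "\<nu> \<in> space (prob_algebra N)" "r \<le> 1"
    and [measurable]: "g \<in> borel_measurable N"
  shows "(\<integral>\<^sup>+z. g z \<partial>mix r \<mu> \<nu>) = r * (\<integral>\<^sup>+z. g z \<partial>\<mu>) + (1 - r) * (\<integral>\<^sup>+z. g z \<partial>\<nu>)"
proof -
  have r: "0 \<le> enn2real r" "enn2real r \<le> 1"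
    using assms(3) by (auto simp: enn2real_leI)
  have "r < top" using assms(3) by (simp add: order_le_less_trans)
  then have r': "ennreal (enn2real r) = r" by simp
  have r'': "ennreal (1 - enn2real r) = 1 - r"
    using r r' by (metis ennreal_1 ennreal_minus)
  have "\<mu> \<in> space (subprob_algebra N)" "\<nu> \<in> space (subprob_algebra N)"
    using assms(1,2) by (auto simp: space_prob_algebra space_subprob_algebra prob_space_imp_subprob_space)
  then have "(\<lambda>b. if b then \<mu> else \<nu>) \<in> measure_pmf (bernoulli_pmf (enn2real r)) \<rightarrow>\<^sub>M subprob_algebra N"
    by simp
  then show ?thesis
    unfolding mix_def using r
    by (subst nn_integral_bind[where B=N])
       (simp_all add: nn_integral_bernoulli_pmf r' r'' mult.commute)
qed

lemma mix_measurable: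
  assumes [measurable]: "f \<in> N \<rightarrow>\<^sub>M prob_algebra L" "g \<in> N \<rightarrow>\<^sub>M prob_algebra L"
    and [measurable]: "r \<in> borel_measurable N" and r: "\<And>w. r w \<le> 1"
  shows "(\<lambda>w. mix (r w) (f w) (g w)) \<in> N \<rightarrow>\<^sub>M prob_algebra L"
proof (rule measurable_prob_algebraI)
  have sp: "f w \<in> space (prob_algebra L)" "g w \<in> space (prob_algebra L)" if "w \<in> space N" for w
    using that measurable_space[OF assms(1)] measurable_space[OF assms(2)] by auto
  show p: "prob_space (mix (r w) (f w) (g w))" if "w \<in> space N" for w
    unfolding mix_def using sp[OF that] measure_pmf.prob_space_axioms
    by (intro prob_space.prob_space_bind[where S=L])
       (auto simp: space_prob_algebra space_subprob_algebra prob_space_imp_subprob_space)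
  have s: "sets (mix (r w) (f w) (g w)) = sets L" if "w \<in> space N" for w
    unfolding mix_def using sp[OF that]
    by (intro sets_bind) (auto simp: space_prob_algebra)
  show "(\<lambda>w. mix (r w) (f w) (g w)) \<in> N \<rightarrow>\<^sub>M subprob_algebra L"
  proof (rule measurable_subprob_algebra)
    fix A assume A[measurable]: "A \<in> sets L"
    have "emeasure (mix (r w) (f w) (g w)) A = r w * emeasure (f w) A + (1 - r w) * emeasure (g w) A"
      if w: "w \<in> space N" for w
      using nn_integral_mix[OF sp[OF w] r, of "indicator A" w] s[OF w] sp[OF w] by (simp add: space_prob_algebra)
    moreover have [measurable]: "f \<in> N \<rightarrow>\<^sub>M subprob_algebra L" "g \<in> N \<rightarrow>\<^sub>M subprob_algebra L"
      using assms(1,2) by (auto intro: measurable_prob_algebraD)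
    moreover have "(\<lambda>w. r w * emeasure (f w) A + (1 - r w) * emeasure (g w) A) \<in> borel_measurable N"
      by measurable
    ultimately show "(\<lambda>w. emeasure (mix (r w) (f w) (g w)) A) \<in> borel_measurable N"
      by (simp cong: measurable_cong)
  qed (use p s in \<open>auto intro: prob_space_imp_subprob_space\<close>)
qed

lemma complement_unique_ennreal: "a + b = (1::ennreal) \<Longrightarrow> b = 1 - a"
  using ennreal_add_diff_cancel_left[of a b] ennreal_add_eq_top[of a b] by force

text \<open>
  Bayes' rule: \<open>w\<close> is the posterior probability that a point drawn from the mixture
  came from the first component, that is, the density of \<open>a \<cdot> H1\<close> with respect
  to the mixture. Truncation at \<open>1\<close> changes it on a null set only, since the two
  component densities add up to \<open>1\<close> almost everywhere.
\<close>

lemma mixture_weight: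
  fixes a b :: ennreal
  assumes H1: "H1 \<in> space (prob_algebra N)" and H2: "H2 \<in> space (prob_algebra N)" and ab: "a + b = 1"
  obtains w where "w \<in> borel_measurable N" "\<And>x. w x \<le> 1"
    "\<And>g1 g2. g1 \<in> borel_measurable N \<Longrightarrow> g2 \<in> borel_measurable N \<Longrightarrow>
      (\<integral>\<^sup>+x. w x * g1 x + (1 - w x) * g2 x \<partial>mix a H1 H2) = a * (\<integral>\<^sup>+x. g1 x \<partial>H1) + b * (\<integral>\<^sup>+x. g2 x \<partial>H2)"
proof -
  have a: "a \<le> 1" unfolding ab[symmetric] by simp
  have b: "b = 1 - a" by (rule complement_unique_ennreal[OF ab])
  define \<eta> where "\<eta> = mix a H1 H2"
  have int: "(\<integral>\<^sup>+x. g x \<partial>\<eta>) = a * (\<integral>\<^sup>+x. g x \<partial>H1) + b * (\<integral>\<^sup>+x. g x \<partial>H2)"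
    if "g \<in> borel_measurable N" for g
    unfolding \<eta>_def using nn_integral_mix[OF H1 H2 a that] b by simp
  have "(\<lambda>w::unit. mix a H1 H2) \<in> count_space UNIV \<rightarrow>\<^sub>M prob_algebra N"
    by (rule mix_measurable) (use H1 H2 a in auto)
  from measurable_space[OF this, of "()"]
  have \<eta>: "\<eta> \<in> space (prob_algebra N)" by (simp add: \<eta>_def)
  interpret \<eta>: prob_space \<eta> using \<eta> by (simp add: space_prob_algebra)
  have sets[measurable_cong]: "sets \<eta> = sets N" "sets H1 = sets N" "sets H2 = sets N"
    using \<eta> H1 H2 by (auto simp: space_prob_algebra)
  have em: "emeasure \<eta> B = a * emeasure H1 B + b * emeasure H2 B" if "B \<in> sets N" for B
    using int[of "indicator B"] that by (simp add: sets)
  have ac: "absolutely_continuous \<eta> (scale_measure a H1)" "absolutely_continuous \<eta> (scale_measure b H2)"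
    unfolding absolutely_continuous_def by (auto simp: null_sets_def sets em)
  let ?r1 = "RN_deriv \<eta> (scale_measure a H1)" and ?r2 = "RN_deriv \<eta> (scale_measure b H2)"
  have r1: "(\<integral>\<^sup>+x. ?r1 x * g x \<partial>\<eta>) = a * (\<integral>\<^sup>+x. g x \<partial>H1)"
    and r2: "(\<integral>\<^sup>+x. ?r2 x * g x \<partial>\<eta>) = b * (\<integral>\<^sup>+x. g x \<partial>H2)" if [measurable]: "g \<in> borel_measurable N" for g
    using \<eta>.RN_deriv_nn_integral[OF ac(1), of g] \<eta>.RN_deriv_nn_integral[OF ac(2), of g]
    by (simp_all add: sets nn_integral_scale_measure)
  have "density \<eta> (\<lambda>x. ?r1 x + ?r2 x) = density \<eta> (\<lambda>_. 1)"
  proof (rule measure_eqI)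
    fix B assume B: "B \<in> sets (density \<eta> (\<lambda>x. ?r1 x + ?r2 x))"
    then have [measurable]: "B \<in> sets N" by (simp add: sets)
    have "emeasure (density \<eta> (\<lambda>x. ?r1 x + ?r2 x)) B = (\<integral>\<^sup>+x. ?r1 x * indicator B x + ?r2 x * indicator B x \<partial>\<eta>)"
      by (subst emeasure_density) (auto simp: distrib_right)
    also have "\<dots> = emeasure \<eta> B"
      by (subst nn_integral_add) (auto simp: r1 r2 em sets)
    finally show "emeasure (density \<eta> (\<lambda>x. ?r1 x + ?r2 x)) B = emeasure (density \<eta> (\<lambda>_. 1)) B"
      by (simp add: density_1)
  qed simp
  then have AE: "AE x in \<eta>. ?r1 x + ?r2 x = 1"
    by (subst (asm) \<eta>.density_unique_iff) auto
  define w where "w x = min 1 (?r1 x)" for x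
  show thesis
  proof
    show "w \<in> borel_measurable N" unfolding w_def[abs_def] by measurable
    show "w x \<le> 1" for x by (simp add: w_def)
    fix g1 g2 :: "_ \<Rightarrow> ennreal" assume [measurable]: "g1 \<in> borel_measurable N" "g2 \<in> borel_measurable N"
    have "(\<integral>\<^sup>+x. w x * g1 x + (1 - w x) * g2 x \<partial>\<eta>) = (\<integral>\<^sup>+x. ?r1 x * g1 x + ?r2 x * g2 x \<partial>\<eta>)"
    proof (rule nn_integral_cong_AE, use AE in eventually_elim)
      fix x assume eq: "?r1 x + ?r2 x = 1"
      then have "?r1 x \<le> 1" unfolding eq[symmetric] by simp
      moreover have "?r2 x = 1 - ?r1 x"
        by (rule complement_unique_ennreal[OF eq])
      ultimately show "w x * g1 x + (1 - w x) * g2 x = ?r1 x * g1 x + ?r2 x * g2 x"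
        by (simp add: w_def min_def)
    qed
    also have "\<dots> = a * (\<integral>\<^sup>+x. g1 x \<partial>H1) + b * (\<integral>\<^sup>+x. g2 x \<partial>H2)"
      by (subst nn_integral_add) (auto simp: r1 r2)
    finally show "(\<integral>\<^sup>+x. w x * g1 x + (1 - w x) * g2 x \<partial>mix a H1 H2) =
        a * (\<integral>\<^sup>+x. g1 x \<partial>H1) + b * (\<integral>\<^sup>+x. g2 x \<partial>H2)"
      unfolding \<eta>_def .
  qed
qed

text \<open>
  Tossing a coin at time \<open>0\<close> and then following one of two policies is not a policy
  in itself, because the coin is not part of the history. The policy that weights the two action
  distributions by the posterior probability of the coin given the history has the same law; this
  is shown by induction on the length of the history.
\<close>

lemma (in cmdp_kernels) policy_mixture:
  fixes a b :: ennreal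
  assumes \<pi>1: "\<pi>1 \<in> policies M" and \<pi>2: "\<pi>2 \<in> policies M" and ab: "a + b = 1"
  obtains \<pi> where "\<pi> \<in> policies M"
    "\<And>t g. g \<in> borel_measurable (steps M) \<Longrightarrow>
      (\<integral>\<^sup>+z. g z \<partial>step_law M \<pi> t) = a * (\<integral>\<^sup>+z. g z \<partial>step_law M \<pi>1 t) + b * (\<integral>\<^sup>+z. g z \<partial>step_law M \<pi>2 t)"
proof -
  let ?H1 = "history_law M \<pi>1" and ?H2 = "history_law M \<pi>2"
  have a: "a \<le> 1" unfolding ab[symmetric] by simp
  have b: "b = 1 - a" by (rule complement_unique_ennreal[OF ab])
  have "\<forall>t. \<exists>w. w \<in> borel_measurable (histories M t) \<and> (\<forall>x. w x \<le> 1) \<and>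
    (\<forall>(g1 :: _ \<Rightarrow> ennreal) (g2 :: _ \<Rightarrow> ennreal). g1 \<in> borel_measurable (histories M t) \<longrightarrow> g2 \<in> borel_measurable (histories M t) \<longrightarrow>
      (\<integral>\<^sup>+x. w x * g1 x + (1 - w x) * g2 x \<partial>mix a (?H1 t) (?H2 t)) =
        a * (\<integral>\<^sup>+x. g1 x \<partial>?H1 t) + b * (\<integral>\<^sup>+x. g2 x \<partial>?H2 t))"
    (is "\<forall>t. \<exists>w. ?P t w")
  proof
    fix t
    show "\<exists>w. ?P t w"
      by (rule mixture_weight[OF history_law_prob[OF \<pi>1, of t] history_law_prob[OF \<pi>2, of t] ab])
         (rule exI, intro conjI allI impI)
  qed
  from choice[OF this] obtain w where w_all: "\<And>t. ?P t (w t)" by auto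
  have w: "w t \<in> borel_measurable (histories M t)" "w t x \<le> 1" for t x
    using w_all[of t] by (blast, blast)
  have w_int: "(\<integral>\<^sup>+x. w t x * g1 x + (1 - w t x) * g2 x \<partial>mix a (?H1 t) (?H2 t)) =
        a * (\<integral>\<^sup>+x. g1 x \<partial>?H1 t) + b * (\<integral>\<^sup>+x. g2 x \<partial>?H2 t)"
    if "g1 \<in> borel_measurable (histories M t)" "g2 \<in> borel_measurable (histories M t)" for t g1 g2
    using w_all[of t] that by blast
  define \<pi> :: "('s, 'a) policy" where "\<pi> t h = mix (w t h) (\<pi>1 t h) (\<pi>2 t h)" for t h
  have \<pi>: "\<pi> \<in> policies M"
    unfolding policies_def \<pi>_def[abs_def]
    by (intro CollectI allI mix_measurable policy_kernel[OF \<pi>1] policy_kernel[OF \<pi>2] w)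
  have act: "(\<integral>\<^sup>+a. G a \<partial>\<pi> t h) = w t h * (\<integral>\<^sup>+a. G a \<partial>\<pi>1 t h) + (1 - w t h) * (\<integral>\<^sup>+a. G a \<partial>\<pi>2 t h)"
    if "h \<in> space (histories M t)" "G \<in> borel_measurable (actions M)" for t h and G
    unfolding \<pi>_def
    using measurable_space[OF policy_kernel[OF \<pi>1] that(1)] measurable_space[OF policy_kernel[OF \<pi>2] that(1)]
      w(2) that(2) by (rule nn_integral_mix)
  have step: "(\<integral>\<^sup>+h. (\<integral>\<^sup>+a. G h a \<partial>\<pi> t h) \<partial>history_law M \<pi> t) =
      a * (\<integral>\<^sup>+h. (\<integral>\<^sup>+a. G h a \<partial>\<pi>1 t h) \<partial>?H1 t) + b * (\<integral>\<^sup>+h. (\<integral>\<^sup>+a. G h a \<partial>\<pi>2 t h) \<partial>?H2 t)"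
    if eq: "\<And>g. g \<in> borel_measurable (histories M t) \<Longrightarrow>
       (\<integral>\<^sup>+h. g h \<partial>history_law M \<pi> t) = a * (\<integral>\<^sup>+h. g h \<partial>?H1 t) + b * (\<integral>\<^sup>+h. g h \<partial>?H2 t)"
      and G: "(\<lambda>(h, a). G h a) \<in> borel_measurable (histories M t \<Otimes>\<^sub>M actions M)" for t G
  proof -
    have Gm: "(\<lambda>h. \<integral>\<^sup>+a. G h a \<partial>\<pi>' t h) \<in> borel_measurable (histories M t)" if "\<pi>' \<in> policies M" for \<pi>'
      by (rule nn_integral_measurable_subprob_algebra2[OF G measurable_prob_algebraD[OF policy_kernel[OF that]]])
    note [measurable] = Gm[OF \<pi>1] Gm[OF \<pi>2] w(1)[of t]
    have Ga: "G h \<in> borel_measurable (actions M)" if "h \<in> space (histories M t)" for h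
      using measurable_compose[OF measurable_Pair1'[OF that] G] by simp
    let ?g = "\<lambda>h. w t h * (\<integral>\<^sup>+a. G h a \<partial>\<pi>1 t h) + (1 - w t h) * (\<integral>\<^sup>+a. G h a \<partial>\<pi>2 t h)"
    have "(\<integral>\<^sup>+h. (\<integral>\<^sup>+a. G h a \<partial>\<pi> t h) \<partial>history_law M \<pi> t) = (\<integral>\<^sup>+h. ?g h \<partial>history_law M \<pi> t)"
      using sets_eq_imp_space_eq[OF sets_history_law[OF \<pi>]]
      by (intro nn_integral_cong act Ga) auto
    also have "\<dots> = a * (\<integral>\<^sup>+h. ?g h \<partial>?H1 t) + b * (\<integral>\<^sup>+h. ?g h \<partial>?H2 t)"
      by (rule eq) measurable
    also have "\<dots> = (\<integral>\<^sup>+h. ?g h \<partial>mix a (?H1 t) (?H2 t))"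
      unfolding b by (rule nn_integral_mix[OF history_law_prob[OF \<pi>1] history_law_prob[OF \<pi>2] a, symmetric])
         measurable
    also have "\<dots> = a * (\<integral>\<^sup>+h. (\<integral>\<^sup>+a. G h a \<partial>\<pi>1 t h) \<partial>?H1 t) + b * (\<integral>\<^sup>+h. (\<integral>\<^sup>+a. G h a \<partial>\<pi>2 t h) \<partial>?H2 t)"
      by (rule w_int) measurable
    finally show ?thesis .
  qed
  have hist: "(\<integral>\<^sup>+h. g h \<partial>history_law M \<pi> t) = a * (\<integral>\<^sup>+h. g h \<partial>?H1 t) + b * (\<integral>\<^sup>+h. g h \<partial>?H2 t)"
    if "\<And>g. g \<in> borel_measurable (\<Pi>\<^sub>M i\<in>{0..<t}. steps M) \<Longrightarrow> (\<integral>\<^sup>+h. g h \<partial>path_law M \<pi> t) =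
       a * (\<integral>\<^sup>+h. g h \<partial>path_law M \<pi>1 t) + b * (\<integral>\<^sup>+h. g h \<partial>path_law M \<pi>2 t)"
      and g: "g \<in> borel_measurable (histories M t)" for t g
  proof -
    have [measurable]: "g \<in> borel_measurable ((\<Pi>\<^sub>M i\<in>{0..<t}. steps M) \<Otimes>\<^sub>M states M)"
      using g by (simp add: histories_def)
    have "(\<lambda>h. \<integral>\<^sup>+x. g (h, x) \<partial>state_kernel M t h) \<in> borel_measurable (\<Pi>\<^sub>M i\<in>{0..<t}. steps M)"
      by (rule nn_integral_measurable_subprob_algebra2[OF _ measurable_prob_algebraD[OF state_kernel_measurable]])
         simp
    then show ?thesis
      by (simp add: nn_integral_history_law[OF _ g] \<pi> \<pi>1 \<pi>2 that(1))
  qed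
  have path: "(\<integral>\<^sup>+h. g h \<partial>path_law M \<pi> t) = a * (\<integral>\<^sup>+h. g h \<partial>path_law M \<pi>1 t) + b * (\<integral>\<^sup>+h. g h \<partial>path_law M \<pi>2 t)"
    if "g \<in> borel_measurable (\<Pi>\<^sub>M i\<in>{0..<t}. steps M)" for t g
    using that
  proof (induction t arbitrary: g)
    case 0
    have "path_law M \<pi>' 0 = return (\<Pi>\<^sub>M i\<in>{0..<0}. steps M) (\<lambda>_. undefined)" if "\<pi>' \<in> policies M" for \<pi>'
    proof -
      interpret IT: Ionescu_Tulcea "step_kernel M \<pi>'" "\<lambda>_. steps M"
        by (rule Ionescu_Tulcea_step_kernel[OF that])
      show ?thesis unfolding path_law_def by simp
    qed
    with \<pi> \<pi>1 \<pi>2 have "path_law M \<pi> 0 = path_law M \<pi>1 0" "path_law M \<pi>2 0 = path_law M \<pi>1 0"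
      by auto
    then show ?case using ab by (simp flip: distrib_right)
  next
    case (Suc t)
    have "(\<lambda>(h, a'). g ((fst h)(t := (snd h, a')))) \<in> borel_measurable (histories M t \<Otimes>\<^sub>M actions M)"
      using measurable_compose[OF history_update_measurable Suc.prems] by (simp add: split_beta' fun_upd_def)
    then show ?case
      unfolding nn_integral_path_law_Suc[OF \<pi> Suc.prems] nn_integral_path_law_Suc[OF \<pi>1 Suc.prems]
        nn_integral_path_law_Suc[OF \<pi>2 Suc.prems]
      by (intro step hist Suc.IH)
  qed
  show thesis
  proof
    fix t and g :: "'s \<times> 'a \<Rightarrow> ennreal" assume g[measurable]: "g \<in> borel_measurable (steps M)"
    have "(\<lambda>(h, a'). g (snd h, a')) \<in> borel_measurable (histories M t \<Otimes>\<^sub>M actions M)"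
      unfolding histories_def by measurable
    then show "(\<integral>\<^sup>+z. g z \<partial>step_law M \<pi> t) = a * (\<integral>\<^sup>+z. g z \<partial>step_law M \<pi>1 t) + b * (\<integral>\<^sup>+z. g z \<partial>step_law M \<pi>2 t)"
      unfolding nn_integral_step_law[OF \<pi> g] nn_integral_step_law[OF \<pi>1 g] nn_integral_step_law[OF \<pi>2 g]
      by (intro step hist path)
  qed (rule \<pi>)
qed

section \<open>Discounted costs and the optimality inequalities\<close>

text \<open>
  Bounds are required on the state-action space only, since a cost may be arbitrary outside it.
\<close>

definition bounded_cost :: "('s, 'a) cmdp \<Rightarrow> real \<Rightarrow> ('s \<times> 'a \<Rightarrow> real) \<Rightarrow> bool" where
  "bounded_cost M B f \<longleftrightarrow>
     f \<in> borel_measurable (steps M) \<and> (\<forall>z\<in>space (steps M). 0 \<le> f z \<and> f z \<le> B)"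

lemma (in prob_space) integrable_nonneg_bounded:
  fixes f :: "'a \<Rightarrow> real"
  assumes "f \<in> borel_measurable M" "\<And>z. z \<in> space M \<Longrightarrow> 0 \<le> f z \<and> f z \<le> B"
  shows "integrable M f" "0 \<le> (\<integral>z. f z \<partial>M)" "(\<integral>z. f z \<partial>M) \<le> B"
proof -
  show int: "integrable M f"
    using assms by (intro integrable_const_bound[where B=B]) (auto simp: AE_I2)
  show "0 \<le> (\<integral>z. f z \<partial>M)"
    using assms by (intro integral_nonneg_AE AE_I2) auto
  have "(\<integral>z. f z \<partial>M) \<le> (\<integral>z. B \<partial>M)"
    using assms int by (intro integral_mono) auto
  then show "(\<integral>z. f z \<partial>M) \<le> B" by (simp add: prob_space)
qed

lemma geometric_series_bounded:
  fixes a :: "nat \<Rightarrow> real"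
  assumes "0 < \<beta>" "\<beta> < 1" "\<And>t. \<bar>a t\<bar> \<le> B"
  shows "summable (\<lambda>t. \<beta> ^ t * a t)"
proof (rule summable_comparison_test')
  show "summable (\<lambda>t. \<beta> ^ t * B)"
    using assms by (intro summable_mult2 summable_geometric) simp
  show "norm (\<beta> ^ t * a t) \<le> \<beta> ^ t * B" if "0 \<le> t" for t
    using assms by (simp add: abs_mult mult_left_mono)
qed

text \<open>
  The key identity: the discounted sum of the increments \<open>m t - \<beta> m (t + 1)\<close>
  collapses to its first term.
\<close>

lemma discounted_telescope:
  fixes m :: "nat \<Rightarrow> real"
  assumes "0 < \<beta>" "\<beta> < 1" "\<And>t. \<bar>m t\<bar> \<le> B"
  shows "(\<lambda>t. \<beta> ^ t * (m t - \<beta> * m (Suc t))) sums m 0"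
proof -
  have "summable (\<lambda>t. \<beta> ^ t * m t)" using assms by (rule geometric_series_bounded)
  then have "(\<lambda>t. \<beta> ^ t * m t) \<longlonglongrightarrow> 0" by (rule summable_LIMSEQ_zero)
  from telescope_sums'[OF this] show ?thesis by (simp add: algebra_simps)
qed

context cmdp_kernels
begin

lemma step_law_prob_space: "\<pi> \<in> policies M \<Longrightarrow> prob_space (step_law M \<pi> t)"
  using step_law_prob[of \<pi> t] by (simp add: space_prob_algebra)

lemma space_step_law: "space (step_law M \<pi> t) = space (steps M)"
  by (simp add: step_law_def)

lemma step_law_integral_bounded:
  assumes "\<pi> \<in> policies M" "bounded_cost M B f"
  shows "integrable (step_law M \<pi> t) f" "0 \<le> (\<integral>z. f z \<partial>step_law M \<pi> t)"
    "(\<integral>z. f z \<partial>step_law M \<pi> t) \<le> B"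
    "ennreal (\<integral>z. f z \<partial>step_law M \<pi> t) = (\<integral>\<^sup>+z. f z \<partial>step_law M \<pi> t)"
proof -
  interpret prob_space "step_law M \<pi> t" by (rule step_law_prob_space[OF assms(1)])
  have f: "f \<in> borel_measurable (step_law M \<pi> t)"
    "\<And>z. z \<in> space (step_law M \<pi> t) \<Longrightarrow> 0 \<le> f z \<and> f z \<le> B"
    using assms(2) by (auto simp: bounded_cost_def space_step_law cong: measurable_cong_sets)
  from integrable_nonneg_bounded[OF f]
  show *: "integrable (step_law M \<pi> t) f" "0 \<le> (\<integral>z. f z \<partial>step_law M \<pi> t)"
    "(\<integral>z. f z \<partial>step_law M \<pi> t) \<le> B" by auto
  show "ennreal (\<integral>z. f z \<partial>step_law M \<pi> t) = (\<integral>\<^sup>+z. f z \<partial>step_law M \<pi> t)"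
    by (rule nn_integral_eq_integral[symmetric, OF *(1)]) (use f in \<open>auto intro: AE_I2\<close>)
qed

lemma summable_discounted:
  assumes "0 < \<beta>" "\<beta> < 1" "\<pi> \<in> policies M" "bounded_cost M B f"
  shows "summable (\<lambda>t. \<beta> ^ t * (\<integral>z. f z \<partial>step_law M \<pi> t))"
  using assms(1,2) step_law_integral_bounded(2,3)[OF assms(3,4)]
  by (intro geometric_series_bounded[where B=B]) auto

lemma discounted_cost_eq:
  assumes \<beta>: "0 < \<beta>" "\<beta> < 1" and \<pi>: "\<pi> \<in> policies M" and f: "bounded_cost M B f"
  shows "discounted_cost \<beta> M f \<pi> = (1 - \<beta>) * (\<Sum>t. \<beta> ^ t * (\<integral>z. f z \<partial>step_law M \<pi> t))"
proof -
  interpret L: prob_space "law M \<pi>" using law_prob[OF \<pi>] by (simp add: space_prob_algebra)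
  have [measurable_cong]: "sets (law M \<pi>) = sets (\<Pi>\<^sub>M i\<in>UNIV. steps M)"
    using law_prob[OF \<pi>] by (simp add: space_prob_algebra)
  have fm[measurable]: "f \<in> borel_measurable (steps M)" using f by (simp add: bounded_cost_def)
  have sp: "\<omega> t \<in> space (steps M)" if "\<omega> \<in> space (law M \<pi>)" for \<omega> t
  proof -
    have "(\<lambda>\<omega>. \<omega> t) \<in> law M \<pi> \<rightarrow>\<^sub>M steps M" by measurable
    from measurable_space[OF this that] show ?thesis .
  qed
  have fb: "0 \<le> f (\<omega> t) \<and> f (\<omega> t) \<le> B" if "\<omega> \<in> space (law M \<pi>)" for \<omega> t
    using sp[OF that] f by (simp add: bounded_cost_def)
  have int: "integrable (law M \<pi>) (\<lambda>\<omega>. f (\<omega> t))" for t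
    by (rule L.integrable_nonneg_bounded[where B=B]) (use fb in auto)
  have distr: "(\<integral>\<omega>. f (\<omega> t) \<partial>law M \<pi>) = (\<integral>z. f z \<partial>step_law M \<pi> t)" for t
    unfolding step_law_def by (subst integral_distr) auto
  have "(\<integral>\<omega>. (\<Sum>t. \<beta> ^ t * f (\<omega> t)) \<partial>law M \<pi>) = (\<Sum>t. \<integral>\<omega>. \<beta> ^ t * f (\<omega> t) \<partial>law M \<pi>)"
  proof (rule integral_suminf)
    show "integrable (law M \<pi>) (\<lambda>\<omega>. \<beta> ^ t * f (\<omega> t))" for t using int by simp
    show "AE \<omega> in law M \<pi>. summable (\<lambda>t. norm (\<beta> ^ t * f (\<omega> t)))"
    proof (rule AE_I2)
      fix \<omega> assume "\<omega> \<in> space (law M \<pi>)"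
      with fb have "summable (\<lambda>t. \<beta> ^ t * \<bar>f (\<omega> t)\<bar>)"
        using \<beta> by (intro geometric_series_bounded[where B=B]) auto
      then show "summable (\<lambda>t. norm (\<beta> ^ t * f (\<omega> t)))" using \<beta> by (simp add: abs_mult)
    qed
    have "(\<integral>\<omega>. norm (\<beta> ^ t * f (\<omega> t)) \<partial>law M \<pi>) = \<beta> ^ t * (\<integral>z. f z \<partial>step_law M \<pi> t)" for t
    proof -
      have "(\<integral>\<omega>. norm (\<beta> ^ t * f (\<omega> t)) \<partial>law M \<pi>) = (\<integral>\<omega>. \<beta> ^ t * f (\<omega> t) \<partial>law M \<pi>)"
        by (rule Bochner_Integration.integral_cong) (use fb \<beta> in \<open>auto simp: abs_mult\<close>)
      then show ?thesis by (simp add: distr)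
    qed
    then show "summable (\<lambda>t. \<integral>\<omega>. norm (\<beta> ^ t * f (\<omega> t)) \<partial>law M \<pi>)"
      using summable_discounted[OF \<beta> \<pi> f] by simp
  qed
  then show ?thesis by (simp add: discounted_cost_def distr)
qed

lemma discounted_cost_bounds:
  assumes \<beta>: "0 < \<beta>" "\<beta> < 1" and \<pi>: "\<pi> \<in> policies M" and f: "bounded_cost M B f"
  shows "0 \<le> discounted_cost \<beta> M f \<pi>" "discounted_cost \<beta> M f \<pi> \<le> B"
proof -
  note * = step_law_integral_bounded(2,3)[OF \<pi> f]
  have "0 \<le> (\<Sum>t. \<beta> ^ t * (\<integral>z. f z \<partial>step_law M \<pi> t))"
    using * \<beta> by (intro suminf_nonneg summable_discounted[OF \<beta> \<pi> f]) simp
  then show "0 \<le> discounted_cost \<beta> M f \<pi>"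
    using \<beta> by (simp add: discounted_cost_eq[OF \<beta> \<pi> f])
  have "(\<Sum>t. \<beta> ^ t * (\<integral>z. f z \<partial>step_law M \<pi> t)) \<le> (\<Sum>t. \<beta> ^ t * B)"
    using * \<beta> by (intro suminf_le summable_discounted[OF \<beta> \<pi> f] summable_mult2 summable_geometric)
      (auto intro: mult_left_mono)
  also have "\<dots> = B / (1 - \<beta>)"
    using \<beta> by (subst suminf_mult2[symmetric]) (auto simp: suminf_geometric)
  finally show "discounted_cost \<beta> M f \<pi> \<le> B"
    using \<beta> by (simp add: discounted_cost_eq[OF \<beta> \<pi> f] field_simps)
qed

lemma discounted_cost_weighted_sum:
  fixes f :: "'i \<Rightarrow> 's \<times> 'a \<Rightarrow> real"
  assumes \<beta>: "0 < \<beta>" "\<beta> < 1" and \<pi>: "\<pi> \<in> policies M"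
    and f: "\<And>l. l \<in> I \<Longrightarrow> bounded_cost M (B l) (f l)"
    and w: "\<And>l. l \<in> I \<Longrightarrow> 0 \<le> w l"
  shows "bounded_cost M (\<Sum>l\<in>I. w l * B l) (\<lambda>z. \<Sum>l\<in>I. w l * f l z)"
    "discounted_cost \<beta> M (\<lambda>z. \<Sum>l\<in>I. w l * f l z) \<pi> = (\<Sum>l\<in>I. w l * discounted_cost \<beta> M (f l) \<pi>)"
proof -
  show b: "bounded_cost M (\<Sum>l\<in>I. w l * B l) (\<lambda>z. \<Sum>l\<in>I. w l * f l z)"
    using f w unfolding bounded_cost_def
    by (auto intro!: sum_nonneg sum_mono mult_left_mono borel_measurable_sum borel_measurable_times)
  have 1: "(\<integral>z. (\<Sum>l\<in>I. w l * f l z) \<partial>step_law M \<pi> t) = (\<Sum>l\<in>I. w l * (\<integral>z. f l z \<partial>step_law M \<pi> t))" for t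
    using step_law_integral_bounded(1)[OF \<pi> f]
    by (subst Bochner_Integration.integral_sum) auto
  have "(\<Sum>t. \<beta> ^ t * (\<Sum>l\<in>I. w l * (\<integral>z. f l z \<partial>step_law M \<pi> t))) =
      (\<Sum>t. \<Sum>l\<in>I. w l * (\<beta> ^ t * (\<integral>z. f l z \<partial>step_law M \<pi> t)))"
    by (simp add: sum_distrib_left mult.left_commute)
  also have "\<dots> = (\<Sum>l\<in>I. \<Sum>t. w l * (\<beta> ^ t * (\<integral>z. f l z \<partial>step_law M \<pi> t)))"
    by (rule suminf_sum) (intro summable_mult summable_discounted[OF \<beta> \<pi> f])
  also have "\<dots> = (\<Sum>l\<in>I. w l * (\<Sum>t. \<beta> ^ t * (\<integral>z. f l z \<partial>step_law M \<pi> t)))"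
    by (intro sum.cong refl suminf_mult summable_discounted[OF \<beta> \<pi> f])
  finally show "discounted_cost \<beta> M (\<lambda>z. \<Sum>l\<in>I. w l * f l z) \<pi> = (\<Sum>l\<in>I. w l * discounted_cost \<beta> M (f l) \<pi>)"
    by (simp add: discounted_cost_eq[OF \<beta> \<pi> b] discounted_cost_eq[OF \<beta> \<pi> f] 1 sum_distrib_left
        mult.left_commute)
qed

lemma discounted_cost_mixture:
  assumes \<beta>: "0 < \<beta>" "\<beta> < 1" and \<pi>1: "\<pi>1 \<in> policies M" and \<pi>2: "\<pi>2 \<in> policies M"
    and \<theta>: "0 \<le> \<theta>" "\<theta> \<le> 1"
  obtains \<pi> where "\<pi> \<in> policies M"
    "\<And>B f. bounded_cost M B f \<Longrightarrow>
      discounted_cost \<beta> M f \<pi> = \<theta> * discounted_cost \<beta> M f \<pi>1 + (1 - \<theta>) * discounted_cost \<beta> M f \<pi>2"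
proof -
  have "ennreal \<theta> + ennreal (1 - \<theta>) = 1" using \<theta> by (simp flip: ennreal_plus)
  from policy_mixture[OF \<pi>1 \<pi>2 this] obtain \<pi> where \<pi>: "\<pi> \<in> policies M"
    and eq: "\<And>t g. g \<in> borel_measurable (steps M) \<Longrightarrow> (\<integral>\<^sup>+z. g z \<partial>step_law M \<pi> t) =
      ennreal \<theta> * (\<integral>\<^sup>+z. g z \<partial>step_law M \<pi>1 t) + ennreal (1 - \<theta>) * (\<integral>\<^sup>+z. g z \<partial>step_law M \<pi>2 t)"
    by blast
  show thesis
  proof
    fix B f assume f: "bounded_cost M B f"
    then have fm: "f \<in> borel_measurable (steps M)" by (simp add: bounded_cost_def)
    let ?I = "\<lambda>\<pi> t. \<integral>z. f z \<partial>step_law M \<pi> t"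
    note nn = step_law_integral_bounded(2)[OF _ f]
    have "ennreal (?I \<pi> t) = ennreal (\<theta> * ?I \<pi>1 t + (1 - \<theta>) * ?I \<pi>2 t)" for t
      using \<theta> nn[OF \<pi>1] nn[OF \<pi>2] fm
      by (simp add: step_law_integral_bounded(4)[OF _ f] \<pi> \<pi>1 \<pi>2 eq ennreal_plus ennreal_mult)
    then have I: "?I \<pi> t = \<theta> * ?I \<pi>1 t + (1 - \<theta>) * ?I \<pi>2 t" for t
      using \<theta> nn[OF \<pi>1] nn[OF \<pi>2] nn[OF \<pi>] by (subst (asm) ennreal_inj) auto
    have "(\<Sum>t. \<beta> ^ t * ?I \<pi> t) = (\<Sum>t. \<theta> * (\<beta> ^ t * ?I \<pi>1 t) + (1 - \<theta>) * (\<beta> ^ t * ?I \<pi>2 t))"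
      by (simp add: I algebra_simps)
    also have "\<dots> = \<theta> * (\<Sum>t. \<beta> ^ t * ?I \<pi>1 t) + (1 - \<theta>) * (\<Sum>t. \<beta> ^ t * ?I \<pi>2 t)"
      using summable_discounted[OF \<beta> \<pi>1 f] summable_discounted[OF \<beta> \<pi>2 f]
      by (subst suminf_add[symmetric]) (auto simp: suminf_mult)
    finally show "discounted_cost \<beta> M f \<pi> = \<theta> * discounted_cost \<beta> M f \<pi>1 + (1 - \<theta>) * discounted_cost \<beta> M f \<pi>2"
      unfolding discounted_cost_eq[OF \<beta> \<pi> f] discounted_cost_eq[OF \<beta> \<pi>1 f] discounted_cost_eq[OF \<beta> \<pi>2 f]
      by (simp only:) (simp add: algebra_simps)
  qed (rule \<pi>)
qed

lemma bounded_cost_next: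
  fixes u :: "'s \<Rightarrow> real"
  assumes [measurable]: "u \<in> borel_measurable (states M)" and u: "\<And>x. x \<in> space (states M) \<Longrightarrow> 0 \<le> u x \<and> u x \<le> C"
  shows "bounded_cost M C (\<lambda>z. \<integral>x. u x \<partial>trans M z)"
    "z \<in> space (steps M) \<Longrightarrow> integrable (trans M z) u"
    "bounded_cost M C (\<lambda>z. u (fst z))"
proof -
  have *: "integrable (trans M z) u \<and> 0 \<le> (\<integral>x. u x \<partial>trans M z) \<and> (\<integral>x. u x \<partial>trans M z) \<le> C"
    if z: "z \<in> space (steps M)" for z
  proof -
    have T: "prob_space (trans M z)" "sets (trans M z) = sets (states M)"
      using measurable_space[OF trans_kernel z] by (auto simp: space_prob_algebra)
    show ?thesis
      using prob_space.integrable_nonneg_bounded[OF T(1), of u C] T(2) u sets_eq_imp_space_eq[OF T(2)]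
      by (auto cong: measurable_cong_sets)
  qed
  then show "z \<in> space (steps M) \<Longrightarrow> integrable (trans M z) u" by simp
  have "(\<lambda>z. \<integral>x. u x \<partial>trans M z) \<in> borel_measurable (steps M)"
    by (rule measurable_compose[OF measurable_prob_algebraD[OF trans_kernel]]) measurable
  with * show "bounded_cost M C (\<lambda>z. \<integral>x. u x \<partial>trans M z)"
    by (auto simp: bounded_cost_def)
  show "bounded_cost M C (\<lambda>z. u (fst z))"
    using u by (auto simp: bounded_cost_def space_pair_measure)
qed

lemma integral_step_law_fst:
  fixes u :: "'s \<Rightarrow> real"
  assumes \<pi>: "\<pi> \<in> policies M" and um[measurable]: "u \<in> borel_measurable (states M)"
    and u: "\<And>x. x \<in> space (states M) \<Longrightarrow> 0 \<le> u x \<and> u x \<le> C"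
  shows "(\<integral>z. u (fst z) \<partial>step_law M \<pi> 0) = (\<integral>x. u x \<partial>init M)"
    "(\<integral>z. u (fst z) \<partial>step_law M \<pi> (Suc t)) = (\<integral>z. (\<integral>x. u x \<partial>trans M z) \<partial>step_law M \<pi> t)"
proof -
  have I: "prob_space (init M)" "sets (init M) = sets (states M)"
    using init_prob by (auto simp: space_prob_algebra)
  note b = bounded_cost_next[OF um u]
  have int: "integrable (init M) u"
    using prob_space.integrable_nonneg_bounded[OF I(1), of u C] I(2) u sets_eq_imp_space_eq[OF I(2)]
    by (auto cong: measurable_cong_sets)
  have pos: "0 \<le> (\<integral>x. u x \<partial>init M)"
    using u sets_eq_imp_space_eq[OF I(2)] by (intro integral_nonneg_AE AE_I2) auto
  have "(\<integral>\<^sup>+x. u x \<partial>init M) = ennreal (\<integral>x. u x \<partial>init M)"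
    using u sets_eq_imp_space_eq[OF I(2)] by (intro nn_integral_eq_integral[OF int] AE_I2) auto
  then have "ennreal (\<integral>z. u (fst z) \<partial>step_law M \<pi> 0) = ennreal (\<integral>x. u x \<partial>init M)"
    using um
    by (simp add: step_law_integral_bounded(4)[OF \<pi> b(3)] nn_integral_step_law_fst_0[OF \<pi>, of "\<lambda>x. ennreal (u x)"])
  then show "(\<integral>z. u (fst z) \<partial>step_law M \<pi> 0) = (\<integral>x. u x \<partial>init M)"
    using step_law_integral_bounded(2)[OF \<pi> b(3)] pos by simp
  have "ennreal (\<integral>z. u (fst z) \<partial>step_law M \<pi> (Suc t)) =
      (\<integral>\<^sup>+z. (\<integral>\<^sup>+x. u x \<partial>trans M z) \<partial>step_law M \<pi> t)"
    using um by (simp add: step_law_integral_bounded(4)[OF \<pi> b(3)] nn_integral_step_law_fst_Suc[OF \<pi>, of "\<lambda>x. ennreal (u x)"])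
  also have "\<dots> = (\<integral>\<^sup>+z. ennreal (\<integral>x. u x \<partial>trans M z) \<partial>step_law M \<pi> t)"
  proof (rule nn_integral_cong)
    fix z assume "z \<in> space (step_law M \<pi> t)"
    then have z: "z \<in> space (steps M)" by (simp add: space_step_law)
    have T: "sets (trans M z) = sets (states M)"
      using measurable_space[OF trans_kernel z] by (auto simp: space_prob_algebra)
    show "(\<integral>\<^sup>+x. u x \<partial>trans M z) = ennreal (\<integral>x. u x \<partial>trans M z)"
      using u sets_eq_imp_space_eq[OF T] by (intro nn_integral_eq_integral b(2) z) (auto intro: AE_I2)
  qed
  also have "\<dots> = ennreal (\<integral>z. (\<integral>x. u x \<partial>trans M z) \<partial>step_law M \<pi> t)"
    by (rule step_law_integral_bounded(4)[OF \<pi> b(1), symmetric])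
  finally show "(\<integral>z. u (fst z) \<partial>step_law M \<pi> (Suc t)) = (\<integral>z. (\<integral>x. u x \<partial>trans M z) \<partial>step_law M \<pi> t)"
    using step_law_integral_bounded(2)[OF \<pi> b(3)] step_law_integral_bounded(2)[OF \<pi> b(1)] by simp
qed

lemma init_integral_eq_telescope:
  fixes u :: "'s \<Rightarrow> real"
  assumes \<beta>: "0 < \<beta>" "\<beta> < 1" and \<pi>: "\<pi> \<in> policies M" and um: "u \<in> borel_measurable (states M)"
    and u: "\<And>x. x \<in> space (states M) \<Longrightarrow> 0 \<le> u x \<and> u x \<le> C"
  shows "(\<lambda>t. \<beta> ^ t * ((\<integral>z. u (fst z) \<partial>step_law M \<pi> t) -
      \<beta> * (\<integral>z. (\<integral>x. u x \<partial>trans M z) \<partial>step_law M \<pi> t))) sums (\<integral>x. u x \<partial>init M)"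
proof -
  note b = bounded_cost_next(3)[OF um u]
  from discounted_telescope[OF \<beta>, of "\<lambda>t. \<integral>z. u (fst z) \<partial>step_law M \<pi> t" C]
  show ?thesis
    using step_law_integral_bounded(2,3)[OF \<pi> b]
    by (simp add: integral_step_law_fst[OF \<pi> um u])
qed

text \<open>
  If \<open>u\<close> is a subsolution of the optimality equation up to \<open>e\<close>, summing
  the inequality along the trajectory telescopes, and no policy can cost less than
  \<open>u\<close> predicts.
\<close>

lemma discounted_cost_lower_bound:
  fixes u :: "'s \<Rightarrow> real"
  assumes \<beta>: "0 < \<beta>" "\<beta> < 1" and \<pi>: "\<pi> \<in> policies M" and f: "bounded_cost M B f"
    and um: "u \<in> borel_measurable (states M)"
    and u: "\<And>x. x \<in> space (states M) \<Longrightarrow> 0 \<le> u x \<and> u x \<le> C"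
    and sub: "\<And>z. z \<in> space (steps M) \<Longrightarrow> u (fst z) \<le> f z + \<beta> * (\<integral>x. u x \<partial>trans M z) + e"
  shows "(1 - \<beta>) * (\<integral>x. u x \<partial>init M) \<le> discounted_cost \<beta> M f \<pi> + e"
proof -
  note b = bounded_cost_next[OF um u]
  note int = step_law_integral_bounded(1)[OF \<pi>]
  note tel = init_integral_eq_telescope[OF \<beta> \<pi> um u]
  let ?F = "\<lambda>t. \<integral>z. f z \<partial>step_law M \<pi> t"
  have "(\<integral>z. u (fst z) \<partial>step_law M \<pi> t) - \<beta> * (\<integral>z. (\<integral>x. u x \<partial>trans M z) \<partial>step_law M \<pi> t) \<le> ?F t + e" for t
  proof -
    interpret prob_space "step_law M \<pi> t" by (rule step_law_prob_space[OF \<pi>])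
    have "(\<integral>z. u (fst z) \<partial>step_law M \<pi> t) \<le> (\<integral>z. f z + \<beta> * (\<integral>x. u x \<partial>trans M z) + e \<partial>step_law M \<pi> t)"
      using sub by (intro integral_mono) (auto simp: int[OF b(3)] int[OF b(1)] int[OF f] space_step_law)
    also have "\<dots> = ?F t + \<beta> * (\<integral>z. (\<integral>x. u x \<partial>trans M z) \<partial>step_law M \<pi> t) + e"
      by (simp add: int[OF b(1)] int[OF f] prob_space)
    finally show ?thesis by simp
  qed
  moreover have "summable (\<lambda>t. \<beta> ^ t * (?F t + e))"
  proof (rule geometric_series_bounded[OF \<beta>])
    show "\<bar>?F t + e\<bar> \<le> B + \<bar>e\<bar>" for t
      using step_law_integral_bounded(2,3)[OF \<pi> f, of t] by linarith
  qed
  ultimately have "(\<integral>x. u x \<partial>init M) \<le> (\<Sum>t. \<beta> ^ t * (?F t + e))"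
    using \<beta> by (intro sums_le[OF _ tel summable_sums]) (auto intro!: mult_left_mono)
  also have "\<dots> = (\<Sum>t. \<beta> ^ t * ?F t) + (\<Sum>t. \<beta> ^ t * e)"
    using \<beta> by (subst suminf_add)
      (auto simp: distrib_left intro!: summable_discounted[OF \<beta> \<pi> f] summable_mult2 summable_geometric)
  also have "(\<Sum>t. \<beta> ^ t * e) = e / (1 - \<beta>)"
    using \<beta> by (subst suminf_mult2[symmetric]) (auto simp: suminf_geometric)
  finally show ?thesis
    using \<beta> by (simp add: discounted_cost_eq[OF \<beta> \<pi> f] field_simps)
qed

definition stationary :: "('s \<Rightarrow> 'a) \<Rightarrow> ('s, 'a) policy" where
  "stationary \<phi> = (\<lambda>t w. return (actions M) (\<phi> (snd w)))"

lemma stationary_policy: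
  assumes [measurable]: "\<phi> \<in> states M \<rightarrow>\<^sub>M actions M"
  shows "stationary \<phi> \<in> policies M"
  unfolding policies_def stationary_def histories_def by simp

text \<open>
  Under a stationary policy the action is almost surely the selected one.
\<close>

lemma integral_step_law_stationary:
  assumes \<phi>[measurable]: "\<phi> \<in> states M \<rightarrow>\<^sub>M actions M" and g: "bounded_cost M B g"
  shows "(\<integral>z. g z \<partial>step_law M (stationary \<phi>) t) = (\<integral>z. g (fst z, \<phi> (fst z)) \<partial>step_law M (stationary \<phi>) t)"
    "bounded_cost M B (\<lambda>z. g (fst z, \<phi> (fst z)))"
proof -
  have gm[measurable]: "g \<in> borel_measurable (steps M)" using g by (simp add: bounded_cost_def)
  note \<pi> = stationary_policy[OF \<phi>]
  show g': "bounded_cost M B (\<lambda>z. g (fst z, \<phi> (fst z)))"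
    using g measurable_space[OF \<phi>] by (auto simp: bounded_cost_def space_pair_measure)
  have *: "(\<integral>\<^sup>+z. h z \<partial>step_law M (stationary \<phi>) t) = (\<integral>\<^sup>+w. h (snd w, \<phi> (snd w)) \<partial>history_law M (stationary \<phi>) t)"
    if [measurable]: "h \<in> borel_measurable (steps M)" for h
  proof (subst nn_integral_step_law[OF \<pi> that], rule nn_integral_cong)
    fix w assume "w \<in> space (history_law M (stationary \<phi>) t)"
    then have w[measurable]: "snd w \<in> space (states M)"
      using sets_history_law[OF \<pi>, THEN sets_eq_imp_space_eq] by (auto simp: histories_def space_pair_measure)
    show "(\<integral>\<^sup>+a. h (snd w, a) \<partial>stationary \<phi> t w) = h (snd w, \<phi> (snd w))"
      unfolding stationary_def
      by (rule nn_integral_return) (use measurable_space[OF \<phi> w] in auto)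
  qed
  have "ennreal (\<integral>z. g z \<partial>step_law M (stationary \<phi>) t) = ennreal (\<integral>z. g (fst z, \<phi> (fst z)) \<partial>step_law M (stationary \<phi>) t)"
    by (simp add: step_law_integral_bounded(4)[OF \<pi> g] step_law_integral_bounded(4)[OF \<pi> g'] *)
  then show "(\<integral>z. g z \<partial>step_law M (stationary \<phi>) t) = (\<integral>z. g (fst z, \<phi> (fst z)) \<partial>step_law M (stationary \<phi>) t)"
    using step_law_integral_bounded(2)[OF \<pi> g] step_law_integral_bounded(2)[OF \<pi> g'] by simp
qed

text \<open>
  The converse bound, for the policy that follows a selector along which \<open>u\<close> is a
  supersolution up to \<open>e\<close>.
\<close>

lemma discounted_cost_stationary_upper_bound:
  fixes u :: "'s \<Rightarrow> real"
  assumes \<beta>: "0 < \<beta>" "\<beta> < 1" and \<phi>[measurable]: "\<phi> \<in> states M \<rightarrow>\<^sub>M actions M" and f: "bounded_cost M B f"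
    and um: "u \<in> borel_measurable (states M)"
    and u: "\<And>x. x \<in> space (states M) \<Longrightarrow> 0 \<le> u x \<and> u x \<le> C"
    and super: "\<And>x. x \<in> space (states M) \<Longrightarrow> f (x, \<phi> x) + \<beta> * (\<integral>y. u y \<partial>trans M (x, \<phi> x)) \<le> u x + e"
  shows "discounted_cost \<beta> M f (stationary \<phi>) \<le> (1 - \<beta>) * (\<integral>x. u x \<partial>init M) + e"
proof -
  note \<pi> = stationary_policy[OF \<phi>]
  note b = bounded_cost_next[OF um u]
  note int = step_law_integral_bounded(1)[OF \<pi>]
  note tel = init_integral_eq_telescope[OF \<beta> \<pi> um u]
  let ?F = "\<lambda>t. \<integral>z. f z \<partial>step_law M (stationary \<phi>) t"
  let ?m = "\<lambda>t. (\<integral>z. u (fst z) \<partial>step_law M (stationary \<phi>) t) -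
      \<beta> * (\<integral>z. (\<integral>x. u x \<partial>trans M z) \<partial>step_law M (stationary \<phi>) t)"
  have "?F t \<le> ?m t + e" for t
  proof -
    interpret prob_space "step_law M (stationary \<phi>) t" by (rule step_law_prob_space[OF \<pi>])
    note s = integral_step_law_stationary[OF \<phi>]
    have "?F t + \<beta> * (\<integral>z. (\<integral>x. u x \<partial>trans M z) \<partial>step_law M (stationary \<phi>) t) =
      (\<integral>z. f (fst z, \<phi> (fst z)) + \<beta> * (\<integral>y. u y \<partial>trans M (fst z, \<phi> (fst z))) \<partial>step_law M (stationary \<phi>) t)"
      using int[OF s(2)[OF f]] int[OF s(2)[OF b(1)]] s(1)[OF f, of t] s(1)[OF b(1), of t] by simp
    also have "\<dots> \<le> (\<integral>z. u (fst z) + e \<partial>step_law M (stationary \<phi>) t)"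
      using super int[OF s(2)[OF f]] int[OF s(2)[OF b(1)]]
      by (intro integral_mono) (auto simp: int[OF b(3)] space_step_law space_pair_measure)
    also have "\<dots> = (\<integral>z. u (fst z) \<partial>step_law M (stationary \<phi>) t) + e"
      by (simp add: int[OF b(3)] prob_space)
    finally show ?thesis by simp
  qed
  then have "(\<Sum>t. \<beta> ^ t * ?F t) \<le> (\<Sum>t. \<beta> ^ t * ?m t + \<beta> ^ t * e)"
    using \<beta> by (intro suminf_le summable_discounted[OF \<beta> \<pi> f] summable_add sums_summable[OF tel]
       summable_mult2 summable_geometric) (auto simp flip: distrib_left)
  also have "\<dots> = (\<integral>x. u x \<partial>init M) + (\<Sum>t. \<beta> ^ t * e)"
    using \<beta> by (intro sums_unique[symmetric] sums_add tel summable_sums summable_mult2 summable_geometric) auto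
  also have "(\<Sum>t. \<beta> ^ t * e) = e / (1 - \<beta>)"
    using \<beta> by (subst suminf_mult2[symmetric]) (auto simp: suminf_geometric)
  finally show ?thesis
    using \<beta> by (simp add: discounted_cost_eq[OF \<beta> \<pi> f] field_simps)
qed

end

section \<open>A minimax lemma for finitely many functions\<close>

text \<open>
  Fan's weakening of convexity for a finite family of functions on a set without linear structure:
  here \<open>S\<close> is going to be a set of policies, and mixtures of policies replace convex
  combinations.
\<close>

definition convexlike :: "'p set \<Rightarrow> 'i set \<Rightarrow> ('i \<Rightarrow> 'p \<Rightarrow> real) \<Rightarrow> bool" where
  "convexlike S I f \<longleftrightarrow> (\<forall>x\<in>S. \<forall>y\<in>S. \<forall>\<theta>\<in>{0..1}. \<exists>z\<in>S. \<forall>l\<in>I. f l z \<le> \<theta> * f l x + (1 - \<theta>) * f l y)"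

text \<open>
  Otherwise the point \<open>(s, s)\<close> lies outside the convex set of all pairs above some
  \<open>(g x, h x)\<close>. The normal of a separating line is nonnegative because that set is
  closed under increasing either coordinate, and, once normalized, it contradicts the assumption
  on weights.
\<close>

lemma convexlike_two_functions:
  fixes g h :: "'p \<Rightarrow> real"
  assumes cvx: "\<And>x y \<theta>. x \<in> S \<Longrightarrow> y \<in> S \<Longrightarrow> 0 \<le> \<theta> \<Longrightarrow> \<theta> \<le> 1 \<Longrightarrow>
      \<exists>z\<in>S. g z \<le> \<theta> * g x + (1 - \<theta>) * g y \<and> h z \<le> \<theta> * h x + (1 - \<theta>) * h y"
    and wt: "\<And>t \<rho>. 0 \<le> t \<Longrightarrow> t \<le> 1 \<Longrightarrow> r < \<rho> \<Longrightarrow> \<exists>x\<in>S. t * g x + (1 - t) * h x \<le> \<rho>"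
    and s: "r < s"
  shows "\<exists>x\<in>S. g x \<le> s \<and> h x \<le> s"
proof (rule ccontr)
  assume no: "\<not> (\<exists>x\<in>S. g x \<le> s \<and> h x \<le> s)"
  \<comment> \<open>The points above the image of \<open>S\<close>, shifted so that \<open>(s, s)\<close> becomes the origin.\<close>
  define C :: "(real \<times> real) set" where "C = {(u, v). \<exists>x\<in>S. g x - s \<le> u \<and> h x - s \<le> v}"
  have "convex C"
    unfolding convex_alt
  proof (intro ballI allI impI)
    fix P P' :: "real \<times> real" and \<theta> :: real
    assume PQ: "P \<in> C" "P' \<in> C" and \<theta>: "0 \<le> \<theta> \<and> \<theta> \<le> 1"
    obtain x y where x: "x \<in> S" "g x - s \<le> fst P" "h x - s \<le> snd P"
      and y: "y \<in> S" "g y - s \<le> fst P'" "h y - s \<le> snd P'"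
      using PQ by (auto simp: C_def split_beta')
    obtain z where z: "z \<in> S" "g z \<le> (1 - \<theta>) * g x + \<theta> * g y" "h z \<le> (1 - \<theta>) * h x + \<theta> * h y"
      using cvx[OF x(1) y(1), of "1 - \<theta>"] \<theta> by auto
    have "(1 - \<theta>) * (g x - s) + \<theta> * (g y - s) \<le> (1 - \<theta>) * fst P + \<theta> * fst P'"
      "(1 - \<theta>) * (h x - s) + \<theta> * (h y - s) \<le> (1 - \<theta>) * snd P + \<theta> * snd P'"
      using x y \<theta> by (auto intro!: add_mono mult_left_mono)
    moreover have "(1 - \<theta>) * (c - s) + \<theta> * (c' - s) = (1 - \<theta>) * c + \<theta> * c' - s" for c c'
      by (simp add: algebra_simps)
    ultimately have "g z - s \<le> (1 - \<theta>) * fst P + \<theta> * fst P'" "h z - s \<le> (1 - \<theta>) * snd P + \<theta> * snd P'"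
      using z by simp_all
    with z(1) show "(1 - \<theta>) *\<^sub>R P + \<theta> *\<^sub>R P' \<in> C"
      unfolding C_def by (auto simp: split_beta')
  qed
  moreover have "0 \<notin> C" using no by (auto simp: C_def zero_prod_def)
  ultimately obtain n where n: "n \<noteq> 0" "\<And>P. P \<in> C \<Longrightarrow> 0 \<le> n \<bullet> P"
    using separating_hyperplane_set_0[of C] by blast
  obtain a b where ab: "n = (a, b)" by (cases n)
  have ge: "0 \<le> a * (g x - s + u) + b * (h x - s + v)" if "x \<in> S" "0 \<le> u" "0 \<le> v" for x u v
  proof -
    have "(g x - s + u, h x - s + v) \<in> C" using that by (auto simp: C_def intro!: bexI[of _ x])
    from n(2)[OF this] show ?thesis by (simp add: ab)
  qed
  obtain x0 where x0: "x0 \<in> S" using wt[of 0 s] s by auto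
  define N where "N = a * (g x0 - s) + b * (h x0 - s)"
  have "0 \<le> N + a * u + b * v" if "0 \<le> u" "0 \<le> v" for u v
    using ge[OF x0 that] by (simp add: N_def algebra_simps)
  note N = this
  have a: "0 \<le> a"
  proof (rule ccontr)
    assume "\<not> 0 \<le> a"
    then have "0 \<le> (\<bar>N\<bar> + 1) / - a" "a * ((\<bar>N\<bar> + 1) / - a) = - (\<bar>N\<bar> + 1)"
      by (simp_all add: divide_nonneg_neg)
    then show False using N[of "(\<bar>N\<bar> + 1) / - a" 0] by linarith
  qed
  have b: "0 \<le> b"
  proof (rule ccontr)
    assume "\<not> 0 \<le> b"
    then have "0 \<le> (\<bar>N\<bar> + 1) / - b" "b * ((\<bar>N\<bar> + 1) / - b) = - (\<bar>N\<bar> + 1)"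
      by (simp_all add: divide_nonneg_neg)
    then show False using N[of 0 "(\<bar>N\<bar> + 1) / - b"] by linarith
  qed
  have ab0: "0 < a + b" using n(1) a b by (auto simp: ab zero_prod_def)
  define t where "t = a / (a + b)"
  have t: "0 \<le> t" "t \<le> 1" and t': "1 - t = b / (a + b)"
    using a b ab0 by (auto simp: t_def field_simps)
  obtain x where x: "x \<in> S" "t * g x + (1 - t) * h x \<le> (r + s) / 2"
    using wt[OF t, of "(r + s) / 2"] s by auto
  have "0 \<le> (a * (g x - s) + b * (h x - s)) / (a + b)"
    using ge[OF x(1), of 0 0] ab0 by simp
  also have "\<dots> = t * (g x - s) + (1 - t) * (h x - s)"
    unfolding t' by (simp add: t_def add_divide_distrib)
  also have "\<dots> = t * g x + (1 - t) * h x - s" by (simp add: algebra_simps)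
  finally show False using x(2) s by simp
qed

text \<open>
  Induction on the number of functions: restricting \<open>S\<close> to the points where the new
  function is at most an intermediate level \<open>m\<close> keeps the family convexlike, and the
  case of two functions, applied to the new function and a weighted sum of the old ones, shows
  that the weighted sums still get below \<open>m\<close> on the restriction.
\<close>

lemma convexlike_minimax:
  assumes "finite I" "I \<noteq> {}" "convexlike S I f"
    and "\<And>w \<rho>. (\<forall>l\<in>I. 0 \<le> w l) \<Longrightarrow> sum w I = 1 \<Longrightarrow> r < \<rho> \<Longrightarrow> \<exists>x\<in>S. (\<Sum>l\<in>I. w l * f l x) \<le> \<rho>"
    and "r < s"
  shows "\<exists>x\<in>S. \<forall>l\<in>I. f l x \<le> s"
  using assms
proof (induction I arbitrary: S r s rule: finite_ne_induct)
  case (singleton a)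
  from singleton.prems(2)[of "\<lambda>_. 1" s] singleton.prems(3) show ?case by simp
next
  case (insert a F)
  define m where "m = (r + s) / 2"
  have m: "r < m" "m < s" using insert.prems(3) by (auto simp: m_def)
  define S' where "S' = {x\<in>S. f a x \<le> m}"
  have cvx: "\<exists>z\<in>S. \<forall>l\<in>insert a F. f l z \<le> \<theta> * f l x + (1 - \<theta>) * f l y"
    if "x \<in> S" "y \<in> S" "0 \<le> \<theta>" "\<theta> \<le> 1" for x y \<theta>
    using insert.prems(1) that by (simp add: convexlike_def)
  have "\<exists>x\<in>S'. \<forall>l\<in>F. f l x \<le> s"
  proof (rule insert.IH)
    show "convexlike S' F f"
      unfolding convexlike_def
    proof (intro ballI)
      fix x y \<theta> assume xy: "x \<in> S'" "y \<in> S'" and \<theta>: "\<theta> \<in> {0..1::real}"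
      with cvx[of x y \<theta>] obtain z where z: "z \<in> S" "\<forall>l\<in>insert a F. f l z \<le> \<theta> * f l x + (1 - \<theta>) * f l y"
        by (auto simp: S'_def)
      have "\<theta> * f a x + (1 - \<theta>) * f a y \<le> \<theta> * m + (1 - \<theta>) * m"
        using xy \<theta> by (intro add_mono mult_left_mono) (auto simp: S'_def)
      then have "\<theta> * f a x + (1 - \<theta>) * f a y \<le> m" by (simp add: algebra_simps)
      with z show "\<exists>z\<in>S'. \<forall>l\<in>F. f l z \<le> \<theta> * f l x + (1 - \<theta>) * f l y"
        by (intro bexI[of _ z]) (auto simp: S'_def)
    qed
  next
    fix w :: "_ \<Rightarrow> real" and \<rho> assume w: "\<forall>l\<in>F. 0 \<le> w l" "sum w F = 1" and \<rho>: "m < \<rho>"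
    let ?g = "\<lambda>x. \<Sum>l\<in>F. w l * f l x"
    have "\<exists>x\<in>S. f a x \<le> m \<and> ?g x \<le> m"
    proof (rule convexlike_two_functions)
      fix x y and \<theta> :: real assume xy: "x \<in> S" "y \<in> S" and \<theta>: "0 \<le> \<theta>" "\<theta> \<le> 1"
      from cvx[OF this] obtain z where z: "z \<in> S" "\<forall>l\<in>insert a F. f l z \<le> \<theta> * f l x + (1 - \<theta>) * f l y"
        by blast
      have "?g z \<le> (\<Sum>l\<in>F. w l * (\<theta> * f l x + (1 - \<theta>) * f l y))"
        using z w by (intro sum_mono mult_left_mono) auto
      also have "\<dots> = \<theta> * ?g x + (1 - \<theta>) * ?g y"
        unfolding sum_distrib_left sum.distrib[symmetric] by (intro sum.cong refl) (simp add: algebra_simps)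
      finally show "\<exists>z\<in>S. f a z \<le> \<theta> * f a x + (1 - \<theta>) * f a y \<and> ?g z \<le> \<theta> * ?g x + (1 - \<theta>) * ?g y"
        using z by blast
    next
      fix t \<rho> :: real assume t: "0 \<le> t" "t \<le> 1" and \<rho>: "r < \<rho>"
      \<comment> \<open>A convex combination of the new function and \<open>?g\<close> is a weighted sum of the whole family.\<close>
      let ?w = "\<lambda>l. if l = a then t else (1 - t) * w l"
      have F: "(\<Sum>l\<in>F. ?w l * h l) = (1 - t) * (\<Sum>l\<in>F. w l * h l)" for h
        using insert.hyps unfolding sum_distrib_left by (intro sum.cong) (auto simp: mult.assoc)
      have "\<forall>l\<in>insert a F. 0 \<le> ?w l" using w t by auto
      moreover have "sum ?w (insert a F) = 1"
        using F[of "\<lambda>_. 1"] w insert.hyps by simp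
      ultimately show "\<exists>x\<in>S. t * f a x + (1 - t) * ?g x \<le> \<rho>"
        using insert.prems(2)[of ?w \<rho>] \<rho> F insert.hyps by simp
    qed (rule m(1))
    then show "\<exists>x\<in>S'. ?g x \<le> \<rho>"
      using \<rho> by (force simp: S'_def)
  qed (rule m(2))
  then show ?case using m(2) by (force simp: S'_def)
qed

section \<open>Value iteration in a Lipschitz model\<close>

lemma continuous_on_measurable_product:
  fixes f :: "'x::{second_countable_topology} \<times> 'b::{second_countable_topology} \<Rightarrow> real"
  assumes "continuous_on (X \<times> A) f"
  shows "f \<in> borel_measurable (restrict_space borel X \<Otimes>\<^sub>M restrict_space borel A)"
proof -
  have "(\<lambda>z. (fst z, snd z)) \<in> restrict_space borel X \<Otimes>\<^sub>M restrict_space borel A \<rightarrow>\<^sub>M borel \<Otimes>\<^sub>M borel"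
    by (intro measurable_Pair measurable_compose[OF measurable_fst] measurable_compose[OF measurable_snd]
        measurable_restrict_space1) auto
  then have "(\<lambda>z. z) \<in> restrict_space borel X \<Otimes>\<^sub>M restrict_space borel A \<rightarrow>\<^sub>M restrict_space borel (X \<times> A)"
    by (intro measurable_restrict_space2) (auto simp: space_pair_measure space_restrict_space borel_prod)
  from measurable_compose[OF this borel_measurable_continuous_on_restrict[OF assms]] show ?thesis .
qed

lemma product_coupling:
  assumes "\<mu> \<in> space (prob_algebra S)" "\<nu> \<in> space (prob_algebra S)"
  shows "\<mu> \<Otimes>\<^sub>M \<nu> \<in> couplings S \<mu> \<nu>"
proof -
  have \<mu>: "prob_space \<mu>" "sets \<mu> = sets S" and \<nu>: "prob_space \<nu>" "sets \<nu> = sets S"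
    using assms by (auto simp: space_prob_algebra)
  interpret \<mu>: prob_space \<mu> by fact
  interpret \<nu>: prob_space \<nu> by fact
  interpret pair_prob_space \<mu> \<nu> ..
  have "distr (\<mu> \<Otimes>\<^sub>M \<nu>) S fst = distr (\<mu> \<Otimes>\<^sub>M \<nu>) \<mu> fst" "distr (\<mu> \<Otimes>\<^sub>M \<nu>) S snd = distr (\<mu> \<Otimes>\<^sub>M \<nu>) \<nu> snd"
    using \<mu>(2) \<nu>(2) by (auto intro: distr_cong)
  moreover have "distr (\<mu> \<Otimes>\<^sub>M \<nu>) \<nu> snd = \<nu>"
  proof (rule measure_eqI)
    fix B assume B: "B \<in> sets (distr (\<mu> \<Otimes>\<^sub>M \<nu>) \<nu> snd)"
    then have "emeasure (distr (\<mu> \<Otimes>\<^sub>M \<nu>) \<nu> snd) B = emeasure (\<mu> \<Otimes>\<^sub>M \<nu>) (space \<mu> \<times> B)"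
      by (auto simp: emeasure_distr space_pair_measure dest: sets.sets_into_space
          intro!: arg_cong2[where f=emeasure])
    with B show "emeasure (distr (\<mu> \<Otimes>\<^sub>M \<nu>) \<nu> snd) B = emeasure \<nu> B"
      by (simp add: \<nu>.emeasure_pair_measure_Times \<mu>.emeasure_space_1)
  qed simp
  ultimately show ?thesis
    unfolding couplings_def space_prob_algebra
    using \<mu>(2) \<nu>(2) prob_space_axioms \<nu>.distr_pair_fst[of \<mu>]
    by (auto cong: sets_pair_measure_cong)
qed

text \<open>
  The easy half of Kantorovich duality: the difference of the integrals is the integral of
  \<open>v (fst z) - v (snd z)\<close> against any coupling.
\<close>

lemma wasserstein1_dual_bound:
  fixes X :: "'x::euclidean_space set" and v :: "'x \<Rightarrow> real"
  assumes X: "compact X" and v: "L-lipschitz_on X v"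
    and \<mu>: "\<mu> \<in> space (prob_algebra (restrict_space borel X))"
    and \<nu>: "\<nu> \<in> space (prob_algebra (restrict_space borel X))"
  shows "\<bar>(\<integral>x. v x \<partial>\<mu>) - (\<integral>x. v x \<partial>\<nu>)\<bar> \<le> L * wasserstein1 (restrict_space borel X) \<mu> \<nu>"
proof -
  let ?S = "restrict_space borel X"
  define D where "D = \<bar>(\<integral>x. v x \<partial>\<mu>) - (\<integral>x. v x \<partial>\<nu>)\<bar>"
  have L: "0 \<le> L" using v by (rule lipschitz_on_nonneg)
  have cv: "continuous_on X v" using v by (rule lipschitz_on_continuous_on)
  obtain C where C: "\<And>x. x \<in> X \<Longrightarrow> \<bar>v x\<bar> \<le> C"
    using compact_imp_bounded[OF compact_continuous_image[OF cv X]] by (auto simp: bounded_iff)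
  have vm[measurable]: "v \<in> borel_measurable ?S" by (rule borel_measurable_continuous_on_restrict[OF cv])
  have bound: "D \<le> L * (\<integral>z. dist (fst z) (snd z) \<partial>\<eta>)" if \<eta>: "\<eta> \<in> couplings ?S \<mu> \<nu>" for \<eta>
  proof -
    have s[measurable_cong]: "sets \<eta> = sets (?S \<Otimes>\<^sub>M ?S)" and p: "prob_space \<eta>"
      and d: "distr \<eta> ?S fst = \<mu>" "distr \<eta> ?S snd = \<nu>"
      using \<eta> by (auto simp: couplings_def space_prob_algebra)
    interpret prob_space \<eta> by fact
    have sp: "space \<eta> = X \<times> X"
      using sets_eq_imp_space_eq[OF s] by (simp add: space_pair_measure space_restrict_space)
    have int: "integrable \<eta> (\<lambda>z. v (fst z))" "integrable \<eta> (\<lambda>z. v (snd z))"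
      using C by (auto intro!: integrable_const_bound[where B=C] AE_I2 simp: sp)
    have "continuous_on (X \<times> X) (\<lambda>z. dist (fst z) (snd z))" by (intro continuous_intros)
    then have dm[measurable]: "(\<lambda>z. dist (fst z) (snd z)) \<in> borel_measurable \<eta>"
      by (simp add: measurable_cong_sets[OF s refl] continuous_on_measurable_product)
    have "bounded ((\<lambda>z. dist (fst z) (snd z)) ` (X \<times> X))"
      by (intro compact_imp_bounded compact_continuous_image compact_Times X continuous_intros)
    then obtain R where R: "\<And>z. z \<in> X \<times> X \<Longrightarrow> \<bar>dist (fst z) (snd z)\<bar> \<le> R"
      unfolding bounded_iff real_norm_def by blast
    have int': "integrable \<eta> (\<lambda>z. dist (fst z) (snd z))"
      using R by (auto intro!: integrable_const_bound[where B=R] AE_I2 simp: sp)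
    have "(\<integral>x. v x \<partial>\<mu>) - (\<integral>x. v x \<partial>\<nu>) = (\<integral>z. v (fst z) - v (snd z) \<partial>\<eta>)"
      using int by (simp flip: d add: integral_distr)
    then have "D \<le> (\<integral>z. \<bar>v (fst z) - v (snd z)\<bar> \<partial>\<eta>)"
      unfolding D_def using integral_norm_bound[of \<eta> "\<lambda>z. v (fst z) - v (snd z)"] by simp
    also have "\<dots> \<le> (\<integral>z. L * dist (fst z) (snd z) \<partial>\<eta>)"
      using int int' lipschitz_onD[OF v]
      by (intro integral_mono) (auto simp: sp dist_real_def)
    finally show ?thesis by simp
  qed
  have ne: "couplings ?S \<mu> \<nu> \<noteq> {}" using product_coupling[OF \<mu> \<nu>] by auto
  show ?thesis
  proof (cases "L = 0")
    case True
    then show ?thesis using bound[OF product_coupling[OF \<mu> \<nu>]] by (simp add: D_def)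
  next
    case False
    with L have "0 < L" by simp
    then have "D / L \<le> wasserstein1 ?S \<mu> \<nu>"
      unfolding wasserstein1_def using bound
      by (intro cINF_greatest[OF ne]) (simp add: divide_le_eq mult.commute)
    then show ?thesis using \<open>0 < L\<close> by (simp add: D_def divide_le_eq mult.commute)
  qed
qed

locale lipschitz_cmdp = cmdp_kernels M
  for M :: "('x::euclidean_space, 'b::{metric_space, second_countable_topology}) cmdp" +
  fixes X :: "'x set" and A :: "'b set" and \<beta> K\<^sub>p :: real
  assumes states_M: "states M = restrict_space borel X"
    and actions_M: "actions M = restrict_space borel A"
    and compact_X: "compact X" and compact_A: "compact A" and A_nonempty: "A \<noteq> {}"
    and \<beta>: "0 < \<beta>" "\<beta> < 1" and contraction: "K\<^sub>p * \<beta> < 1"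
    and weakly_continuous: "weakly_continuous_kernel X (X \<times> A) (trans M)"
    and wasserstein: "\<And>x y a. x \<in> X \<Longrightarrow> y \<in> X \<Longrightarrow> a \<in> A \<Longrightarrow>
      wasserstein1 (restrict_space borel X) (trans M (x, a)) (trans M (y, a)) \<le> K\<^sub>p * dist x y"
begin

definition lipschitz_cost :: "real \<Rightarrow> ('x \<times> 'b \<Rightarrow> real) \<Rightarrow> bool" where
  "lipschitz_cost K f \<longleftrightarrow> continuous_on (X \<times> A) f \<and> (\<forall>a\<in>A. K-lipschitz_on X (\<lambda>x. f (x, a)))"

lemma space_M: "space (states M) = X" "space (actions M) = A" "space (steps M) = X \<times> A"
  by (auto simp: states_M actions_M space_restrict_space space_pair_measure)

lemma trans_prob: "x \<in> X \<Longrightarrow> a \<in> A \<Longrightarrow> trans M (x, a) \<in> space (prob_algebra (restrict_space borel X))"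
  using measurable_space[OF trans_kernel, of "(x, a)"] by (simp add: space_M states_M[symmetric])

lemma lipschitz_integrable:
  assumes v: "L-lipschitz_on X v" and x: "x \<in> X" "a \<in> A"
  shows "integrable (trans M (x, a)) (v :: 'x \<Rightarrow> real)"
proof -
  have p: "prob_space (trans M (x, a))" and s[measurable_cong]: "sets (trans M (x, a)) = sets (restrict_space borel X)"
    using trans_prob[OF x] by (auto simp: space_prob_algebra)
  interpret prob_space "trans M (x, a)" by fact
  have cv: "continuous_on X v" using v by (rule lipschitz_on_continuous_on)
  obtain C where C: "\<And>x. x \<in> X \<Longrightarrow> \<bar>v x\<bar> \<le> C"
    using compact_imp_bounded[OF compact_continuous_image[OF cv compact_X]] by (auto simp: bounded_iff)
  have [measurable]: "v \<in> borel_measurable (restrict_space borel X)"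
    by (rule borel_measurable_continuous_on_restrict[OF cv])
  show ?thesis
    using C sets_eq_imp_space_eq[OF s]
    by (intro integrable_const_bound[where B=C]) (auto simp: space_restrict_space)
qed

definition Q_value :: "('x \<times> 'b \<Rightarrow> real) \<Rightarrow> ('x \<Rightarrow> real) \<Rightarrow> 'x \<times> 'b \<Rightarrow> real" where
  "Q_value f v z = f z + \<beta> * (\<integral>y. v y \<partial>trans M z)"

text \<open>
  The optimality operator; \<open>Q_value f v\<close> is the cost of one step followed by the
  terminal cost \<open>v\<close>, and has nothing to do with the nearest-point map
  \<open>Q\<close>.
\<close>

definition bellman :: "('x \<times> 'b \<Rightarrow> real) \<Rightarrow> ('x \<Rightarrow> real) \<Rightarrow> 'x \<Rightarrow> real" where
  "bellman f v x = (INF a\<in>A. Q_value f v (x, a))"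

lemma lipschitz_Q_value:
  assumes f: "lipschitz_cost K f" and v: "L-lipschitz_on X v" and xy: "x \<in> X" "y \<in> X" and a: "a \<in> A"
  shows "\<bar>Q_value f v (x, a) - Q_value f v (y, a)\<bar> \<le> (K + \<beta> * K\<^sub>p * L) * dist x y"
proof -
  have "\<bar>f (x, a) - f (y, a)\<bar> \<le> K * dist x y"
    using lipschitz_onD[of K X "\<lambda>x. f (x, a)" x y] f xy a by (auto simp: lipschitz_cost_def dist_real_def)
  moreover have "\<bar>(\<integral>y. v y \<partial>trans M (x, a)) - (\<integral>z. v z \<partial>trans M (y, a))\<bar> \<le> L * (K\<^sub>p * dist x y)"
    by (rule order_trans[OF wasserstein1_dual_bound[OF compact_X v trans_prob[OF xy(1) a] trans_prob[OF xy(2) a]]])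
      (intro mult_left_mono wasserstein xy a lipschitz_on_nonneg[OF v])
  then have "\<beta> * \<bar>(\<integral>y. v y \<partial>trans M (x, a)) - (\<integral>z. v z \<partial>trans M (y, a))\<bar> \<le> \<beta> * (L * (K\<^sub>p * dist x y))"
    using \<beta> by (intro mult_left_mono) auto
  then have "\<bar>\<beta> * (\<integral>y. v y \<partial>trans M (x, a)) - \<beta> * (\<integral>z. v z \<partial>trans M (y, a))\<bar> \<le> \<beta> * (L * (K\<^sub>p * dist x y))"
    using \<beta> by (simp add: abs_mult flip: right_diff_distrib)
  ultimately show ?thesis unfolding Q_value_def by (simp add: algebra_simps)
qed

lemma continuous_Q_value:
  assumes f: "lipschitz_cost K f" and v: "L-lipschitz_on X v"
  shows "continuous_on (X \<times> A) (Q_value f v)"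
proof -
  have cv: "continuous_on X v" using v by (rule lipschitz_on_continuous_on)
  then have "bounded (v ` X)" using compact_X by (intro compact_imp_bounded compact_continuous_image)
  then have "continuous_on (X \<times> A) (\<lambda>z. \<integral>y. v y \<partial>trans M z)"
    using weakly_continuous cv by (auto simp: weakly_continuous_kernel_def)
  then show ?thesis
    using f unfolding Q_value_def[abs_def] lipschitz_cost_def by (intro continuous_intros) auto
qed

lemma Q_value_mono:
  assumes "L-lipschitz_on X v" "L'-lipschitz_on X v'" "\<And>y. y \<in> X \<Longrightarrow> v y \<le> v' y + e" "x \<in> X" "a \<in> A"
  shows "Q_value f v (x, a) \<le> Q_value f v' (x, a) + \<beta> * e"
proof -
  have p: "prob_space (trans M (x, a))" and s: "sets (trans M (x, a)) = sets (restrict_space borel X)"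
    using trans_prob[OF assms(4,5)] by (auto simp: space_prob_algebra)
  interpret prob_space "trans M (x, a)" by fact
  have "(\<integral>y. v y \<partial>trans M (x, a)) \<le> (\<integral>y. v' y + e \<partial>trans M (x, a))"
    using assms sets_eq_imp_space_eq[OF s]
    by (intro integral_mono) (auto simp: lipschitz_integrable space_restrict_space)
  also have "\<dots> = (\<integral>y. v' y \<partial>trans M (x, a)) + e"
    using lipschitz_integrable[OF assms(2,4,5)] by (simp add: prob_space)
  finally have "\<beta> * (\<integral>y. v y \<partial>trans M (x, a)) \<le> \<beta> * ((\<integral>y. v' y \<partial>trans M (x, a)) + e)"
    using \<beta> by (intro mult_left_mono) auto
  then show ?thesis by (simp add: Q_value_def algebra_simps)
qed

lemma Q_value_nonneg:
  assumes "\<And>z. z \<in> X \<times> A \<Longrightarrow> 0 \<le> f z" "\<And>y. y \<in> X \<Longrightarrow> 0 \<le> v y" "x \<in> X" "a \<in> A"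
  shows "0 \<le> Q_value f v (x, a)"
proof -
  have s: "sets (trans M (x, a)) = sets (restrict_space borel X)"
    using trans_prob[OF assms(3,4)] by (auto simp: space_prob_algebra)
  have "0 \<le> (\<integral>y. v y \<partial>trans M (x, a))"
    using assms sets_eq_imp_space_eq[OF s]
    by (intro integral_nonneg_AE AE_I2) (auto simp: space_restrict_space)
  then show ?thesis using assms \<beta> by (simp add: Q_value_def)
qed

text \<open>
  The iterate after \<open>n\<close> steps from \<open>0\<close>. It increases because the costs
  are nonnegative, it stays \<open>L\<close>-Lipschitz because \<open>K + \<beta> K\<^sub>p L =
  L\<close>, and consecutive iterates differ by at most \<open>\<beta> ^ n * B\<close>. Working
  with a late iterate avoids the passage to the fixed point.
\<close>

lemma value_iteration:
  fixes K :: real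
  defines "L \<equiv> K / (1 - \<beta> * K\<^sub>p)"
  assumes f: "lipschitz_cost K f" and f0: "\<And>z. z \<in> X \<times> A \<Longrightarrow> 0 \<le> f z \<and> f z \<le> B"
  shows "\<exists>v. L-lipschitz_on X v \<and> (\<forall>x\<in>X. 0 \<le> v x) \<and> (\<forall>x\<in>X. v x \<le> bellman f v x) \<and>
    (\<forall>x\<in>X. bellman f v x \<le> v x + \<beta> ^ n * B)"
proof -
  have pos: "0 < 1 - \<beta> * K\<^sub>p" using contraction by (simp add: mult.commute)
  have K: "0 \<le> K" using f A_nonempty by (auto simp: lipschitz_cost_def dest: lipschitz_on_nonneg)
  then have L: "0 \<le> L" using pos by (simp add: L_def)
  have LK: "K + \<beta> * K\<^sub>p * L = L" using pos by (simp add: L_def field_simps)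
  have bdd: "bdd_below ((\<lambda>a. Q_value f v (x, a)) ` A)" if "\<And>y. y \<in> X \<Longrightarrow> 0 \<le> v y" "x \<in> X" for v x
    using Q_value_nonneg[of f v x] f0 that by (intro bdd_belowI[of _ 0]) auto
  show ?thesis
  proof (induction n)
    case 0
    have Q0: "Q_value f (\<lambda>_. 0) z = f z" for z by (simp add: Q_value_def)
    have "bellman f (\<lambda>_. 0) x \<le> B" "0 \<le> bellman f (\<lambda>_. 0) x" if x: "x \<in> X" for x
    proof -
      obtain a where a: "a \<in> A" using A_nonempty by auto
      have "bellman f (\<lambda>_. 0) x \<le> Q_value f (\<lambda>_. 0) (x, a)"
        unfolding bellman_def by (rule cINF_lower[OF bdd a]) (use x in auto)
      then show "bellman f (\<lambda>_. 0) x \<le> B" using f0[of "(x, a)"] x a by (simp add: Q0)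
      show "0 \<le> bellman f (\<lambda>_. 0) x"
        unfolding bellman_def using f0 x by (intro cINF_greatest[OF A_nonempty]) (auto simp: Q0)
    qed
    moreover have "L-lipschitz_on X (\<lambda>_. 0::real)" using L by (intro lipschitz_onI) auto
    ultimately show ?case by (intro exI[of _ "\<lambda>_. 0"]) simp
  next
    case (Suc n)
    then obtain v where v: "L-lipschitz_on X v" "\<And>x. x \<in> X \<Longrightarrow> 0 \<le> v x"
      "\<And>x. x \<in> X \<Longrightarrow> v x \<le> bellman f v x" "\<And>x. x \<in> X \<Longrightarrow> bellman f v x \<le> v x + \<beta> ^ n * B"
      by blast
    let ?T = "bellman f v"
    have T_le: "?T x \<le> Q_value f v (x, a)" if "x \<in> X" "a \<in> A" for x a
      unfolding bellman_def by (rule cINF_lower[OF bdd]) (use that v in auto)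
    have "?T x \<le> ?T y + L * dist x y" if xy: "x \<in> X" "y \<in> X" for x y
    proof -
      have "?T x - L * dist x y \<le> Q_value f v (y, a)" if a: "a \<in> A" for a
        using T_le[OF xy(1) a] lipschitz_Q_value[OF f v(1) xy a] LK by (simp add: abs_le_iff)
      then have "?T x - L * dist x y \<le> ?T y"
        unfolding bellman_def[of f v y] by (intro cINF_greatest[OF A_nonempty]) auto
      then show ?thesis by simp
    qed
    note Tl = this
    have TL: "L-lipschitz_on X ?T"
    proof (rule lipschitz_onI[OF _ L])
      show "dist (?T x) (?T y) \<le> L * dist x y" if "x \<in> X" "y \<in> X" for x y
        using Tl[OF that] Tl[OF that(2,1)] by (simp add: dist_real_def abs_le_iff dist_commute)
    qed
    have T0: "0 \<le> ?T x" if "x \<in> X" for x using v(2,3)[OF that] by simp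
    have "?T x \<le> bellman f ?T x" if x: "x \<in> X" for x
      unfolding bellman_def[of f ?T x]
    proof (rule cINF_greatest[OF A_nonempty])
      fix a assume a: "a \<in> A"
      have "Q_value f v (x, a) \<le> Q_value f ?T (x, a) + \<beta> * 0"
        by (rule Q_value_mono[OF v(1) TL _ x a]) (use v in simp)
      with T_le[OF x a] show "?T x \<le> Q_value f ?T (x, a)" by simp
    qed
    moreover have "bellman f ?T x \<le> ?T x + \<beta> ^ Suc n * B" if x: "x \<in> X" for x
    proof -
      have "bellman f ?T x - \<beta> ^ Suc n * B \<le> Q_value f v (x, a)" if a: "a \<in> A" for a
      proof -
        have "bellman f ?T x \<le> Q_value f ?T (x, a)"
          unfolding bellman_def[of f ?T x] by (rule cINF_lower[OF bdd a]) (use T0 x in auto)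
        also have "\<dots> \<le> Q_value f v (x, a) + \<beta> * (\<beta> ^ n * B)"
          by (rule Q_value_mono[OF TL v(1) _ x a]) (use v in simp)
        finally show ?thesis by simp
      qed
      then have "bellman f ?T x - \<beta> ^ Suc n * B \<le> ?T x"
        unfolding bellman_def[of f v x] by (intro cINF_greatest[OF A_nonempty]) auto
      then show ?thesis by simp
    qed
    ultimately show ?case using TL T0 by (intro exI[of _ ?T]) auto
  qed
qed

text \<open>
  The exact inequality on one side gives lower bounds for all policies, the approximate one on the
  other side gives a selector of nearly optimal actions.
\<close>

lemma almost_optimality_equation:
  fixes K :: real
  assumes f: "lipschitz_cost K f" and f0: "\<And>z. z \<in> X \<times> A \<Longrightarrow> 0 \<le> f z \<and> f z \<le> B" and \<epsilon>: "0 < \<epsilon>"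
  obtains v where "(K / (1 - \<beta> * K\<^sub>p))-lipschitz_on X v" "\<And>x. x \<in> X \<Longrightarrow> 0 \<le> v x"
    "\<And>x a. x \<in> X \<Longrightarrow> a \<in> A \<Longrightarrow> v x \<le> Q_value f v (x, a)"
    "\<And>x. x \<in> X \<Longrightarrow> \<exists>a\<in>A. Q_value f v (x, a) < v x + \<epsilon>"
proof -
  have "(\<lambda>n. \<beta> ^ n * B) \<longlonglongrightarrow> 0 * B"
    using \<beta> by (intro tendsto_mult LIMSEQ_realpow_zero tendsto_const) auto
  then have "\<forall>\<^sub>F n in sequentially. \<beta> ^ n * B < \<epsilon>"
    using \<epsilon> by (intro order_tendstoD) auto
  then obtain n where n: "\<beta> ^ n * B < \<epsilon>" by (auto simp: eventually_sequentially)
  from value_iteration[OF f f0, of n] obtain v where v: "(K / (1 - \<beta> * K\<^sub>p))-lipschitz_on X v" "\<And>x. x \<in> X \<Longrightarrow> 0 \<le> v x"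
    "\<And>x. x \<in> X \<Longrightarrow> v x \<le> bellman f v x" "\<And>x. x \<in> X \<Longrightarrow> bellman f v x \<le> v x + \<beta> ^ n * B"
    by auto
  have bdd: "bdd_below ((\<lambda>a. Q_value f v (x, a)) ` A)" if "x \<in> X" for x
    using Q_value_nonneg[of f v x] f0 that v by (intro bdd_belowI[of _ 0]) auto
  show thesis
  proof
    show "v x \<le> Q_value f v (x, a)" if "x \<in> X" "a \<in> A" for x a
      using v(3)[OF that(1)] cINF_lower[OF bdd[OF that(1)] that(2)] by (simp add: bellman_def)
    show "\<exists>a\<in>A. Q_value f v (x, a) < v x + \<epsilon>" if x: "x \<in> X" for x
      using v(4)[OF x] n cINF_less_iff[OF A_nonempty bdd[OF x], of "v x + \<epsilon>"] by (simp add: bellman_def)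
  qed (use v in auto)
qed

text \<open>
  By continuity in the action, a strict inequality that holds for some action holds for an element
  of a countable dense set of actions; the first one in an enumeration depends measurably on the
  state.
\<close>

lemma measurable_selector:
  assumes g: "continuous_on (X \<times> A) g" and vm[measurable]: "v \<in> borel_measurable (states M)"
    and ex: "\<And>x. x \<in> X \<Longrightarrow> \<exists>a\<in>A. g (x, a) < (v x :: real)"
  obtains \<phi> where "\<phi> \<in> states M \<rightarrow>\<^sub>M actions M" "\<And>x. x \<in> X \<Longrightarrow> g (x, \<phi> x) < v x"
proof -
  obtain D where D: "countable D" "D \<subseteq> A" "A \<subseteq> closure D" by (rule separable)
  have "D \<noteq> {}" using D(3) A_nonempty by auto
  define e where "e = from_nat_into D"
  have e: "range e = D" unfolding e_def using D(1) \<open>D \<noteq> {}\<close> by (rule range_from_nat_into[rotated])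
  have eA: "e i \<in> A" for i using e D(2) by auto
  have ex_e: "\<exists>i. g (x, e i) < v x" if x: "x \<in> X" for x
  proof -
    obtain a where a: "a \<in> A" "g (x, a) < v x" using ex[OF x] by auto
    have "continuous_on A (\<lambda>a. g (x, a))"
      by (rule continuous_on_compose2[OF g]) (use x in \<open>auto intro!: continuous_intros\<close>)
    then have "((\<lambda>a. g (x, a)) \<longlongrightarrow> g (x, a)) (at a within A)"
      using a by (simp add: continuous_on_def)
    then have "\<forall>\<^sub>F b in at a within A. g (x, b) < v x"
      using a(2) by (rule order_tendstoD)
    then obtain r where r: "0 < r" "\<And>b. b \<in> A \<Longrightarrow> b \<noteq> a \<Longrightarrow> dist b a < r \<Longrightarrow> g (x, b) < v x"
      by (auto simp: eventually_at)
    obtain b where "b \<in> D" "dist b a < r"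
      using D(3) a(1) r(1) by (metis closure_approachable subsetD)
    moreover from this have "g (x, b) < v x" using r(2)[of b] a D(2) by (cases "b = a") auto
    ultimately show ?thesis using e by auto
  qed
  \<comment> \<open>The first index that works is a measurable function of \<open>x\<close> into the naturals.\<close>
  define \<phi> where "\<phi> x = e (LEAST i. g (x, e i) < v x)" for x
  show thesis
  proof
    have [measurable]: "(\<lambda>x. g (x, e i)) \<in> borel_measurable (states M)" for i
    proof -
      have "continuous_on X (\<lambda>x. g (x, e i))"
        by (rule continuous_on_compose2[OF g]) (use eA in \<open>auto intro!: continuous_intros\<close>)
      then show ?thesis unfolding states_M by (rule borel_measurable_continuous_on_restrict)
    qed
    have "(\<lambda>x. LEAST i. g (x, e i) < v x) \<in> states M \<rightarrow>\<^sub>M count_space UNIV"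
      by measurable
    moreover have "e \<in> count_space UNIV \<rightarrow>\<^sub>M actions M" using eA by (simp add: space_M)
    ultimately show "\<phi> \<in> states M \<rightarrow>\<^sub>M actions M"
      unfolding \<phi>_def[abs_def] by (rule measurable_compose)
    show "g (x, \<phi> x) < v x" if "x \<in> X" for x
      unfolding \<phi>_def using LeastI_ex[OF ex_e[OF that]] .
  qed
qed

end

section \<open>The quantized model\<close>

locale quantized_cmdp = lipschitz_cmdp M X A \<beta> K\<^sub>p
  for M :: "('x::euclidean_space, 'b::{metric_space, second_countable_topology}) cmdp" and X A \<beta> K\<^sub>p +
  fixes G :: "'x set" and Q :: "'x \<Rightarrow> 'x" and \<nu> :: "'x measure" and \<delta> :: real
  assumes finite_G: "finite G" and G_subset: "G \<subseteq> X"
    and nearest: "nearest_point_map (states M) G Q"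
    and mesh: "\<And>x. x \<in> X \<Longrightarrow> dist x (Q x) \<le> \<delta>"
    and sets_\<nu>: "sets \<nu> = sets (states M)"
    and cell_mass: "\<And>y. y \<in> G \<Longrightarrow>
      0 < emeasure \<nu> (cell (states M) Q y) \<and> emeasure \<nu> (cell (states M) Q y) < \<infinity>"
begin

abbreviation cell_law :: "'x \<Rightarrow> 'x measure" where
  "cell_law x \<equiv> uniform_measure \<nu> (cell (states M) Q x)"

definition cell_average :: "('x \<times> 'b \<Rightarrow> real) \<Rightarrow> 'x \<times> 'b \<Rightarrow> real" where
  "cell_average f = (\<lambda>(x, a). \<integral>z. f (z, a) \<partial>cell_law x)"

definition M_fin :: "('x, 'b) cmdp" where
  "M_fin = finite_model M G Q \<nu>"

lemma M_fin_sel: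
  "states M_fin = count_space G" "actions M_fin = actions M"
  "init M_fin = distr (init M) (count_space G) Q"
  "cost M_fin = cell_average (cost M)" "ccost M_fin l = cell_average (ccost M l)"
  "trans M_fin xa = point_measure G (\<lambda>y. ennreal (cell_average (\<lambda>za. measure (trans M za) (cell (states M) Q y)) xa))"
  by (simp_all add: M_fin_def finite_model_def cell_average_def Let_def)

lemma space_M_fin: "space (states M_fin) = G" "space (steps M_fin) = G \<times> A"
  by (simp_all add: M_fin_sel space_pair_measure space_M)

lemma Q_measurable[measurable]: "Q \<in> states M \<rightarrow>\<^sub>M count_space G"
  using nearest by (simp add: nearest_point_map_def)

lemma Q_in_G: "x \<in> X \<Longrightarrow> Q x \<in> G"
  using measurable_space[OF Q_measurable, of x] by (simp add: space_M)

lemma cell_sets[measurable]: "y \<in> G \<Longrightarrow> cell (states M) Q y \<in> sets (states M)"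
  unfolding cell_def by (rule measurable_sets[OF Q_measurable]) auto

lemma in_cell: "z \<in> cell (states M) Q y \<longleftrightarrow> z \<in> X \<and> Q z = y"
  by (auto simp: cell_def space_M)

lemma prob_space_cell_law: "y \<in> G \<Longrightarrow> prob_space (cell_law y)"
  using cell_mass[of y] by (intro prob_space_uniform_measure) auto

lemma sets_cell_law[measurable_cong]: "sets (cell_law y) = sets (states M)"
  by (simp add: sets_\<nu>)

lemma space_cell_law: "space \<nu> = X" "space (cell_law y) = X"
  using sets_eq_imp_space_eq[OF sets_\<nu>] by (simp_all add: space_M)

lemma AE_cell_law: "y \<in> G \<Longrightarrow> AE z in cell_law y. z \<in> X \<and> dist z y \<le> \<delta>"
  by (rule AE_uniform_measureI) (use mesh in \<open>auto simp: sets_\<nu> in_cell\<close>)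

lemma steps_section_measurable:
  assumes "h \<in> borel_measurable (steps M)" "a \<in> A"
  shows "(\<lambda>z. h (z, a)) \<in> borel_measurable (states M)"
  using assms by (intro measurable_compose[OF measurable_Pair2' assms(1)]) (auto simp: space_M)

lemma integrable_cell_law:
  fixes h :: "'x \<times> 'b \<Rightarrow> real"
  assumes h: "h \<in> borel_measurable (steps M)" and b: "\<And>z. z \<in> X \<times> A \<Longrightarrow> \<bar>h z\<bar> \<le> B" and "y \<in> G" "a \<in> A"
  shows "integrable (cell_law y) (\<lambda>z. h (z, a))"
proof -
  interpret prob_space "cell_law y" by (rule prob_space_cell_law) fact
  show ?thesis
    by (rule integrable_const_bound[where B=B])
       (use b assms(3,4) steps_section_measurable[OF h] in
         \<open>auto simp: space_cell_law sets_\<nu> cong: measurable_cong_sets intro!: AE_I2\<close>)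
qed

lemma cell_average_measurable:
  assumes h[measurable]: "h \<in> borel_measurable (steps M)"
  shows "cell_average h \<in> borel_measurable (steps M_fin)"
  unfolding M_fin_sel
proof (rule measurable_pair_measure_countable1)
  show "countable G" using finite_G by (rule countable_finite)
  fix x assume x: "x \<in> G"
  interpret prob_space "cell_law x" by (rule prob_space_cell_law) fact
  have "(\<lambda>a. \<integral>z. h (z, a) \<partial>cell_law x) \<in> borel_measurable (actions M)"
    by (rule borel_measurable_lebesgue_integral) measurable
  then show "(\<lambda>a. cell_average h (x, a)) \<in> borel_measurable (actions M)" by (simp add: cell_average_def)
qed

lemma cell_average_bounds:
  assumes "bounded_cost M B f"
  shows "bounded_cost M_fin B (cell_average f)"
proof -
  have f: "f \<in> borel_measurable (steps M)" "\<And>z. z \<in> X \<times> A \<Longrightarrow> 0 \<le> f z \<and> f z \<le> B"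
    using assms by (auto simp: bounded_cost_def space_M)
  have "0 \<le> cell_average f (x, a) \<and> cell_average f (x, a) \<le> B" if "x \<in> G" "a \<in> A" for x a
    unfolding cell_average_def
    using prob_space.integrable_nonneg_bounded(2,3)[OF prob_space_cell_law[OF that(1)], of "\<lambda>z. f (z, a)" B]
      f(2) that steps_section_measurable[OF f(1) that(2)]
    by (auto simp: space_cell_law sets_\<nu> cong: measurable_cong_sets)
  with cell_average_measurable[OF f(1)] show ?thesis
    by (auto simp: bounded_cost_def space_M_fin)
qed

lemma transition_probability_measurable:
  "y \<in> G \<Longrightarrow> (\<lambda>za. measure (trans M za) (cell (states M) Q y)) \<in> borel_measurable (steps M)"
  by measurable

lemma trans_prob_space:
  assumes "z \<in> X" "a \<in> A"
  shows "prob_space (trans M (z, a))" "sets (trans M (z, a)) = sets (states M)" "space (trans M (z, a)) = X"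
  using trans_prob[OF assms] sets_eq_imp_space_eq[of "trans M (z, a)" "states M"]
  by (auto simp: space_prob_algebra states_M space_restrict_space)

text \<open>
  The function \<open>y \<mapsto> u (Q y)\<close> is a step function on the cells.
\<close>

lemma integral_trans_grid_function:
  fixes u :: "'x \<Rightarrow> real"
  assumes "z \<in> X" "a \<in> A"
  shows "(\<integral>y. u (Q y) \<partial>trans M (z, a)) = (\<Sum>y\<in>G. measure (trans M (z, a)) (cell (states M) Q y) * u y)"
proof -
  note T = trans_prob_space[OF assms]
  interpret prob_space "trans M (z, a)" by (rule T(1))
  have cell_sub: "cell (states M) Q g \<subseteq> X" for g by (auto simp: in_cell)
  have "(\<integral>y. u (Q y) \<partial>trans M (z, a)) = (\<integral>y. (\<Sum>g\<in>G. u g * indicator (cell (states M) Q g) y) \<partial>trans M (z, a))"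
  proof (rule Bochner_Integration.integral_cong)
    fix y assume "y \<in> space (trans M (z, a))"
    then have y: "y \<in> X" by (simp add: T)
    have "(\<Sum>g\<in>G. u g * indicator (cell (states M) Q g) y) = (\<Sum>g\<in>G. if g = Q y then u g else 0)"
      using y by (intro sum.cong) (auto simp: in_cell)
    then show "u (Q y) = (\<Sum>g\<in>G. u g * indicator (cell (states M) Q g) y)"
      using finite_G Q_in_G[OF y] by simp
  qed simp
  also have "\<dots> = (\<Sum>g\<in>G. u g * measure (trans M (z, a)) (cell (states M) Q g))"
    by (subst Bochner_Integration.integral_sum) (auto simp: T Int_absorb2 cell_sub less_top[symmetric] intro!: integrable_real_indicator)
  finally show ?thesis by (simp add: mult.commute)
qed

text \<open>
  The finite transition kernel is the average over the cell of the original kernel pushed forward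
  by \<open>Q\<close>.
\<close>

lemma integral_trans_fin:
  fixes u :: "'x \<Rightarrow> real"
  assumes x: "x \<in> G" and a: "a \<in> A"
  shows "(\<integral>y. u y \<partial>trans M_fin (x, a)) = (\<integral>z. (\<integral>y. u (Q y) \<partial>trans M (z, a)) \<partial>cell_law x)"
proof -
  let ?P = "\<lambda>y za. measure (trans M za) (cell (states M) Q y)"
  have int: "integrable (cell_law x) (\<lambda>z. ?P y (z, a))" if "y \<in> G" for y
    by (rule integrable_cell_law[OF transition_probability_measurable[OF that] _ x a, where B=1])
      (auto intro: prob_space.prob_le_1 trans_prob_space)
  have "(\<integral>y. u y \<partial>trans M_fin (x, a)) = (\<Sum>y\<in>G. cell_average (?P y) (x, a) * u y)"
    unfolding M_fin_sel using finite_G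
    by (subst lebesgue_integral_point_measure_finite) (auto simp: cell_average_def)
  also have "\<dots> = (\<integral>z. (\<Sum>y\<in>G. ?P y (z, a) * u y) \<partial>cell_law x)"
    using int by (subst Bochner_Integration.integral_sum) (auto simp: cell_average_def)
  also have "\<dots> = (\<integral>z. (\<integral>y. u (Q y) \<partial>trans M (z, a)) \<partial>cell_law x)"
    by (intro Bochner_Integration.integral_cong) (auto simp: space_cell_law integral_trans_grid_function a)
  finally show ?thesis .
qed

lemma trans_fin_prob_space:
  assumes x: "x \<in> G" and a: "a \<in> A"
  shows "prob_space (trans M_fin (x, a))"
proof -
  let ?P = "\<lambda>y za. measure (trans M za) (cell (states M) Q y)"
  interpret U: prob_space "cell_law x" by (rule prob_space_cell_law) fact
  have nn: "0 \<le> cell_average (?P y) (x, a)" for y by (simp add: cell_average_def)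
  have "(\<Sum>y\<in>G. cell_average (?P y) (x, a)) = (\<integral>y. (1::real) \<partial>trans M_fin (x, a))"
    unfolding M_fin_sel using finite_G
    by (subst lebesgue_integral_point_measure_finite) (auto simp: nn)
  also have "\<dots> = (\<integral>z. (\<integral>y. 1 \<partial>trans M (z, a)) \<partial>cell_law x)"
    by (rule integral_trans_fin[OF x a])
  also have "\<dots> = (\<integral>z. 1 \<partial>cell_law x)"
    using prob_space.prob_space[OF trans_prob_space(1)[OF _ a]]
    by (intro Bochner_Integration.integral_cong) (auto simp: space_cell_law)
  also have "\<dots> = 1" using U.prob_space by simp
  finally have "(\<Sum>y\<in>G. ennreal (cell_average (?P y) (x, a))) = 1"
    using nn by simp
  then show ?thesis
    unfolding M_fin_sel using finite_G by (intro prob_space_point_measure) auto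
qed

lemma cmdp_kernels_M_fin: "cmdp_kernels M_fin"
proof
  have "init M \<in> space (prob_algebra (states M))" by (rule init_prob)
  then have "distr (init M) (count_space G) Q \<in> space (prob_algebra (count_space G))"
    using measurable_space[OF measurable_distr_prob_space[OF Q_measurable]] by simp
  then show "init M_fin \<in> space (prob_algebra (states M_fin))" by (simp add: M_fin_sel)
  show "trans M_fin \<in> steps M_fin \<rightarrow>\<^sub>M prob_algebra (states M_fin)"
  proof (rule measurable_prob_algebraI)
    show p: "prob_space (trans M_fin xa)" if "xa \<in> space (steps M_fin)" for xa
      using that trans_fin_prob_space by (auto simp: space_M_fin)
    show "trans M_fin \<in> steps M_fin \<rightarrow>\<^sub>M subprob_algebra (states M_fin)"
    proof (rule measurable_subprob_algebra)
      fix B assume "B \<in> sets (states M_fin)"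
      then have B: "B \<subseteq> G" by (simp add: M_fin_sel)
      have "emeasure (trans M_fin xa) B =
          (\<Sum>y\<in>B. ennreal (cell_average (\<lambda>za. measure (trans M za) (cell (states M) Q y)) xa))" for xa
        unfolding M_fin_sel using B finite_G by (intro emeasure_point_measure_finite) auto
      moreover have "(\<lambda>xa. \<Sum>y\<in>B. ennreal (cell_average (\<lambda>za. measure (trans M za) (cell (states M) Q y)) xa))
          \<in> borel_measurable (steps M_fin)"
        using B by (intro borel_measurable_sum measurable_compose[OF _ measurable_ennreal]
            cell_average_measurable transition_probability_measurable) auto
      ultimately show "(\<lambda>xa. emeasure (trans M_fin xa) B) \<in> borel_measurable (steps M_fin)"
        by simp
    qed (use p in \<open>auto intro: prob_space_imp_subprob_space simp: M_fin_sel sets_point_measure\<close>)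
  qed
qed

sublocale fin: cmdp_kernels M_fin by (rule cmdp_kernels_M_fin)

end

section \<open>Transfer of policies between the two models\<close>

lemma (in prob_space) integral_close_to_constant:
  fixes w :: "'a \<Rightarrow> real"
  assumes "integrable M w" "AE z in M. \<bar>w z - c\<bar> \<le> e"
  shows "\<bar>(\<integral>z. w z \<partial>M) - c\<bar> \<le> e"
proof -
  have "(\<integral>z. w z \<partial>M) \<le> (\<integral>z. c + e \<partial>M)"
    by (rule integral_mono_AE) (use assms in \<open>auto elim: eventually_mono\<close>)
  moreover have "(\<integral>z. c - e \<partial>M) \<le> (\<integral>z. w z \<partial>M)"
    by (rule integral_mono_AE) (use assms in \<open>auto elim: eventually_mono\<close>)
  ultimately show ?thesis by (simp add: prob_space abs_le_iff)
qed

context cmdp_kernels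
begin

lemma discounted_cost_cong:
  assumes "0 < \<beta>" "\<beta> < 1" "\<pi> \<in> policies M" "bounded_cost M B f" "bounded_cost M B' g"
    and "\<And>z. z \<in> space (steps M) \<Longrightarrow> f z = g z"
  shows "discounted_cost \<beta> M f \<pi> = discounted_cost \<beta> M g \<pi>"
proof -
  have "(\<integral>z. f z \<partial>step_law M \<pi> t) = (\<integral>z. g z \<partial>step_law M \<pi> t)" for t
    using assms(6) by (intro Bochner_Integration.integral_cong) (auto simp: space_step_law)
  then show ?thesis
    by (simp add: discounted_cost_eq[OF assms(1-3,4)] discounted_cost_eq[OF assms(1-3,5)])
qed

end

context lipschitz_cmdp
begin

lemma lipschitz_measurable:
  "L-lipschitz_on X (v :: 'x \<Rightarrow> real) \<Longrightarrow> v \<in> borel_measurable (states M)"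
  unfolding states_M by (intro borel_measurable_continuous_on_restrict lipschitz_on_continuous_on)

lemma lipschitz_bounded:
  assumes "L-lipschitz_on X (v :: 'x \<Rightarrow> real)"
  obtains C where "\<And>x. x \<in> X \<Longrightarrow> v x \<le> C"
proof -
  have "bounded (v ` X)"
    by (intro compact_imp_bounded compact_continuous_image lipschitz_on_continuous_on[OF assms] compact_X)
  then obtain C where "\<forall>y\<in>v ` X. norm y \<le> C" unfolding bounded_iff by blast
  then show thesis by (intro that[of C]) auto
qed

lemma lipschitz_cost_bounded_cost:
  assumes "lipschitz_cost K f" "\<And>z. z \<in> X \<times> A \<Longrightarrow> 0 \<le> f z \<and> f z \<le> B"
  shows "bounded_cost M B f"
  using assms continuous_on_measurable_product[of X A f]
  by (auto simp: bounded_cost_def lipschitz_cost_def states_M actions_M space_pair_measure space_restrict_space)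

end

context quantized_cmdp
begin

lemma Q_in_X: "x \<in> X \<Longrightarrow> Q x \<in> X"
  using Q_in_G G_subset by blast

lemma integral_grid_projection:
  assumes \<mu>: "\<mu> \<in> space (prob_algebra (states M))" and v: "L-lipschitz_on X v"
  shows "\<bar>(\<integral>y. v (Q y) \<partial>\<mu>) - (\<integral>y. v y \<partial>\<mu>)\<bar> \<le> L * (\<delta> :: real)"
proof -
  have p: "prob_space \<mu>" and s: "sets \<mu> = sets (states M)"
    using \<mu> by (auto simp: space_prob_algebra)
  note [measurable_cong] = s
  interpret prob_space \<mu> by (rule p)
  have sp: "space \<mu> = X" using sets_eq_imp_space_eq[OF s] by (simp add: space_M)
  have [measurable]: "v \<in> borel_measurable \<mu>" "(\<lambda>y. v (Q y)) \<in> borel_measurable \<mu>"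
    using lipschitz_measurable[OF v] measurable_compose[OF Q_measurable, of v borel]
    by (auto cong: measurable_cong_sets)
  have "bounded (v ` X)"
    by (intro compact_imp_bounded compact_continuous_image lipschitz_on_continuous_on[OF v] compact_X)
  then obtain C where "\<forall>y\<in>v ` X. norm y \<le> C" unfolding bounded_iff by blast
  then have C: "\<bar>v x\<bar> \<le> C" if "x \<in> X" for x using that by auto
  have int: "integrable \<mu> v" "integrable \<mu> (\<lambda>y. v (Q y))"
    using C Q_in_X by (auto intro!: integrable_const_bound[where B=C] AE_I2 simp: sp)
  have L: "0 \<le> L" using v by (rule lipschitz_on_nonneg)
  have "\<bar>v (Q y) - v y\<bar> \<le> L * \<delta>" if y: "y \<in> X" for y
  proof -
    have "\<bar>v (Q y) - v y\<bar> \<le> L * dist (Q y) y"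
      using lipschitz_onD[OF v, of "Q y" y] Q_in_G[OF y] G_subset y by (auto simp: dist_real_def)
    also have "\<dots> \<le> L * \<delta>" using mesh[OF y] L by (intro mult_left_mono) (simp_all add: dist_commute)
    finally show ?thesis .
  qed
  then have "\<bar>(\<integral>y. v (Q y) - v y \<partial>\<mu>) - 0\<bar> \<le> L * \<delta>"
    using int by (intro integral_close_to_constant AE_I2) (auto simp: sp)
  then show ?thesis using int by simp
qed

text \<open>
  The two discretization errors: the inner integral replaces \<open>v y\<close> by \<open>v (Q
  y)\<close>, at the price \<open>\<beta> L \<delta>\<close>, and the outer one averages over the
  states of a cell, within \<open>\<delta>\<close> of the grid point, at the price \<open>L
  \<delta>\<close>.
\<close>

lemma grid_Q_value:
  fixes K :: real
  defines "L \<equiv> K / (1 - \<beta> * K\<^sub>p)"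
  assumes f: "lipschitz_cost K f" and f0: "\<And>z. z \<in> X \<times> A \<Longrightarrow> 0 \<le> f z \<and> f z \<le> B"
    and v: "L-lipschitz_on X v" and v0: "\<And>x. x \<in> X \<Longrightarrow> 0 \<le> v x" and x: "x \<in> G" and a: "a \<in> A"
  shows "\<bar>cell_average f (x, a) + \<beta> * (\<integral>y. v y \<partial>trans M_fin (x, a)) - Q_value f v (x, a)\<bar> \<le> (1 + \<beta>) * (L * \<delta>)"
proof -
  have LK: "K + \<beta> * K\<^sub>p * L = L"
    using contraction by (simp add: L_def field_simps)
  have L: "0 \<le> L" using v by (rule lipschitz_on_nonneg)
  interpret U: prob_space "cell_law x" by (rule prob_space_cell_law) fact
  obtain C where C: "\<And>x. x \<in> X \<Longrightarrow> v x \<le> C" using lipschitz_bounded[OF v] by blast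
  have fb: "bounded_cost M B f" by (rule lipschitz_cost_bounded_cost[OF f f0])
  have nb: "bounded_cost M C (\<lambda>z. \<integral>y. v (Q y) \<partial>trans M z)"
    using measurable_compose[OF Q_measurable, of v borel] v0 C Q_in_X
    by (intro bounded_cost_next) (auto simp: space_M)
  have intf: "integrable (cell_law x) (\<lambda>z. f (z, a))"
    using fb by (intro integrable_cell_law[OF _ _ x a, where B=B]) (auto simp: bounded_cost_def space_M)
  have intn: "integrable (cell_law x) (\<lambda>z. \<integral>y. v (Q y) \<partial>trans M (z, a))"
    using nb by (intro integrable_cell_law[OF _ _ x a, where B=C]) (auto simp: bounded_cost_def space_M)
  let ?w = "\<lambda>z. f (z, a) + \<beta> * (\<integral>y. v (Q y) \<partial>trans M (z, a))"
  have close: "\<bar>?w z - Q_value f v (x, a)\<bar> \<le> (1 + \<beta>) * (L * \<delta>)" if z: "z \<in> X \<and> dist z x \<le> \<delta>" for z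
  proof -
    have "\<bar>(\<integral>y. v (Q y) \<partial>trans M (z, a)) - (\<integral>y. v y \<partial>trans M (z, a))\<bar> \<le> L * \<delta>"
      using trans_prob[of z a] z a by (intro integral_grid_projection v) (auto simp: states_M)
    then have "\<beta> * \<bar>(\<integral>y. v (Q y) \<partial>trans M (z, a)) - (\<integral>y. v y \<partial>trans M (z, a))\<bar> \<le> \<beta> * (L * \<delta>)"
      using \<beta> by (intro mult_left_mono) auto
    then have 1: "\<bar>?w z - Q_value f v (z, a)\<bar> \<le> \<beta> * (L * \<delta>)"
      using \<beta> by (simp add: Q_value_def abs_mult flip: right_diff_distrib)
    have "\<bar>Q_value f v (z, a) - Q_value f v (x, a)\<bar> \<le> L * dist z x"
      using lipschitz_Q_value[OF f v, of z x a] z x a G_subset LK by auto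
    also have "\<dots> \<le> L * \<delta>" using z L by (intro mult_left_mono) auto
    finally show ?thesis using 1 by (simp add: algebra_simps)
  qed
  have "\<bar>(\<integral>z. ?w z \<partial>cell_law x) - Q_value f v (x, a)\<bar> \<le> (1 + \<beta>) * (L * \<delta>)"
    using intf intn
    by (intro U.integral_close_to_constant eventually_mono[OF AE_cell_law[OF x] close]) auto
  moreover have "(\<integral>z. ?w z \<partial>cell_law x) = cell_average f (x, a) + \<beta> * (\<integral>y. v y \<partial>trans M_fin (x, a))"
    using intf intn by (simp add: integral_trans_fin[OF x a] cell_average_def)
  ultimately show ?thesis by simp
qed

lemma init_grid:
  assumes "L-lipschitz_on X v"
  shows "\<bar>(\<integral>x. v x \<partial>init M_fin) - (\<integral>x. v x \<partial>init M)\<bar> \<le> L * (\<delta> :: real)"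
proof -
  have [measurable_cong]: "sets (init M) = sets (states M)" using init_prob by (simp add: space_prob_algebra)
  have "(\<integral>x. v x \<partial>init M_fin) = (\<integral>x. v (Q x) \<partial>init M)"
    unfolding M_fin_sel by (rule integral_distr) measurable
  then show ?thesis using integral_grid_projection[OF init_prob assms] by simp
qed

text \<open>
  With the factor \<open>1 - \<beta>\<close> in the cost, the error of the optimality equation
  contributes \<open>(1 + \<beta>) L \<delta>\<close> and the rounding of the initial state
  \<open>(1 - \<beta>) L \<delta>\<close>, which add up to \<open>2 L \<delta>\<close>.
\<close>

lemma transfer_to_grid:
  assumes f: "lipschitz_cost K f" and f0: "\<And>z. z \<in> X \<times> A \<Longrightarrow> 0 \<le> f z \<and> f z \<le> B"
    and \<pi>: "\<pi> \<in> policies M" and \<epsilon>: "0 < \<epsilon>"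
  obtains \<pi>' where "\<pi>' \<in> policies M_fin"
    "discounted_cost \<beta> M_fin (cell_average f) \<pi>' \<le> discounted_cost \<beta> M f \<pi> + 2 * \<delta> * (K / (1 - \<beta> * K\<^sub>p)) + \<epsilon>"
proof -
  define L where "L = K / (1 - \<beta> * K\<^sub>p)"
  obtain v where v: "L-lipschitz_on X v" "\<And>x. x \<in> X \<Longrightarrow> 0 \<le> v x"
    "\<And>x a. x \<in> X \<Longrightarrow> a \<in> A \<Longrightarrow> v x \<le> Q_value f v (x, a)"
    "\<And>x. x \<in> X \<Longrightarrow> \<exists>a\<in>A. Q_value f v (x, a) < v x + \<epsilon>"
    using almost_optimality_equation[OF f f0 \<epsilon>] unfolding L_def by blast
  obtain C where C: "\<And>x. x \<in> X \<Longrightarrow> v x \<le> C" using lipschitz_bounded[OF v(1)] by blast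
  have fb: "bounded_cost M B f" by (rule lipschitz_cost_bounded_cost[OF f f0])
  have "\<forall>x. \<exists>a. x \<in> G \<longrightarrow> a \<in> A \<and> Q_value f v (x, a) < v x + \<epsilon>"
    using v(4) G_subset by blast
  then obtain \<phi> where \<phi>: "\<And>x. x \<in> G \<Longrightarrow> \<phi> x \<in> A" "\<And>x. x \<in> G \<Longrightarrow> Q_value f v (x, \<phi> x) < v x + \<epsilon>"
    by metis
  have \<phi>m: "\<phi> \<in> states M_fin \<rightarrow>\<^sub>M actions M_fin" using \<phi>(1) by (auto simp: M_fin_sel space_M)
  have "(1 - \<beta>) * (\<integral>x. v x \<partial>init M) \<le> discounted_cost \<beta> M f \<pi> + 0"
    by (rule discounted_cost_lower_bound[OF \<beta> \<pi> fb lipschitz_measurable[OF v(1)], where C=C])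
       (use v C in \<open>auto simp: space_M Q_value_def\<close>)
  moreover have "discounted_cost \<beta> M_fin (cell_average f) (fin.stationary \<phi>) \<le>
      (1 - \<beta>) * (\<integral>x. v x \<partial>init M_fin) + ((1 + \<beta>) * (L * \<delta>) + \<epsilon>)"
  proof (rule fin.discounted_cost_stationary_upper_bound[OF \<beta> \<phi>m cell_average_bounds[OF fb], where C=C])
    fix x assume "x \<in> space (states M_fin)"
    then have x: "x \<in> G" by (simp add: space_M_fin)
    show "cell_average f (x, \<phi> x) + \<beta> * (\<integral>y. v y \<partial>trans M_fin (x, \<phi> x)) \<le> v x + ((1 + \<beta>) * (L * \<delta>) + \<epsilon>)"
      using grid_Q_value[OF f f0 v(1)[unfolded L_def] v(2) x \<phi>(1)[OF x]] \<phi>(2)[OF x]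
      unfolding L_def[symmetric] by (simp add: abs_le_iff)
  qed (use v C G_subset in \<open>auto simp: space_M_fin M_fin_sel\<close>)
  moreover have "(1 - \<beta>) * (\<integral>x. v x \<partial>init M_fin) \<le> (1 - \<beta>) * ((\<integral>x. v x \<partial>init M) + L * \<delta>)"
    using init_grid[OF v(1)] \<beta> by (intro mult_left_mono) (auto simp: abs_le_iff)
  ultimately have "discounted_cost \<beta> M_fin (cell_average f) (fin.stationary \<phi>) \<le>
      discounted_cost \<beta> M f \<pi> + 2 * \<delta> * L + \<epsilon>"
    by (simp add: algebra_simps)
  then show thesis using that fin.stationary_policy[OF \<phi>m] unfolding L_def by blast
qed

lemma transfer_from_grid:
  assumes f: "lipschitz_cost K f" and f0: "\<And>z. z \<in> X \<times> A \<Longrightarrow> 0 \<le> f z \<and> f z \<le> B"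
    and \<pi>: "\<pi> \<in> policies M_fin" and \<epsilon>: "0 < \<epsilon>"
  obtains \<pi>' where "\<pi>' \<in> policies M"
    "discounted_cost \<beta> M f \<pi>' \<le> discounted_cost \<beta> M_fin (cell_average f) \<pi> + 2 * \<delta> * (K / (1 - \<beta> * K\<^sub>p)) + \<epsilon>"
proof -
  define L where "L = K / (1 - \<beta> * K\<^sub>p)"
  obtain v where v: "L-lipschitz_on X v" "\<And>x. x \<in> X \<Longrightarrow> 0 \<le> v x"
    "\<And>x a. x \<in> X \<Longrightarrow> a \<in> A \<Longrightarrow> v x \<le> Q_value f v (x, a)"
    "\<And>x. x \<in> X \<Longrightarrow> \<exists>a\<in>A. Q_value f v (x, a) < v x + \<epsilon>"
    using almost_optimality_equation[OF f f0 \<epsilon>] unfolding L_def by blast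
  obtain C where C: "\<And>x. x \<in> X \<Longrightarrow> v x \<le> C" using lipschitz_bounded[OF v(1)] by blast
  have fb: "bounded_cost M B f" by (rule lipschitz_cost_bounded_cost[OF f f0])
  have vm[measurable]: "v \<in> borel_measurable (states M)" by (rule lipschitz_measurable[OF v(1)])
  obtain \<phi> where \<phi>: "\<phi> \<in> states M \<rightarrow>\<^sub>M actions M" "\<And>x. x \<in> X \<Longrightarrow> Q_value f v (x, \<phi> x) < v x + \<epsilon>"
    by (rule measurable_selector[OF continuous_Q_value[OF f v(1)], of "\<lambda>x. v x + \<epsilon>"]) (use v(4) in auto)
  have "(1 - \<beta>) * (\<integral>x. v x \<partial>init M_fin) \<le> discounted_cost \<beta> M_fin (cell_average f) \<pi> + (1 + \<beta>) * (L * \<delta>)"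
  proof (rule fin.discounted_cost_lower_bound[OF \<beta> \<pi> cell_average_bounds[OF fb], where C=C])
    fix z assume "z \<in> space (steps M_fin)"
    then obtain x a where z: "z = (x, a)" and x: "x \<in> G" and a: "a \<in> A" by (auto simp: space_M_fin)
    show "v (fst z) \<le> cell_average f z + \<beta> * (\<integral>y. v y \<partial>trans M_fin z) + (1 + \<beta>) * (L * \<delta>)"
      using grid_Q_value[OF f f0 v(1)[unfolded L_def] v(2) x a] v(3)[of x a] x a G_subset
      unfolding L_def[symmetric] z by (auto simp: abs_le_iff)
  qed (use v C G_subset in \<open>auto simp: space_M_fin M_fin_sel\<close>)
  moreover have "discounted_cost \<beta> M f (stationary \<phi>) \<le> (1 - \<beta>) * (\<integral>x. v x \<partial>init M) + \<epsilon>"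
    by (rule discounted_cost_stationary_upper_bound[OF \<beta> \<phi>(1) fb vm, where C=C])
       (use v C \<phi>(2) in \<open>auto simp: space_M Q_value_def less_imp_le\<close>)
  moreover have "(1 - \<beta>) * (\<integral>x. v x \<partial>init M) \<le> (1 - \<beta>) * ((\<integral>x. v x \<partial>init M_fin) + L * \<delta>)"
    using init_grid[OF v(1)] \<beta> by (intro mult_left_mono) (auto simp: abs_le_iff)
  ultimately have "discounted_cost \<beta> M f (stationary \<phi>) \<le>
      discounted_cost \<beta> M_fin (cell_average f) \<pi> + 2 * \<delta> * L + \<epsilon>"
    by (simp add: algebra_simps)
  then show thesis using that stationary_policy[OF \<phi>(1)] unfolding L_def by blast
qed

lemma lipschitz_cost_weighted_sum:
  assumes "finite I" "\<And>l. l \<in> I \<Longrightarrow> lipschitz_cost (K l) (f l)" "\<And>l. l \<in> I \<Longrightarrow> 0 \<le> w l"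
  shows "lipschitz_cost (\<Sum>l\<in>I. w l * K l) (\<lambda>z. \<Sum>l\<in>I. w l * f l z)"
  unfolding lipschitz_cost_def
proof (intro conjI ballI)
  show "continuous_on (X \<times> A) (\<lambda>z. \<Sum>l\<in>I. w l * f l z)"
    using assms(2) by (intro continuous_intros) (auto simp: lipschitz_cost_def)
  fix a assume a: "a \<in> A"
  show "(\<Sum>l\<in>I. w l * K l)-lipschitz_on X (\<lambda>x. \<Sum>l\<in>I. w l * f l (x, a))"
  proof (rule lipschitz_onI)
    show "0 \<le> (\<Sum>l\<in>I. w l * K l)"
      using assms(2,3) a by (intro sum_nonneg mult_nonneg_nonneg) (auto simp: lipschitz_cost_def dest: lipschitz_on_nonneg)
    fix x y assume xy: "x \<in> X" "y \<in> X"
    have "\<bar>(\<Sum>l\<in>I. w l * f l (x, a)) - (\<Sum>l\<in>I. w l * f l (y, a))\<bar> \<le> (\<Sum>l\<in>I. \<bar>w l * (f l (x, a) - f l (y, a))\<bar>)"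
      by (simp add: right_diff_distrib flip: sum_subtractf)
    also have "\<dots> \<le> (\<Sum>l\<in>I. w l * (K l * dist x y))"
    proof (rule sum_mono)
      fix l assume l: "l \<in> I"
      have "\<bar>f l (x, a) - f l (y, a)\<bar> \<le> K l * dist x y"
        using assms(2)[OF l] a xy lipschitz_onD[of "K l" X "\<lambda>x. f l (x, a)" x y]
        by (auto simp: lipschitz_cost_def dist_real_def)
      then show "\<bar>w l * (f l (x, a) - f l (y, a))\<bar> \<le> w l * (K l * dist x y)"
        using assms(3)[OF l] by (simp add: abs_mult mult_left_mono)
    qed
    finally show "dist (\<Sum>l\<in>I. w l * f l (x, a)) (\<Sum>l\<in>I. w l * f l (y, a)) \<le> (\<Sum>l\<in>I. w l * K l) * dist x y"
      by (simp add: dist_real_def sum_distrib_right mult.assoc)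
  qed
qed

lemma cell_average_weighted_sum:
  assumes "\<And>l. l \<in> I \<Longrightarrow> bounded_cost M (B l) (f l)" "x \<in> G" "a \<in> A"
  shows "cell_average (\<lambda>z. \<Sum>l\<in>I. w l * f l z) (x, a) = (\<Sum>l\<in>I. w l * cell_average (f l) (x, a))"
proof -
  have "integrable (cell_law x) (\<lambda>z. f l (z, a))" if "l \<in> I" for l
    using assms(1)[OF that] by (intro integrable_cell_law[OF _ _ assms(2,3), where B="B l"]) (auto simp: bounded_cost_def space_M)
  then show ?thesis
    unfolding cell_average_def by (simp add: Bochner_Integration.integral_sum)
qed

end

lemma (in cmdp_kernels) convexlike_costs:
  assumes \<beta>: "0 < \<beta>" "\<beta> < 1" and f: "\<And>l. l \<in> I \<Longrightarrow> bounded_cost M (B l) (f l)"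
  shows "convexlike (policies M) I (\<lambda>l \<pi>. discounted_cost \<beta> M (f l) \<pi> - r l)"
  unfolding convexlike_def
proof (intro ballI)
  fix \<pi>1 \<pi>2 and \<theta> :: real assume \<pi>: "\<pi>1 \<in> policies M" "\<pi>2 \<in> policies M" and \<theta>: "\<theta> \<in> {0..1}"
  then obtain \<pi> where *: "\<pi> \<in> policies M" "\<And>B f. bounded_cost M B f \<Longrightarrow>
      discounted_cost \<beta> M f \<pi> = \<theta> * discounted_cost \<beta> M f \<pi>1 + (1 - \<theta>) * discounted_cost \<beta> M f \<pi>2"
    using discounted_cost_mixture[OF \<beta> \<pi>, of \<theta>] by auto
  show "\<exists>\<pi>\<in>policies M. \<forall>l\<in>I. discounted_cost \<beta> M (f l) \<pi> - r l \<le>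
      \<theta> * (discounted_cost \<beta> M (f l) \<pi>1 - r l) + (1 - \<theta>) * (discounted_cost \<beta> M (f l) \<pi>2 - r l)"
    using *(1) *(2)[OF f] by (intro bexI[of _ \<pi>]) (auto simp: algebra_simps)
qed

context quantized_cmdp
begin

text \<open>
  For fixed \<open>\<pi>\<close>, the excess of each cost over its target is a convexlike family
  of functions of the other model's policy; a weighted sum of excesses is the excess for the
  weighted sum of the costs, and the transfer of a single cost brings it below every positive number.
\<close>

lemma simultaneous_transfer:
  assumes I: "finite I" "I \<noteq> {}" and f: "\<And>l. l \<in> I \<Longrightarrow> lipschitz_cost (K l) (f l)"
    and f0: "\<And>l z. l \<in> I \<Longrightarrow> z \<in> X \<times> A \<Longrightarrow> 0 \<le> f l z \<and> f l z \<le> B l" and \<epsilon>: "0 < \<epsilon>"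
  shows "\<pi> \<in> policies M \<Longrightarrow> \<exists>\<pi>'\<in>policies M_fin. \<forall>l\<in>I. discounted_cost \<beta> M_fin (cell_average (f l)) \<pi>' \<le>
      discounted_cost \<beta> M (f l) \<pi> + 2 * \<delta> * (K l / (1 - \<beta> * K\<^sub>p)) + \<epsilon>" (is "_ \<Longrightarrow> ?to \<pi>")
    and "\<pi>' \<in> policies M_fin \<Longrightarrow> \<exists>\<pi>\<in>policies M. \<forall>l\<in>I. discounted_cost \<beta> M (f l) \<pi> \<le>
      discounted_cost \<beta> M_fin (cell_average (f l)) \<pi>' + 2 * \<delta> * (K l / (1 - \<beta> * K\<^sub>p)) + \<epsilon>" (is "_ \<Longrightarrow> ?from \<pi>'")
proof -
  have fb: "bounded_cost M (B l) (f l)" if "l \<in> I" for l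
    by (rule lipschitz_cost_bounded_cost[OF f f0]) (use that in auto)
  note ab = cell_average_bounds[OF fb]
  let ?e = "\<lambda>l. 2 * \<delta> * (K l / (1 - \<beta> * K\<^sub>p))"
  let ?J = "\<lambda>l. discounted_cost \<beta> M (f l)" and ?J' = "\<lambda>l. discounted_cost \<beta> M_fin (cell_average (f l))"
  have sum: "lipschitz_cost (\<Sum>l\<in>I. w l * K l) (\<lambda>z. \<Sum>l\<in>I. w l * f l z)"
      "\<And>z. z \<in> X \<times> A \<Longrightarrow> 0 \<le> (\<Sum>l\<in>I. w l * f l z) \<and> (\<Sum>l\<in>I. w l * f l z) \<le> (\<Sum>l\<in>I. w l * B l)"
      "\<And>\<pi>. \<pi> \<in> policies M \<Longrightarrow> discounted_cost \<beta> M (\<lambda>z. \<Sum>l\<in>I. w l * f l z) \<pi> = (\<Sum>l\<in>I. w l * ?J l \<pi>)"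
      "\<And>\<pi>. \<pi> \<in> policies M_fin \<Longrightarrow>
        discounted_cost \<beta> M_fin (cell_average (\<lambda>z. \<Sum>l\<in>I. w l * f l z)) \<pi> = (\<Sum>l\<in>I. w l * ?J' l \<pi>)"
      "2 * \<delta> * ((\<Sum>l\<in>I. w l * K l) / (1 - \<beta> * K\<^sub>p)) = (\<Sum>l\<in>I. w l * ?e l)"
    if w: "\<forall>l\<in>I. 0 \<le> w l" for w
  proof -
    show L: "lipschitz_cost (\<Sum>l\<in>I. w l * K l) (\<lambda>z. \<Sum>l\<in>I. w l * f l z)"
      using I f w by (intro lipschitz_cost_weighted_sum) auto
    show b: "0 \<le> (\<Sum>l\<in>I. w l * f l z) \<and> (\<Sum>l\<in>I. w l * f l z) \<le> (\<Sum>l\<in>I. w l * B l)" if "z \<in> X \<times> A" for z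
      using f0[OF _ that] w by (auto intro!: sum_nonneg sum_mono mult_left_mono)
    show "discounted_cost \<beta> M (\<lambda>z. \<Sum>l\<in>I. w l * f l z) \<pi> = (\<Sum>l\<in>I. w l * ?J l \<pi>)" if "\<pi> \<in> policies M" for \<pi>
      by (rule discounted_cost_weighted_sum(2)[OF \<beta> that fb]) (use w in auto)
    show "discounted_cost \<beta> M_fin (cell_average (\<lambda>z. \<Sum>l\<in>I. w l * f l z)) \<pi> = (\<Sum>l\<in>I. w l * ?J' l \<pi>)"
      if \<pi>: "\<pi> \<in> policies M_fin" for \<pi>
    proof -
      have "discounted_cost \<beta> M_fin (cell_average (\<lambda>z. \<Sum>l\<in>I. w l * f l z)) \<pi> =
        discounted_cost \<beta> M_fin (\<lambda>z. \<Sum>l\<in>I. w l * cell_average (f l) z) \<pi>"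
      proof (rule fin.discounted_cost_cong[OF \<beta> \<pi>])
        show "bounded_cost M_fin (\<Sum>l\<in>I. w l * B l) (cell_average (\<lambda>z. \<Sum>l\<in>I. w l * f l z))"
          by (intro cell_average_bounds lipschitz_cost_bounded_cost[OF L b])
        show "bounded_cost M_fin (\<Sum>l\<in>I. w l * B l) (\<lambda>z. \<Sum>l\<in>I. w l * cell_average (f l) z)"
          by (rule fin.discounted_cost_weighted_sum(1)[OF \<beta> \<pi> ab]) (use w in auto)
        show "cell_average (\<lambda>z. \<Sum>l\<in>I. w l * f l z) z = (\<Sum>l\<in>I. w l * cell_average (f l) z)"
          if "z \<in> space (steps M_fin)" for z
          using that cell_average_weighted_sum[OF fb] by (auto simp: space_M_fin)
      qed
      also have "\<dots> = (\<Sum>l\<in>I. w l * ?J' l \<pi>)"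
        by (rule fin.discounted_cost_weighted_sum(2)[OF \<beta> \<pi> ab]) (use w in auto)
      finally show ?thesis .
    qed
    show "2 * \<delta> * ((\<Sum>l\<in>I. w l * K l) / (1 - \<beta> * K\<^sub>p)) = (\<Sum>l\<in>I. w l * ?e l)"
      by (simp add: sum_distrib_left sum_divide_distrib mult_ac)
  qed
  show "?to \<pi>" if \<pi>: "\<pi> \<in> policies M"
  proof -
    have "\<exists>\<pi>'\<in>policies M_fin. \<forall>l\<in>I. ?J' l \<pi>' - (?J l \<pi> + ?e l) \<le> \<epsilon>"
    proof (rule convexlike_minimax[OF I fin.convexlike_costs[OF \<beta> ab]])
      fix w :: "_ \<Rightarrow> real" and \<rho> :: real assume w: "\<forall>l\<in>I. 0 \<le> w l" and "0 < \<rho>"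
      from transfer_to_grid[OF sum(1,2)[OF w] \<pi> \<open>0 < \<rho>\<close>, unfolded sum(3)[OF w \<pi>] sum(5)[OF w]]
      obtain \<pi>' where \<pi>': "\<pi>' \<in> policies M_fin"
        "(\<Sum>l\<in>I. w l * ?J' l \<pi>') \<le> (\<Sum>l\<in>I. w l * ?J l \<pi>) + (\<Sum>l\<in>I. w l * ?e l) + \<rho>"
        by (auto simp: sum(4)[OF w])
      then show "\<exists>\<pi>'\<in>policies M_fin. (\<Sum>l\<in>I. w l * (?J' l \<pi>' - (?J l \<pi> + ?e l))) \<le> \<rho>"
        by (intro bexI[of _ \<pi>']) (simp_all add: algebra_simps sum.distrib sum_subtractf)
    qed (use \<epsilon> in auto)
    then show ?thesis by (auto simp: algebra_simps)
  qed
  show "?from \<pi>'" if \<pi>': "\<pi>' \<in> policies M_fin"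
  proof -
    have "\<exists>\<pi>\<in>policies M. \<forall>l\<in>I. ?J l \<pi> - (?J' l \<pi>' + ?e l) \<le> \<epsilon>"
    proof (rule convexlike_minimax[OF I convexlike_costs[OF \<beta> fb]])
      fix w :: "_ \<Rightarrow> real" and \<rho> :: real assume w: "\<forall>l\<in>I. 0 \<le> w l" and "0 < \<rho>"
      from transfer_from_grid[OF sum(1,2)[OF w] \<pi>' \<open>0 < \<rho>\<close>, unfolded sum(4)[OF w \<pi>'] sum(5)[OF w]]
      obtain \<pi> where \<pi>: "\<pi> \<in> policies M"
        "(\<Sum>l\<in>I. w l * ?J l \<pi>) \<le> (\<Sum>l\<in>I. w l * ?J' l \<pi>') + (\<Sum>l\<in>I. w l * ?e l) + \<rho>"
        by (auto simp: sum(3)[OF w])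
      then show "\<exists>\<pi>\<in>policies M. (\<Sum>l\<in>I. w l * (?J l \<pi> - (?J' l \<pi>' + ?e l))) \<le> \<rho>"
        by (intro bexI[of _ \<pi>]) (simp_all add: algebra_simps sum.distrib sum_subtractf)
    qed (use \<epsilon> in auto)
    then show ?thesis by (auto simp: algebra_simps)
  qed
qed

end

section \<open>Optimal values under constraints\<close>

text \<open>
  A quantized model together with its constraints. \<open>B\<close> bounds the cost,
  \<open>K\<^sub>m\<close> the Lipschitz constants of the constraint costs, and \<open>m\<close>
  is the slack of the policy \<open>\<pi>\<^sub>0\<close> in all constraints. The bounds \<open>Bd
  l\<close> make the constraint costs integrable.
\<close>

locale constrained_quantized_cmdp = quantized_cmdp M X A \<beta> K\<^sub>p G Q \<nu> \<delta>
  for M :: "('x::euclidean_space, 'b::{metric_space, second_countable_topology}) cmdp"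
    and X A \<beta> K\<^sub>p G Q \<nu> \<delta> +
  fixes q :: nat and k K\<^sub>l Bd :: "nat \<Rightarrow> real" and K\<^sub>c K\<^sub>m B m :: real
    and \<pi>\<^sub>0 :: "('x, 'b) policy"
  assumes cost_lipschitz: "lipschitz_cost K\<^sub>c (cost M)"
    and cost_bounds: "\<And>z. z \<in> X \<times> A \<Longrightarrow> 0 \<le> cost M z \<and> cost M z \<le> B"
    and ccost_lipschitz: "\<And>l. l \<in> {1..q} \<Longrightarrow> lipschitz_cost (K\<^sub>l l) (ccost M l)"
    and ccost_bounds: "\<And>l z. l \<in> {1..q} \<Longrightarrow> z \<in> X \<times> A \<Longrightarrow> 0 \<le> ccost M l z \<and> ccost M l z \<le> Bd l"
    and K\<^sub>m: "\<And>l. l \<in> {1..q} \<Longrightarrow> K\<^sub>l l \<le> K\<^sub>m" "0 \<le> K\<^sub>m"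
    and m_pos: "0 < m" and \<delta>_nonneg: "0 \<le> \<delta>"
    and slater_policy: "\<pi>\<^sub>0 \<in> policies M"
    and slater: "\<And>l. l \<in> {1..q} \<Longrightarrow> discounted_cost \<beta> M (ccost M l) \<pi>\<^sub>0 + m \<le> k l"
begin

abbreviation "J \<equiv> discounted_cost \<beta> M (cost M)"
abbreviation "J\<^sub>c \<equiv> \<lambda>l. discounted_cost \<beta> M (ccost M l)"
abbreviation "J' \<equiv> discounted_cost \<beta> M_fin (cost M_fin)"
abbreviation "J'\<^sub>c \<equiv> \<lambda>l. discounted_cost \<beta> M_fin (ccost M_fin l)"

definition cost_error :: real where "cost_error = 2 * \<delta> * (K\<^sub>c / (1 - \<beta> * K\<^sub>p))"
definition constraint_error :: real where "constraint_error = 2 * \<delta> * (K\<^sub>m / (1 - \<beta> * K\<^sub>p))"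

lemma denominator_pos: "0 < 1 - \<beta> * K\<^sub>p"
  using contraction by (simp add: mult.commute)

lemma K\<^sub>c_nonneg: "0 \<le> K\<^sub>c"
  using cost_lipschitz A_nonempty by (auto simp: lipschitz_cost_def dest: lipschitz_on_nonneg)

lemma errors_nonneg: "0 \<le> cost_error" "0 \<le> constraint_error"
  using denominator_pos K\<^sub>m(2) \<delta>_nonneg K\<^sub>c_nonneg by (simp_all add: cost_error_def constraint_error_def)

lemma constraint_error_bound: "l \<in> {1..q} \<Longrightarrow> 2 * \<delta> * (K\<^sub>l l / (1 - \<beta> * K\<^sub>p)) \<le> constraint_error"
  unfolding constraint_error_def using denominator_pos \<delta>_nonneg K\<^sub>m(1)
  by (intro mult_left_mono divide_right_mono) auto

lemma bounded_cost_cost: "bounded_cost M B (cost M)"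
  by (rule lipschitz_cost_bounded_cost[OF cost_lipschitz cost_bounds])

lemma bounded_cost_ccost: "l \<in> {1..q} \<Longrightarrow> bounded_cost M (Bd l) (ccost M l)"
  by (rule lipschitz_cost_bounded_cost[OF ccost_lipschitz ccost_bounds])

lemma J_bounds: "\<pi> \<in> policies M \<Longrightarrow> 0 \<le> J \<pi> \<and> J \<pi> \<le> B"
  using discounted_cost_bounds[OF \<beta> _ bounded_cost_cost] by auto

lemma J'_bounds: "\<pi> \<in> policies M_fin \<Longrightarrow> 0 \<le> J' \<pi> \<and> J' \<pi> \<le> B"
  using fin.discounted_cost_bounds[OF \<beta> _ cell_average_bounds[OF bounded_cost_cost]] by (auto simp: M_fin_sel)

lemma B_nonneg: "0 \<le> B"
  using J_bounds[OF slater_policy] by linarith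

lemma transfer_all_costs:
  assumes \<epsilon>: "0 < \<epsilon>"
  shows "\<pi> \<in> policies M \<Longrightarrow> \<exists>\<pi>'\<in>policies M_fin. J' \<pi>' \<le> J \<pi> + cost_error + \<epsilon> \<and>
      (\<forall>l\<in>{1..q}. J'\<^sub>c l \<pi>' \<le> J\<^sub>c l \<pi> + constraint_error + \<epsilon>)"
    and "\<pi>' \<in> policies M_fin \<Longrightarrow> \<exists>\<pi>\<in>policies M. J \<pi> \<le> J' \<pi>' + cost_error + \<epsilon> \<and>
      (\<forall>l\<in>{1..q}. J\<^sub>c l \<pi> \<le> J'\<^sub>c l \<pi>' + constraint_error + \<epsilon>)"
proof -
  \<comment> \<open>The cost takes the free index \<open>0\<close> in front of the constraint costs \<open>1, ..., q\<close>.\<close>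
  define f where "f l = (if l = 0 then cost M else ccost M l)" for l
  define L where "L l = (if l = 0 then K\<^sub>c else K\<^sub>l l)" for l
  define C where "C l = (if l = 0 then B else Bd l)" for l
  have f: "lipschitz_cost (L l) (f l)" if "l \<in> {0..q}" for l
    using that cost_lipschitz ccost_lipschitz[of l] by (auto simp: f_def L_def)
  have f0: "0 \<le> f l z \<and> f l z \<le> C l" if "l \<in> {0..q}" "z \<in> X \<times> A" for l z
    using that cost_bounds[of z] ccost_bounds[of l z] by (auto simp: f_def C_def)
  have ne: "{0..q} \<noteq> {}" by simp
  have split: "P 0" "\<And>l. l \<in> {1..q} \<Longrightarrow> P l" if "\<forall>l\<in>{0..q}. P l" for P using that by auto
  show "\<exists>\<pi>'\<in>policies M_fin. J' \<pi>' \<le> J \<pi> + cost_error + \<epsilon> \<and>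
      (\<forall>l\<in>{1..q}. J'\<^sub>c l \<pi>' \<le> J\<^sub>c l \<pi> + constraint_error + \<epsilon>)" if "\<pi> \<in> policies M"
  proof -
    have "\<exists>\<pi>'\<in>policies M_fin. \<forall>l\<in>{0..q}. discounted_cost \<beta> M_fin (cell_average (f l)) \<pi>' \<le>
        discounted_cost \<beta> M (f l) \<pi> + 2 * \<delta> * (L l / (1 - \<beta> * K\<^sub>p)) + \<epsilon>"
      by (rule simultaneous_transfer(1)[OF finite_atLeastAtMost ne f f0 \<epsilon> that]) assumption+
    then obtain \<pi>' where \<pi>': "\<pi>' \<in> policies M_fin"
      and *: "\<forall>l\<in>{0..q}. discounted_cost \<beta> M_fin (cell_average (f l)) \<pi>' \<le>
        discounted_cost \<beta> M (f l) \<pi> + 2 * \<delta> * (L l / (1 - \<beta> * K\<^sub>p)) + \<epsilon>" by auto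
    have "J' \<pi>' \<le> J \<pi> + cost_error + \<epsilon>"
      using split(1)[OF *] by (simp add: f_def L_def cost_error_def M_fin_sel)
    moreover have "J'\<^sub>c l \<pi>' \<le> J\<^sub>c l \<pi> + constraint_error + \<epsilon>" if "l \<in> {1..q}" for l
      using split(2)[OF * that] constraint_error_bound[OF that] that by (simp add: f_def L_def M_fin_sel)
    ultimately show ?thesis using \<pi>' by blast
  qed
  show "\<exists>\<pi>\<in>policies M. J \<pi> \<le> J' \<pi>' + cost_error + \<epsilon> \<and>
      (\<forall>l\<in>{1..q}. J\<^sub>c l \<pi> \<le> J'\<^sub>c l \<pi>' + constraint_error + \<epsilon>)" if "\<pi>' \<in> policies M_fin"
  proof -
    have "\<exists>\<pi>\<in>policies M. \<forall>l\<in>{0..q}. discounted_cost \<beta> M (f l) \<pi> \<le>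
        discounted_cost \<beta> M_fin (cell_average (f l)) \<pi>' + 2 * \<delta> * (L l / (1 - \<beta> * K\<^sub>p)) + \<epsilon>"
      by (rule simultaneous_transfer(2)[OF finite_atLeastAtMost ne f f0 \<epsilon> that]) assumption+
    then obtain \<pi> where \<pi>: "\<pi> \<in> policies M"
      and *: "\<forall>l\<in>{0..q}. discounted_cost \<beta> M (f l) \<pi> \<le>
        discounted_cost \<beta> M_fin (cell_average (f l)) \<pi>' + 2 * \<delta> * (L l / (1 - \<beta> * K\<^sub>p)) + \<epsilon>" by auto
    have "J \<pi> \<le> J' \<pi>' + cost_error + \<epsilon>"
      using split(1)[OF *] by (simp add: f_def L_def cost_error_def M_fin_sel)
    moreover have "J\<^sub>c l \<pi> \<le> J'\<^sub>c l \<pi>' + constraint_error + \<epsilon>" if "l \<in> {1..q}" for l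
      using split(2)[OF * that] constraint_error_bound[OF that] that by (simp add: f_def L_def M_fin_sel)
    ultimately show ?thesis using \<pi> by blast
  qed
qed

text \<open>
  Weight \<open>\<theta>\<close> on \<open>\<pi>\<^sub>0\<close> gains \<open>\<theta> * m\<close>
  in every constraint and costs at most \<open>\<theta> * B\<close>.
\<close>

lemma mix_with_slater_policy:
  assumes \<pi>: "\<pi> \<in> policies M" and \<theta>: "0 \<le> \<theta>" "\<theta> \<le> 1"
    and e: "0 \<le> e" "\<And>l. l \<in> {1..q} \<Longrightarrow> J\<^sub>c l \<pi> \<le> k l + e"
  obtains \<sigma> where "\<sigma> \<in> policies M" "J \<sigma> \<le> J \<pi> + \<theta> * B"
    "\<And>l. l \<in> {1..q} \<Longrightarrow> J\<^sub>c l \<sigma> \<le> k l + e - \<theta> * m"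
proof -
  obtain \<sigma> where \<sigma>: "\<sigma> \<in> policies M" "\<And>B f. bounded_cost M B f \<Longrightarrow>
      discounted_cost \<beta> M f \<sigma> = \<theta> * discounted_cost \<beta> M f \<pi>\<^sub>0 + (1 - \<theta>) * discounted_cost \<beta> M f \<pi>"
    using discounted_cost_mixture[OF \<beta> slater_policy \<pi> \<theta>] by blast
  show thesis
  proof
    have "\<theta> * J \<pi>\<^sub>0 \<le> \<theta> * B" "(1 - \<theta>) * J \<pi> \<le> 1 * J \<pi>"
      using J_bounds[OF slater_policy] J_bounds[OF \<pi>] \<theta> by (intro mult_left_mono mult_right_mono; simp)+
    then show "J \<sigma> \<le> J \<pi> + \<theta> * B" using \<sigma>(2)[OF bounded_cost_cost] by simp
    fix l assume l: "l \<in> {1..q}"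
    have "\<theta> * J\<^sub>c l \<pi>\<^sub>0 \<le> \<theta> * (k l - m)" "(1 - \<theta>) * J\<^sub>c l \<pi> \<le> (1 - \<theta>) * (k l + e)"
      using slater[OF l] e(2)[OF l] \<theta> by (intro mult_left_mono; simp)+
    moreover have "0 \<le> \<theta> * e" using \<theta> e by simp
    ultimately show "J\<^sub>c l \<sigma> \<le> k l + e - \<theta> * m"
      using \<sigma>(2)[OF bounded_cost_ccost[OF l]] by (simp add: algebra_simps)
  qed (rule \<sigma>(1))
qed

lemma grid_feasible:
  assumes "constraint_error < m"
  shows "feasible_policies \<beta> M_fin q k \<noteq> {}"
proof -
  from transfer_all_costs(1)[of "m - constraint_error", OF _ slater_policy] assms
  obtain \<pi>' where "\<pi>' \<in> policies M_fin" "\<forall>l\<in>{1..q}. J'\<^sub>c l \<pi>' \<le> J\<^sub>c l \<pi>\<^sub>0 + m" by auto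
  then have "\<pi>' \<in> feasible_policies \<beta> M_fin q k"
    using slater by (force simp: feasible_policies_def)
  then show ?thesis by auto
qed

lemma bdd_below_costs:
  "bdd_below (J ` feasible_policies \<beta> M q k)" "bdd_below (J' ` feasible_policies \<beta> M_fin q k)"
  using J_bounds J'_bounds by (auto simp: feasible_policies_def intro!: bdd_belowI[of _ 0])

lemma le_plus_small_multiple:
  fixes x y :: real
  assumes "0 < r" "\<And>\<epsilon>. 0 < \<epsilon> \<Longrightarrow> \<epsilon> < r \<Longrightarrow> x \<le> y + \<epsilon> * c"
  shows "x \<le> y"
proof (rule tendsto_lowerbound)
  show "((\<lambda>\<epsilon>. y + \<epsilon> * c) \<longlongrightarrow> y) (at_right 0)"
    by (rule tendsto_eq_intros refl | simp)+
  show "\<forall>\<^sub>F \<epsilon> in at_right 0. x \<le> y + \<epsilon> * c"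
    using assms by (auto simp: eventually_at_right_field)
qed simp

text \<open>
  Upper bound for the finite model: mix a feasible policy with \<open>\<pi>\<^sub>0\<close> first
  and transfer the mixture, whose slack absorbs the transfer error. Lower bound: transfer a
  feasible policy of the finite model first, then repair its constraints by mixing with
  \<open>\<pi>\<^sub>0\<close>. In both directions the weight is \<open>(constraint_error +
  \<epsilon>) / m\<close>, and \<open>\<epsilon>\<close> tends to \<open>0\<close> at the end.
\<close>

lemma optimal_value_error:
  assumes ne: "feasible_policies \<beta> M_fin q k \<noteq> {}"
  shows "\<bar>optimal_value \<beta> M_fin q k - optimal_value \<beta> M q k\<bar> \<le> cost_error + B * constraint_error / m"
proof (cases "constraint_error < m")
  case False
  have range: "0 \<le> v \<and> v \<le> B" if ne: "S \<noteq> {}" and v: "v = Inf (h ` S)" and h: "\<And>\<pi>. \<pi> \<in> S \<Longrightarrow> 0 \<le> h \<pi> \<and> h \<pi> \<le> B"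
    for S v and h :: "_ \<Rightarrow> real"
  proof -
    obtain \<pi> where \<pi>: "\<pi> \<in> S" using ne by auto
    have "v \<le> h \<pi>" unfolding v by (rule cINF_lower[OF _ \<pi>]) (use h in \<open>auto intro!: bdd_belowI[of _ 0]\<close>)
    moreover have "0 \<le> v" unfolding v by (rule cINF_greatest[OF ne]) (use h in auto)
    ultimately show ?thesis using h[OF \<pi>] by auto
  qed
  have "\<pi>\<^sub>0 \<in> feasible_policies \<beta> M q k"
    using slater_policy slater m_pos by (force simp: feasible_policies_def)
  then have "0 \<le> optimal_value \<beta> M q k \<and> optimal_value \<beta> M q k \<le> B"
    using J_bounds by (intro range[OF _ optimal_value_def]) (auto simp: feasible_policies_def)
  moreover have "0 \<le> optimal_value \<beta> M_fin q k \<and> optimal_value \<beta> M_fin q k \<le> B"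
    using J'_bounds by (intro range[OF ne optimal_value_def]) (auto simp: feasible_policies_def)
  \<comment> \<open>Both values lie in \<open>[0, B]\<close>, and here the claimed bound is at least \<open>B\<close>.\<close>
  moreover have "B * m \<le> B * constraint_error"
    using False B_nonneg by (intro mult_left_mono) auto
  then have "B \<le> B * constraint_error / m" using m_pos by (simp add: pos_le_divide_eq)
  ultimately show ?thesis using errors_nonneg(1) by (simp add: abs_le_iff)
next
  case True
  let ?E = "cost_error + B * constraint_error / m"
  \<comment> \<open>For \<open>\<epsilon> < r\<close> the mixing weight \<open>(constraint_error + \<epsilon>) / m\<close> is below \<open>1\<close>.\<close>
  define r where "r = m - constraint_error"
  have r: "0 < r" using True by (simp add: r_def)
  have \<theta>: "0 \<le> (constraint_error + \<epsilon>) / m" "(constraint_error + \<epsilon>) / m \<le> 1"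
    "(constraint_error + \<epsilon>) / m * m = constraint_error + \<epsilon>"
    if "0 < \<epsilon>" "\<epsilon> < r" for \<epsilon>
    using that errors_nonneg(2) m_pos by (simp_all add: r_def)
  have "optimal_value \<beta> M_fin q k \<le> optimal_value \<beta> M q k + ?E"
  proof -
    have "optimal_value \<beta> M_fin q k - ?E \<le> J \<pi>" if "\<pi> \<in> feasible_policies \<beta> M q k" for \<pi>
    proof (rule le_plus_small_multiple[OF r])
      fix \<epsilon> assume \<epsilon>: "0 < \<epsilon>" "\<epsilon> < r"
      have \<pi>: "\<pi> \<in> policies M" "\<And>l. l \<in> {1..q} \<Longrightarrow> J\<^sub>c l \<pi> \<le> k l + 0"
        using that by (auto simp: feasible_policies_def)
      from mix_with_slater_policy[OF \<pi>(1) \<theta>(1,2)[OF \<epsilon>] order_refl \<pi>(2)] obtain \<sigma> where \<sigma>: "\<sigma> \<in> policies M"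
        "J \<sigma> \<le> J \<pi> + (constraint_error + \<epsilon>) / m * B"
        "\<And>l. l \<in> {1..q} \<Longrightarrow> J\<^sub>c l \<sigma> \<le> k l + 0 - (constraint_error + \<epsilon>) / m * m"
        by blast
      from transfer_all_costs(1)[OF \<epsilon>(1) \<sigma>(1)] obtain \<pi>' where \<pi>': "\<pi>' \<in> policies M_fin"
        "J' \<pi>' \<le> J \<sigma> + cost_error + \<epsilon>" "\<forall>l\<in>{1..q}. J'\<^sub>c l \<pi>' \<le> J\<^sub>c l \<sigma> + constraint_error + \<epsilon>" by blast
      then have "\<pi>' \<in> feasible_policies \<beta> M_fin q k"
        using \<sigma>(3) unfolding \<theta>(3)[OF \<epsilon>] by (force simp: feasible_policies_def)
      then have "optimal_value \<beta> M_fin q k \<le> J' \<pi>'"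
        unfolding optimal_value_def by (rule cINF_lower[OF bdd_below_costs(2)])
      with \<pi>'(2) \<sigma>(2) show "optimal_value \<beta> M_fin q k - ?E \<le> J \<pi> + \<epsilon> * (1 + B / m)"
        by (simp add: algebra_simps add_divide_distrib)
    qed
    then have "optimal_value \<beta> M_fin q k - ?E \<le> optimal_value \<beta> M q k"
      unfolding optimal_value_def[of \<beta> M]
      using slater_policy slater m_pos by (intro cINF_greatest) (force simp: feasible_policies_def)+
    then show ?thesis by simp
  qed
  moreover have "optimal_value \<beta> M q k \<le> optimal_value \<beta> M_fin q k + ?E"
  proof -
    have "optimal_value \<beta> M q k - ?E \<le> J' \<pi>'" if "\<pi>' \<in> feasible_policies \<beta> M_fin q k" for \<pi>'
    proof (rule le_plus_small_multiple[OF r])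
      fix \<epsilon> assume \<epsilon>: "0 < \<epsilon>" "\<epsilon> < r"
      have \<pi>': "\<pi>' \<in> policies M_fin" "\<And>l. l \<in> {1..q} \<Longrightarrow> J'\<^sub>c l \<pi>' \<le> k l"
        using that by (auto simp: feasible_policies_def)
      from transfer_all_costs(2)[OF \<epsilon>(1) \<pi>'(1)] obtain \<pi> where \<pi>: "\<pi> \<in> policies M"
        "J \<pi> \<le> J' \<pi>' + cost_error + \<epsilon>" "\<And>l. l \<in> {1..q} \<Longrightarrow> J\<^sub>c l \<pi> \<le> J'\<^sub>c l \<pi>' + constraint_error + \<epsilon>" by blast
      have "0 \<le> constraint_error + \<epsilon>" using errors_nonneg(2) \<epsilon>(1) by simp
      moreover have "J\<^sub>c l \<pi> \<le> k l + (constraint_error + \<epsilon>)" if "l \<in> {1..q}" for l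
        using \<pi>(3)[OF that] \<pi>'(2)[OF that] by simp
      ultimately obtain \<sigma> where \<sigma>: "\<sigma> \<in> policies M"
        "J \<sigma> \<le> J \<pi> + (constraint_error + \<epsilon>) / m * B"
        "\<And>l. l \<in> {1..q} \<Longrightarrow> J\<^sub>c l \<sigma> \<le> k l + (constraint_error + \<epsilon>) - (constraint_error + \<epsilon>) / m * m"
        using mix_with_slater_policy[OF \<pi>(1) \<theta>(1,2)[OF \<epsilon>], of "constraint_error + \<epsilon>"] by blast
      then have "\<sigma> \<in> feasible_policies \<beta> M q k"
        unfolding \<theta>(3)[OF \<epsilon>] by (simp add: feasible_policies_def)
      then have "optimal_value \<beta> M q k \<le> J \<sigma>"
        unfolding optimal_value_def by (rule cINF_lower[OF bdd_below_costs(1)])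
      with \<pi>(2) \<sigma>(2) show "optimal_value \<beta> M q k - ?E \<le> J' \<pi>' + \<epsilon> * (1 + B / m)"
        by (simp add: algebra_simps add_divide_distrib)
    qed
    then have "optimal_value \<beta> M q k - ?E \<le> optimal_value \<beta> M_fin q k"
      unfolding optimal_value_def[of \<beta> M_fin] using ne by (intro cINF_greatest)
    then show ?thesis by simp
  qed
  ultimately show ?thesis by (simp add: abs_le_iff)
qed

end

theorem theorem7:
  fixes X :: "'x::euclidean_space set"
    and A :: "'b::{metric_space, second_countable_topology} set"
    and p :: "'x \<times> 'b \<Rightarrow> 'x measure"
    and c :: "'x \<times> 'b \<Rightarrow> real"
    and d :: "nat \<Rightarrow> 'x \<times> 'b \<Rightarrow> real"
    and \<gamma> :: "'x measure"
    and q :: nat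
    and k \<alpha>' K\<^sub>l :: "nat \<Rightarrow> real"
    and \<alpha> \<beta> K\<^sub>c K\<^sub>p :: real
    and G :: "nat \<Rightarrow> 'x set"
    and Q :: "nat \<Rightarrow> 'x \<Rightarrow> 'x"
    and \<nu> :: "nat \<Rightarrow> 'x measure"
    and SX :: "'x measure" and SA :: "'b measure"
    and MDP :: "('x, 'b) cmdp" and MDP\<^sub>n :: "nat \<Rightarrow> ('x, 'b) cmdp"
  defines "SX \<equiv> restrict_space borel X"
    and "SA \<equiv> restrict_space borel A"
    and "MDP \<equiv> \<lparr> states = SX, actions = SA, init = \<gamma>, trans = p, cost = c, ccost = d \<rparr>"
    and "MDP\<^sub>n \<equiv> (\<lambda>n. finite_model MDP (G n) (Q n) (\<nu> n))"
  assumes "compact X" and "compact A"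
    and "p \<in> SX \<Otimes>\<^sub>M SA \<rightarrow>\<^sub>M prob_algebra SX"
    and "continuous_on (X \<times> A) c" and "\<forall>z\<in>X \<times> A. 0 \<le> c z"
    and "1 \<le> q"
    and "\<forall>l\<in>{1..q}. continuous_on (X \<times> A) (d l) \<and> (\<forall>z\<in>X \<times> A. 0 \<le> d l z)"
    and "\<gamma> \<in> space (prob_algebra SX)"
    and "\<forall>l\<in>{1..q}. 0 \<le> k l"
    and "0 < \<beta>" and "\<beta> < 1"
    and "\<forall>l\<in>{1..q}. 0 < \<alpha>' l"
    and "\<exists>\<pi>\<in>policies MDP. \<forall>l\<in>{1..q}. discounted_cost \<beta> MDP (d l) \<pi> + \<alpha>' l = k l"
    and "0 < \<alpha>"
    and "\<forall>n\<ge>1. G n \<subseteq> X \<and> card (G n) = n"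
    and "\<forall>n\<ge>1. \<forall>x\<in>X. (MIN y\<in>G n. dist x y) \<le> \<alpha> * (1 / real n) powr (1 / DIM('x))"
    and "\<forall>n\<ge>1. nearest_point_map SX (G n) (Q n)"
    and "\<forall>n\<ge>1. sets (\<nu> n) = sets SX \<and>
           (\<forall>y\<in>G n. 0 < emeasure (\<nu> n) (cell SX (Q n) y) \<and> emeasure (\<nu> n) (cell SX (Q n) y) < \<infinity>)"
    and "weakly_continuous_kernel X (X \<times> A) p"
    and "\<forall>a\<in>A. K\<^sub>c-lipschitz_on X (\<lambda>x. c (x, a))"
    and "\<forall>l\<in>{1..q}. \<forall>a\<in>A. (K\<^sub>l l)-lipschitz_on X (\<lambda>x. d l (x, a))"
    and "K\<^sub>p * \<beta> < 1"
    and "\<forall>x\<in>X. \<forall>y\<in>X. \<forall>a\<in>A. wasserstein1 SX (p (x, a)) (p (y, a)) \<le> K\<^sub>p * dist x y"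
  shows
    "let K = 2 * (SUP z\<in>X \<times> A. \<bar>c z\<bar>) / (MIN l\<in>{1..q}. \<alpha>' l);
         Y\<^sub>v = 4 * \<alpha> * (K\<^sub>c + real q * K * (MAX l\<in>{1..q}. K\<^sub>l l)) / (1 - \<beta> * K\<^sub>p)
     in (\<forall>n\<ge>1. feasible_policies \<beta> (MDP\<^sub>n n) q k \<noteq> {} \<longrightarrow>
           \<bar>optimal_value \<beta> (MDP\<^sub>n n) q k - optimal_value \<beta> MDP q k\<bar>
             \<le> Y\<^sub>v * (1 / real n) powr (1 / DIM('x))) \<and>
        (\<forall>\<^sub>F n in sequentially. feasible_policies \<beta> (MDP\<^sub>n n) q k \<noteq> {})"
proof -
  note X = assms(5) and A = assms(6) and p = assms(7) and c = assms(8,9) and q = assms(10) and d = assms(11)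
    and \<gamma> = assms(12) and \<beta> = assms(14,15) and \<alpha>' = assms(16) and \<alpha> = assms(18) and G = assms(19)
    and mesh = assms(20) and nearest = assms(21) and \<nu> = assms(22) and weak = assms(23)
    and c_lip = assms(24) and d_lip = assms(25) and contr = assms(26) and W1 = assms(27)
  obtain \<pi>\<^sub>0 where \<pi>\<^sub>0: "\<pi>\<^sub>0 \<in> policies MDP"
    and slater: "\<And>l. l \<in> {1..q} \<Longrightarrow> discounted_cost \<beta> MDP (d l) \<pi>\<^sub>0 + \<alpha>' l = k l"
    using assms(17) by blast
  \<comment> \<open>A policy assigns a probability measure on \<open>A\<close> to some history, and there are none on the empty set.\<close>
  have A_ne: "A \<noteq> {}"
  proof
    assume A: "A = {}"
    have "space \<gamma> \<noteq> {}" "space \<gamma> = space SX"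
      using \<gamma> prob_space.not_empty[of \<gamma>] sets_eq_imp_space_eq[of \<gamma> SX] by (auto simp: space_prob_algebra)
    then obtain x where x: "x \<in> space SX" by auto
    have "(\<lambda>_. undefined, x) \<in> space (histories MDP 0)"
      using x by (simp add: histories_def MDP_def space_pair_measure space_PiM)
    moreover have "\<pi>\<^sub>0 0 \<in> histories MDP 0 \<rightarrow>\<^sub>M prob_algebra SA"
      using \<pi>\<^sub>0 by (simp add: policies_def MDP_def)
    ultimately have "\<pi>\<^sub>0 0 (\<lambda>_. undefined, x) \<in> space (prob_algebra SA)" by (rule measurable_space[rotated])
    then have "prob_space (\<pi>\<^sub>0 0 (\<lambda>_. undefined, x))" "space (\<pi>\<^sub>0 0 (\<lambda>_. undefined, x)) = space SA"
      using sets_eq_imp_space_eq by (auto simp: space_prob_algebra)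
    then show False
      using A prob_space.not_empty by (auto simp: SA_def space_restrict_space)
  qed
  have X_ne: "X \<noteq> {}" using G[rule_format, of 1] by fastforce
  define m where "m = (MIN l\<in>{1..q}. \<alpha>' l)"
  define K\<^sub>m where "K\<^sub>m = (MAX l\<in>{1..q}. K\<^sub>l l)"
  define C where "C = (SUP z\<in>X \<times> A. \<bar>c z\<bar>)"
  define \<delta> where "\<delta> n = \<alpha> * (1 / real n) powr (1 / DIM('x))" for n
  have m: "m \<le> \<alpha>' l" if "l \<in> {1..q}" for l
    unfolding m_def using that by (intro Min_le) auto
  have m_pos: "0 < m" unfolding m_def using q \<alpha>' by (subst Min_gr_iff) auto
  have Km: "K\<^sub>l l \<le> K\<^sub>m" if "l \<in> {1..q}" for l
    unfolding K\<^sub>m_def using that by (intro Max_ge) auto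
  obtain a\<^sub>0 where a\<^sub>0: "a\<^sub>0 \<in> A" using A_ne by blast
  have "(K\<^sub>l 1)-lipschitz_on X (\<lambda>x. d 1 (x, a\<^sub>0))" using d_lip q a\<^sub>0 by simp
  then have "0 \<le> K\<^sub>l 1" by (rule lipschitz_on_nonneg)
  then have Km0: "0 \<le> K\<^sub>m" using Km[of 1] q by simp
  have Kc0: "0 \<le> K\<^sub>c" using c_lip a\<^sub>0 by (auto dest: lipschitz_on_nonneg)
  have \<delta>0: "0 \<le> \<delta> n" for n using \<alpha> by (simp add: \<delta>_def)
  have bounded: "bounded (f ` (X \<times> A))" if "continuous_on (X \<times> A) f" for f :: "'x \<times> 'b \<Rightarrow> real"
    using that X A by (intro compact_imp_bounded compact_continuous_image compact_Times)
  have c_bound: "0 \<le> c z \<and> c z \<le> C" if z: "z \<in> X \<times> A" for z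
  proof -
    obtain b where "\<forall>y\<in>c ` (X \<times> A). norm y \<le> b" using bounded[OF c(1)] unfolding bounded_iff by blast
    then have "bdd_above ((\<lambda>z. \<bar>c z\<bar>) ` (X \<times> A))" by (intro bdd_aboveI[of _ b]) auto
    then have "\<bar>c z\<bar> \<le> C" unfolding C_def by (rule cSUP_upper[OF z])
    moreover have "0 \<le> c z" using c(2) z by blast
    ultimately show ?thesis by linarith
  qed
  have "\<exists>b. \<forall>z\<in>X \<times> A. d l z \<le> b" if "l \<in> {1..q}" for l
  proof -
    have "continuous_on (X \<times> A) (d l)" using d that by blast
    from bounded[OF this] obtain b where "\<forall>y\<in>d l ` (X \<times> A). norm y \<le> b"
      unfolding bounded_iff by blast
    then show ?thesis by (intro exI[of _ b]) (auto simp: abs_le_iff)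
  qed
  then obtain Bd where Bd: "\<And>l z. l \<in> {1..q} \<Longrightarrow> z \<in> X \<times> A \<Longrightarrow> d l z \<le> Bd l" by metis
  have sel: "states MDP = SX" "actions MDP = SA" "init MDP = \<gamma>" "trans MDP = p" "cost MDP = c" "ccost MDP = d"
    by (simp_all add: MDP_def)
  have "cmdp_kernels MDP" using \<gamma> p by unfold_locales (simp_all add: sel)
  then interpret lipschitz_cmdp MDP X A \<beta> K\<^sub>p
    using X A A_ne \<beta> contr weak W1
    by (intro lipschitz_cmdp.intro lipschitz_cmdp_axioms.intro) (auto simp: sel SX_def SA_def)
  have model: "constrained_quantized_cmdp MDP X A \<beta> K\<^sub>p (G n) (Q n) (\<nu> n) (\<delta> n) q k K\<^sub>l Bd K\<^sub>c K\<^sub>m C m \<pi>\<^sub>0"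
    if n: "1 \<le> n" for n
  proof -
    have Gn: "G n \<subseteq> X" "finite (G n)" "G n \<noteq> {}"
      using G[rule_format, OF n] n by (auto intro: card_ge_0_finite)
    have near: "dist x (Q n x) \<le> \<delta> n" if x: "x \<in> X" for x
    proof -
      have "dist x (Q n x) \<le> dist x y" if "y \<in> G n" for y
        using nearest[rule_format, OF n] x that by (auto simp: nearest_point_map_def SX_def space_restrict_space)
      then have "dist x (Q n x) \<le> (MIN y\<in>G n. dist x y)" using Gn by (subst Min_ge_iff) auto
      also have "\<dots> \<le> \<delta> n" using mesh[rule_format, OF n x] by (simp add: \<delta>_def)
      finally show ?thesis .
    qed
    have "quantized_cmdp MDP X A \<beta> K\<^sub>p (G n) (Q n) (\<nu> n) (\<delta> n)"
      using Gn nearest[rule_format, OF n] near \<nu>[rule_format, OF n]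
      by (intro quantized_cmdp.intro quantized_cmdp_axioms.intro lipschitz_cmdp_axioms) (simp_all add: sel)
    moreover have "discounted_cost \<beta> MDP (ccost MDP l) \<pi>\<^sub>0 + m \<le> k l" if "l \<in> {1..q}" for l
      using slater[OF that] m[OF that] by (simp add: sel)
    ultimately show ?thesis
      using c c_lip c_bound d d_lip Bd Km Km0 m_pos \<delta>0 \<pi>\<^sub>0
      by (intro constrained_quantized_cmdp.intro constrained_quantized_cmdp_axioms.intro)
         (auto simp: sel lipschitz_cost_def)
  qed
  have s: "0 < 1 - \<beta> * K\<^sub>p" using contr by (simp add: mult.commute)
  have C0: "0 \<le> C" using c_bound X_ne a\<^sub>0 by (meson SigmaI all_not_in_conv order_trans)
  define Y where "Y = 4 * \<alpha> * (K\<^sub>c + real q * (2 * C / m) * K\<^sub>m) / (1 - \<beta> * K\<^sub>p)"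
  have value_bound: "\<bar>optimal_value \<beta> (MDP\<^sub>n n) q k - optimal_value \<beta> MDP q k\<bar> \<le> Y * (1 / real n) powr (1 / DIM('x))"
    if n: "1 \<le> n" and ne: "feasible_policies \<beta> (MDP\<^sub>n n) q k \<noteq> {}" for n
  proof -
    interpret C: constrained_quantized_cmdp MDP X A \<beta> K\<^sub>p "G n" "Q n" "\<nu> n" "\<delta> n" q k K\<^sub>l Bd K\<^sub>c K\<^sub>m C m \<pi>\<^sub>0
      by (rule model[OF n])
    have M_fin: "C.M_fin = MDP\<^sub>n n" by (simp add: C.M_fin_def MDP\<^sub>n_def)
    have "\<bar>optimal_value \<beta> (MDP\<^sub>n n) q k - optimal_value \<beta> MDP q k\<bar> \<le> C.cost_error + C * C.constraint_error / m"
      using C.optimal_value_error ne by (simp add: M_fin)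
    also have "\<dots> = 2 * \<delta> n * (K\<^sub>c + (C / m) * K\<^sub>m) / (1 - \<beta> * K\<^sub>p)"
      by (simp add: C.cost_error_def C.constraint_error_def add_divide_distrib distrib_left mult_ac)
    also have "\<dots> \<le> 4 * \<delta> n * (K\<^sub>c + real q * (2 * C / m) * K\<^sub>m) / (1 - \<beta> * K\<^sub>p)"
    proof (intro divide_right_mono mult_mono add_mono mult_right_mono)
      \<comment> \<open>The constant \<open>Y\<close> leaves a factor \<open>2\<close> on \<open>K\<^sub>c\<close> and \<open>4 q\<close> on the constraint term to spare.\<close>
      have "1 * (C / m) \<le> real q * (2 * C / m)" using q C0 m_pos by (intro mult_mono divide_right_mono) auto
      then show "C / m \<le> real q * (2 * C / m)" by simp
    qed (use s \<delta>0 C0 m_pos Km0 Kc0 in auto)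
    also have "\<dots> = Y * (1 / real n) powr (1 / DIM('x))" by (simp add: Y_def \<delta>_def mult_ac)
    finally show ?thesis .
  qed
  have "(\<lambda>n. 2 * \<delta> n * (K\<^sub>m / (1 - \<beta> * K\<^sub>p))) \<longlonglongrightarrow> 2 * (\<alpha> * 0) * (K\<^sub>m / (1 - \<beta> * K\<^sub>p))"
    unfolding \<delta>_def by (intro tendsto_intros tendsto_zero_powrI lim_1_over_n) auto
  then have "\<forall>\<^sub>F n in sequentially. 2 * \<delta> n * (K\<^sub>m / (1 - \<beta> * K\<^sub>p)) < m"
    using m_pos by (intro order_tendstoD) auto
  then have eventually_feasible: "\<forall>\<^sub>F n in sequentially. feasible_policies \<beta> (MDP\<^sub>n n) q k \<noteq> {}"
    using eventually_ge_at_top[of "1::nat"]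
  proof eventually_elim
    case (elim n)
    interpret C: constrained_quantized_cmdp MDP X A \<beta> K\<^sub>p "G n" "Q n" "\<nu> n" "\<delta> n" q k K\<^sub>l Bd K\<^sub>c K\<^sub>m C m \<pi>\<^sub>0
      by (rule model) (use elim in simp)
    have "C.M_fin = MDP\<^sub>n n" by (simp add: C.M_fin_def MDP\<^sub>n_def)
    then show ?case using C.grid_feasible elim by (simp add: C.constraint_error_def)
  qed
  show ?thesis
    unfolding Let_def C_def[symmetric] m_def[symmetric] K\<^sub>m_def[symmetric] Y_def[symmetric]
    using value_bound eventually_feasible by blast
qed

end
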